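(* Let $(X,\rho,\mu)$ be a space of homogeneous type, let $T$ be a Calderón–Zygmund operator on $X$, let $w\in A_2$ and $\sigma=w^{-1}$. Then $$\|T\|_{L^2(w)}\le C\,[w]_{A_2}^{1/2}\left([w]_{A_\infty}+[\sigma]_{A_\infty}\right)^{1/2},$$ where $\|T\|_{L^2(w)}$ is the operator norm of $T$ on $L^2(w)$ and $C$ is a constant independent of $w$ (depending only on $X$ and $T$).
   Context: Space of homogeneous type: a triple $(X,\rho,\mu)$ where $\rho$ is a quasimetric ($\rho(x,y)=0$ iff $x=y$; symmetric; $\rho(x,z)\le\kappa(\rho(x,y)+\rho(y,z))$) and $\mu$ is a positive doubling measure: $0<\mu(B(x_0,2r))\le D_\mu\,\mu(B(x_0,r))<\infty$. Dyadic cubes: a dyadic decomposition of $X$ is a family $\mathcal D=\bigcup_{k\in\mathbb Z}\mathcal D_k$ of sets with points $x_c(Q)$, $Q\in\mathcal D$, and constants $\delta>1$, $0<C_0<\infty$, $0<\varepsilon<1$ such that: $X=\bigcup_{Q\in\mathcal D_k}Q$ for each $k$; two cubes that intersect are nested; every $Q\in\mathcal D_k$ has at least one child in $\mathcal D_{k-1}$ contained in $Q$ and exactly one parent in $\mathcal D_{k+1}$ containing $Q$; $\mu(Q_2)\ge\varepsilon\mu(Q_1)$ if $Q_2$ is a child of $Q_1$; $B(x_c(Q),\delta^k)\subset Q\subset B(x_c(Q),C_0\delta^k)$ for $Q\in\mathcal D_k$. Fix finitely many dyadic decompositions (Hytönen–Kairema adjacent systems), with common constants depending only on $X$, such that every ball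 is contained in a cube, of one of them, of comparable measure. "Cube" means a member of one of these decompositions. $Mf(x)=\sup_{Q\ni x}\frac1{\mu(Q)}\int_Q|f|\,d\mu$, sup over cubes. A weight is a locally integrable function with values in $(0,\infty)$ a.e.; $w(Q)=\int_Qw\,d\mu$; $L^2(w)=L^2(X,w\,d\mu)$. $[w]_{A_2}=\sup_Q\left(\frac1{\mu(Q)}\int_Q w\,d\mu\right)\left(\frac1{\mu(Q)}\int_Q w^{-1}d\mu\right)$, $[w]_{A_\infty}=\sup_Q\frac1{w(Q)}\int_QM(w\chi_Q)\,d\mu$, sup over cubes; $w\in A_2$ means $[w]_{A_2}<\infty$. Calderón–Zygmund kernel: $K:X\times X\setminus\{x=y\}\to\mathbb R$ such that for some $\eta>0$, $C_K<\infty$ and all $x_0\ne y$, $|K(x_0,y)|\le \frac{C_K}{\mu(B(x_0,\rho(x_0,y)))}$, and whenever $\rho(x_0,x)\le\eta\rho(x_0,y)$, both $|K(x,y)-K(x_0,y)|$ and $|K(y,x)-K(y,x_0)|$ are at most $\left(\frac{\rho(x,x_0)}{\rho(x_0,y)}\right)^{\eta}\frac1{\mu(B(x_0,\rho(x_0,y)))}$. A Calderón–Zygmund operator is a linear operator $T$ bounded on $L^2(X,\mu)$ with $Tf(x)=\int_X K(x,y)f(y)\,d\mu(y)$ for $x$ outside the support of $f$. The norm bound means $\|Tf\|_{L^2(w)}\le(\cdots)\|f\|_{L^2(w)}$ for $f\in L^2(X,\mu)\cap L^2(w)$ (a dense subspace of $L^2(w)$). *)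

theory Defs
  imports "HOL-Analysis.Analysis"
begin

subsection \<open>Spaces of homogeneous type\<close>

text \<open>The underlying set of the space is \<open>X = space M\<close>; values of \<open>\<rho>\<close> outside it are irrelevant.\<close>

definition quasimetric_on :: "'a set \<Rightarrow> ('a \<Rightarrow> 'a \<Rightarrow> real) \<Rightarrow> bool" where
  "quasimetric_on X \<rho> \<longleftrightarrow>
     (\<forall>x\<in>X. \<forall>y\<in>X. 0 \<le> \<rho> x y \<and> (\<rho> x y = 0 \<longleftrightarrow> x = y) \<and> \<rho> x y = \<rho> y x) \<and>
     (\<exists>\<kappa>::real. \<forall>x\<in>X. \<forall>y\<in>X. \<forall>z\<in>X. \<rho> x z \<le> \<kappa> * (\<rho> x y + \<rho> y z))"

definition qball :: "'a set \<Rightarrow> ('a \<Rightarrow> 'a \<Rightarrow> real) \<Rightarrow> 'a \<Rightarrow> real \<Rightarrow> 'a set" where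
  "qball X \<rho> x r = {y \<in> X. \<rho> x y < r}"

text \<open>Quasimetric balls need not be open in the topology below, nor Borel.\<close>

definition qopen :: "'a set \<Rightarrow> ('a \<Rightarrow> 'a \<Rightarrow> real) \<Rightarrow> 'a set \<Rightarrow> bool" where
  "qopen X \<rho> U \<longleftrightarrow> U \<subseteq> X \<and> (\<forall>x\<in>U. \<exists>r>0. qball X \<rho> x r \<subseteq> U)"

text \<open>
  The \<open>\<sigma>\<close>-algebra of \<open>M\<close> may be the Borel one or larger (for instance its completion), but every
  measurable set must have a Borel hull of the same measure. Some such condition is part of the
  meaning of ``measure on a quasimetric space'': without it Lebesgue differentiation fails.
\<close>

definition borel_regular :: "'a measure \<Rightarrow> ('a \<Rightarrow> 'a \<Rightarrow> real) \<Rightarrow> bool" where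
  "borel_regular M \<rho> \<longleftrightarrow>
     (\<forall>U. qopen (space M) \<rho> U \<longrightarrow> U \<in> sets M) \<and>
     (\<forall>A\<in>sets M. \<exists>B\<in>sigma_sets (space M) {U. qopen (space M) \<rho> U}.
        A \<subseteq> B \<and> emeasure M B = emeasure M A)"

definition doubling_measure :: "'a measure \<Rightarrow> ('a \<Rightarrow> 'a \<Rightarrow> real) \<Rightarrow> bool" where
  "doubling_measure M \<rho> \<longleftrightarrow>
     (\<exists>D::real. \<forall>x\<in>space M. \<forall>r>0.
        qball (space M) \<rho> x r \<in> sets M \<and>
        0 < emeasure M (qball (space M) \<rho> x (2 * r)) \<and>
        emeasure M (qball (space M) \<rho> x (2 * r)) \<le> ennreal D * emeasure M (qball (space M) \<rho> x r) \<and>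
        emeasure M (qball (space M) \<rho> x r) < \<infinity>)"

definition homogeneous_type :: "'a measure \<Rightarrow> ('a \<Rightarrow> 'a \<Rightarrow> real) \<Rightarrow> bool" where
  "homogeneous_type M \<rho> \<longleftrightarrow>
     quasimetric_on (space M) \<rho> \<and> borel_regular M \<rho> \<and> doubling_measure M \<rho>"

subsection \<open>Dyadic cubes\<close>

text \<open>
  \<open>\<D> k\<close> is the family of cubes of generation \<open>k\<close>. The same set may be a cube of several
  generations, so the centre \<open>xc k Q\<close> may depend on the generation as well.
\<close>

definition dyadic_decomposition ::
    "'a measure \<Rightarrow> ('a \<Rightarrow> 'a \<Rightarrow> real) \<Rightarrow> real \<Rightarrow> real \<Rightarrow> real \<Rightarrow> (int \<Rightarrow> 'a set set) \<Rightarrow> bool" where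
  "dyadic_decomposition M \<rho> \<delta> C\<^sub>0 \<epsilon> \<D> \<longleftrightarrow>
     (\<forall>k. \<D> k \<subseteq> sets M \<and> space M = \<Union>(\<D> k)) \<and>
     (\<forall>j k. \<forall>Q\<in>\<D> j. \<forall>R\<in>\<D> k. Q \<inter> R \<noteq> {} \<longrightarrow> Q \<subseteq> R \<or> R \<subseteq> Q) \<and>
     (\<forall>k. \<forall>Q\<in>\<D> k. (\<exists>R\<in>\<D> (k - 1). R \<subseteq> Q) \<and> (\<exists>!P. P \<in> \<D> (k + 1) \<and> Q \<subseteq> P)) \<and>
     (\<forall>k. \<forall>Q\<in>\<D> k. \<forall>R\<in>\<D> (k - 1). R \<subseteq> Q \<longrightarrow> ennreal \<epsilon> * emeasure M Q \<le> emeasure M R) \<and>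
     (\<exists>xc. \<forall>k. \<forall>Q\<in>\<D> k. xc k Q \<in> space M \<and>
        qball (space M) \<rho> (xc k Q) (\<delta> powi k) \<subseteq> Q \<and>
        Q \<subseteq> qball (space M) \<rho> (xc k Q) (C\<^sub>0 * \<delta> powi k))"

definition cubes :: "(int \<Rightarrow> 'a set set) set \<Rightarrow> 'a set set" where
  "cubes S = {Q. \<exists>\<D>\<in>S. \<exists>k. Q \<in> \<D> k}"

definition adjacent_dyadic_systems ::
    "'a measure \<Rightarrow> ('a \<Rightarrow> 'a \<Rightarrow> real) \<Rightarrow> (int \<Rightarrow> 'a set set) set \<Rightarrow> bool" where
  "adjacent_dyadic_systems M \<rho> S \<longleftrightarrow>
     finite S \<and>
     (\<exists>\<delta> C\<^sub>0 \<epsilon>. 1 < \<delta> \<and> 0 < C\<^sub>0 \<and> 0 < \<epsilon> \<and> \<epsilon> < 1 \<and>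
        (\<forall>\<D>\<in>S. dyadic_decomposition M \<rho> \<delta> C\<^sub>0 \<epsilon> \<D>)) \<and>
     (\<exists>A::real. \<forall>x\<in>space M. \<forall>r>0. \<exists>Q\<in>cubes S.
        qball (space M) \<rho> x r \<subseteq> Q \<and>
        emeasure M Q \<le> ennreal A * emeasure M (qball (space M) \<rho> x r))"

subsection \<open>Maximal function and weights\<close>

definition cube_maximal ::
    "'a measure \<Rightarrow> (int \<Rightarrow> 'a set set) set \<Rightarrow> ('a \<Rightarrow> real) \<Rightarrow> 'a \<Rightarrow> ennreal" where
  "cube_maximal M S f x =
     (SUP Q\<in>{Q \<in> cubes S. x \<in> Q}. (\<integral>\<^sup>+y\<in>Q. ennreal \<bar>f y\<bar> \<partial>M) / emeasure M Q)"

definition weight :: "'a measure \<Rightarrow> ('a \<Rightarrow> 'a \<Rightarrow> real) \<Rightarrow> ('a \<Rightarrow> real) \<Rightarrow> bool" where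
  "weight M \<rho> w \<longleftrightarrow>
     w \<in> borel_measurable M \<and> (AE x in M. 0 < w x) \<and>
     (\<forall>x\<in>space M. \<forall>r>0. set_integrable M (qball (space M) \<rho> x r) w)"

definition A2_const :: "'a measure \<Rightarrow> (int \<Rightarrow> 'a set set) set \<Rightarrow> ('a \<Rightarrow> real) \<Rightarrow> ennreal" where
  "A2_const M S w =
     (SUP Q\<in>cubes S. ((\<integral>\<^sup>+x\<in>Q. ennreal (w x) \<partial>M) / emeasure M Q) *
                      ((\<integral>\<^sup>+x\<in>Q. ennreal (inverse (w x)) \<partial>M) / emeasure M Q))"

definition Ainf_const :: "'a measure \<Rightarrow> (int \<Rightarrow> 'a set set) set \<Rightarrow> ('a \<Rightarrow> real) \<Rightarrow> ennreal" where
  "Ainf_const M S w =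
     (SUP Q\<in>cubes S. (\<integral>\<^sup>+x\<in>Q. cube_maximal M S (\<lambda>y. w y * indicator Q y) x \<partial>M) /
                      (\<integral>\<^sup>+x\<in>Q. ennreal (w x) \<partial>M))"

definition A2_weight ::
    "'a measure \<Rightarrow> ('a \<Rightarrow> 'a \<Rightarrow> real) \<Rightarrow> (int \<Rightarrow> 'a set set) set \<Rightarrow> ('a \<Rightarrow> real) \<Rightarrow> bool" where
  "A2_weight M \<rho> S w \<longleftrightarrow> weight M \<rho> w \<and> A2_const M S w < \<infinity>"

subsection \<open>\<open>L\<^sup>2\<close> spaces\<close>

text \<open>Elements of \<open>L\<^sup>2\<close> are represented by functions; equality in \<open>L\<^sup>2\<close> is equality a.e.\<close>

definition ennreal_sqrt :: "ennreal \<Rightarrow> ennreal" where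
  "ennreal_sqrt a = (if a = \<infinity> then \<infinity> else ennreal (sqrt (enn2real a)))"

definition L2_norm :: "'a measure \<Rightarrow> ('a \<Rightarrow> real) \<Rightarrow> ennreal" where
  "L2_norm N f = ennreal_sqrt (\<integral>\<^sup>+x. ennreal ((f x)\<^sup>2) \<partial>N)"

definition L2_space :: "'a measure \<Rightarrow> ('a \<Rightarrow> real) set" where
  "L2_space N = {f \<in> borel_measurable N. L2_norm N f < \<infinity>}"

definition weighted :: "'a measure \<Rightarrow> ('a \<Rightarrow> real) \<Rightarrow> 'a measure" where
  "weighted M w = density M (\<lambda>x. ennreal (w x))"

text \<open>The complement of the largest open set on which \<open>f\<close> vanishes almost everywhere.\<close>

definition ae_support :: "'a measure \<Rightarrow> ('a \<Rightarrow> 'a \<Rightarrow> real) \<Rightarrow> ('a \<Rightarrow> real) \<Rightarrow> 'a set" where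
  "ae_support M \<rho> f =
     space M - \<Union>{U. qopen (space M) \<rho> U \<and> (AE y in M. y \<in> U \<longrightarrow> f y = 0)}"

subsection \<open>Calderon--Zygmund operators\<close>

text \<open>
  Kernels are total functions whose values on the diagonal are unconstrained. The guard \<open>x \<noteq> y\<close> in
  the smoothness condition matters only if \<open>\<eta>\<close> is large; \<open>K x y\<close> is undefined there otherwise.
\<close>

definition cz_kernel ::
    "'a measure \<Rightarrow> ('a \<Rightarrow> 'a \<Rightarrow> real) \<Rightarrow> ('a \<Rightarrow> 'a \<Rightarrow> real) \<Rightarrow> bool" where
  "cz_kernel M \<rho> K \<longleftrightarrow>
     (\<exists>(\<eta>::real) (C\<^sub>K::real). 0 < \<eta> \<and>
        (\<forall>x\<^sub>0\<in>space M. \<forall>y\<in>space M. x\<^sub>0 \<noteq> y \<longrightarrow>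
           \<bar>K x\<^sub>0 y\<bar> \<le> C\<^sub>K / measure M (qball (space M) \<rho> x\<^sub>0 (\<rho> x\<^sub>0 y)) \<and>
           (\<forall>x\<in>space M. x \<noteq> y \<longrightarrow> \<rho> x\<^sub>0 x \<le> \<eta> * \<rho> x\<^sub>0 y \<longrightarrow>
              \<bar>K x y - K x\<^sub>0 y\<bar> \<le>
                (\<rho> x x\<^sub>0 / \<rho> x\<^sub>0 y) powr \<eta> * (1 / measure M (qball (space M) \<rho> x\<^sub>0 (\<rho> x\<^sub>0 y))) \<and>
              \<bar>K y x - K y x\<^sub>0\<bar> \<le>
                (\<rho> x x\<^sub>0 / \<rho> x\<^sub>0 y) powr \<eta> * (1 / measure M (qball (space M) \<rho> x\<^sub>0 (\<rho> x\<^sub>0 y))))))"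

text \<open>
  An operator on \<open>L\<^sup>2(X,\<mu>)\<close> acts on representatives; linearity holds a.e., and together with
  boundedness this makes it well defined on a.e.-classes.
\<close>

definition bounded_operator_L2 :: "'a measure \<Rightarrow> (('a \<Rightarrow> real) \<Rightarrow> 'a \<Rightarrow> real) \<Rightarrow> bool" where
  "bounded_operator_L2 M T \<longleftrightarrow>
     (\<forall>f\<in>L2_space M. T f \<in> L2_space M) \<and>
     (\<forall>f\<in>L2_space M. \<forall>g\<in>L2_space M. \<forall>a b.
        AE x in M. T (\<lambda>y. a * f y + b * g y) x = a * T f x + b * T g x) \<and>
     (\<exists>B::real. \<forall>f\<in>L2_space M. L2_norm M (T f) \<le> ennreal B * L2_norm M f)"

definition cz_operator ::
    "'a measure \<Rightarrow> ('a \<Rightarrow> 'a \<Rightarrow> real) \<Rightarrow> (('a \<Rightarrow> real) \<Rightarrow> 'a \<Rightarrow> real) \<Rightarrow> bool" where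
  "cz_operator M \<rho> T \<longleftrightarrow>
     bounded_operator_L2 M T \<and>
     (\<exists>K. cz_kernel M \<rho> K \<and>
        (\<forall>f\<in>L2_space M. AE x in M. x \<notin> ae_support M \<rho> f \<longrightarrow>
           T f x = (LINT y|M. K x y * f y)))"

end

theory Submission
  imports Defs
begin

text \<open>
  The operator is dominated pointwise by a sparse operator, following the approach of Lerner and
  Ombrosi: with \<open>Q\<^sup>*\<close> a cube of comparable measure containing a large dilate of \<open>Q\<close>, the weak type
  \<open>(1,1)\<close> inequalities for \<open>T\<close> and \<open>M\<close> show that \<open>T(f \<chi>\<^bsub>Q\<^sup>*\<^esub>)\<close> is at most a multiple of the average of
  \<open>\<bar>f\<bar>\<close> over \<open>Q\<^sup>*\<close> outside a small subset of \<open>Q\<close>. That subset is covered by stopping cubes \<open>P\<close>, on which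
  the smoothness of the kernel allows \<open>Q\<^sup>*\<close> to be replaced by \<open>P\<^sup>*\<close>, and one iterates.

  Testing the sparse operator against itself leads to a bilinear form. Organizing its terms by the
  principal cubes of both functions reduces it to a testing estimate for
  \<open>\<Sum> \<sigma>(R)/\<mu>(R) \<chi>\<^sub>R\<close> in \<open>L\<^sup>2(w)\<close>. Expanding the square there, the \<open>A\<^sub>2\<close> constant is used once, and the remaining
  sum \<open>\<Sum> \<sigma>(R)\<close> over a sparse family is bounded by the integral of a maximal function, that is, by the
  \<open>A\<^sub>\<infinity>\<close> constant of \<open>\<sigma>\<close>.
\<close>

subsection \<open>Spaces of homogeneous type and dyadic cubes\<close>

text \<open>The dominating cubes lie in one dyadic system, but the averages live on enlarged cubes
  \<open>star Q\<close>, which may belong to any system of \<open>S\<close> and need not be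
  distinct. Sparseness is therefore kept on the original cubes, through disjoint sets
  \<open>E P\<close> inside \<open>P\<close>; the enlarged cubes only inherit Carleson packing
  conditions, and nestedness is recovered by distributing the sum over the finitely many systems.

  The exponent 1/2 comes from a quadratic estimate without duality. If \<open>g\<close> is a finite
  sparse sum for \<open>f\<close>, the integral of \<open>g^2\<close> against \<open>w\<close> is
  bounded by bilinear forms in \<open>\<bar>f\<bar> * w\<close> and \<open>g\<close>. Each is at
  most a constant times \<open>a2 * ainf * t\<close> times the squared norm of \<open>f\<close>,
  plus \<open>128 / t\<close> times that of \<open>g\<close>. A large fixed \<open>t\<close> allows
  the last terms to be absorbed, their finiteness being clear for a finite family, and what remains
  is linear in \<open>a2 * ainf\<close>.

  \<open>T f\<close> is determined only almost everywhere, so values on a stopping cube are compared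
  with a number, the kernel integral taken at the centre of the cube.\<close>

locale homogeneous_space =
  fixes M :: "'a measure" and \<rho> :: "'a \<Rightarrow> 'a \<Rightarrow> real" and \<kappa> D :: real
  assumes rho_nonneg: "x \<in> space M \<Longrightarrow> y \<in> space M \<Longrightarrow> 0 \<le> \<rho> x y"
    and rho_eq_0: "x \<in> space M \<Longrightarrow> y \<in> space M \<Longrightarrow> \<rho> x y = 0 \<longleftrightarrow> x = y"
    and rho_sym: "x \<in> space M \<Longrightarrow> y \<in> space M \<Longrightarrow> \<rho> x y = \<rho> y x"
    and rho_triangle: "x \<in> space M \<Longrightarrow> y \<in> space M \<Longrightarrow> z \<in> space M \<Longrightarrow> \<rho> x z \<le> \<kappa> * (\<rho> x y + \<rho> y z)"
    and kappa_ge_1: "1 \<le> \<kappa>"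
    and regular: "borel_regular M \<rho>"
    and ball_sets [measurable]: "x \<in> space M \<Longrightarrow> 0 < r \<Longrightarrow> qball (space M) \<rho> x r \<in> sets M"
    and ball_pos: "x \<in> space M \<Longrightarrow> 0 < r \<Longrightarrow> 0 < measure M (qball (space M) \<rho> x r)"
    and ball_finite: "x \<in> space M \<Longrightarrow> 0 < r \<Longrightarrow> emeasure M (qball (space M) \<rho> x r) < \<infinity>"
    and doubling: "x \<in> space M \<Longrightarrow> 0 < r \<Longrightarrow>
      measure M (qball (space M) \<rho> x (2 * r)) \<le> D * measure M (qball (space M) \<rho> x r)"
begin

abbreviation "X \<equiv> space M"
abbreviation "bl \<equiv> qball (space M) \<rho>"
abbreviation "mu \<equiv> measure M"

lemma ball_fmeasurable: "x \<in> X \<Longrightarrow> 0 < r \<Longrightarrow> bl x r \<in> fmeasurable M"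
  by (simp add: fmeasurable_def ball_finite[unfolded infinity_ennreal_def] ball_sets)

lemma ball_mono: "r \<le> s \<Longrightarrow> bl x r \<subseteq> bl x s"
  by (auto simp: qball_def)

lemma mem_ball: "y \<in> bl x r \<longleftrightarrow> y \<in> X \<and> \<rho> x y < r"
  by (auto simp: qball_def)

lemma center_in_ball: "x \<in> X \<Longrightarrow> 0 < r \<Longrightarrow> x \<in> bl x r"
  using rho_eq_0[of x x] by (simp add: mem_ball)

lemma D_pos: "x \<in> X \<Longrightarrow> 0 < D"
proof -
  assume x: "x \<in> X"
  have "0 < mu (bl x 2)" "0 < mu (bl x 1)" "mu (bl x 2) \<le> D * mu (bl x 1)"
    using x ball_pos[of x 2] ball_pos[of x 1] doubling[of x 1] by auto
  then show "0 < D"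
    by (smt (verit) mult_nonneg_nonneg mult_nonpos_nonneg)
qed

lemma doubling_pow: "x \<in> X \<Longrightarrow> 0 < r \<Longrightarrow> mu (bl x (2 ^ n * r)) \<le> D ^ n * mu (bl x r)"
proof (induction n)
  case (Suc n)
  have "mu (bl x (2 ^ Suc n * r)) \<le> D * mu (bl x (2 ^ n * r))"
    using doubling[of x "2 ^ n * r"] Suc by (simp add: mult.assoc)
  also have "\<dots> \<le> D * (D ^ n * mu (bl x r))"
    using Suc D_pos[of x] by (intro mult_left_mono) auto
  finally show ?case by (simp add: mult.assoc)
qed auto

lemma doubling_scale:
  obtains c where "0 < c" "\<And>x r. x \<in> X \<Longrightarrow> 0 < r \<Longrightarrow> mu (bl x (L * r)) \<le> c * mu (bl x r)"
proof -
  obtain n where "L < 2 ^ n"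
    using real_arch_pow[of 2 L] by auto
  then have n: "L \<le> 2 ^ n" by simp
  show thesis
  \<comment> \<open>The maximum keeps the constant positive when \<open>X\<close> is empty:
    \<open>D_pos\<close> needs a point.\<close>
  proof (rule that[of "max 1 (D ^ n)"])
    fix x r assume x: "x \<in> X" "0 < (r::real)"
    have "mu (bl x (L * r)) \<le> mu (bl x (2 ^ n * r))"
    proof (rule measure_mono_fmeasurable)
      show "bl x (L * r) \<subseteq> bl x (2 ^ n * r)"
        using n x by (intro ball_mono mult_right_mono) auto
      show "bl x (2 ^ n * r) \<in> fmeasurable M" using x by (intro ball_fmeasurable) auto
      show "bl x (L * r) \<in> sets M"
      proof (cases "0 < L * r")
        case False
        then have "bl x (L * r) = {}"
          using x rho_nonneg[of x] by (force simp: qball_def)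
        then show ?thesis by simp
      qed (use x in simp)
    qed
    also have "\<dots> \<le> D ^ n * mu (bl x r)" using doubling_pow x by auto
    also have "\<dots> \<le> max 1 (D ^ n) * mu (bl x r)" by (intro mult_right_mono) auto
    finally show "mu (bl x (L * r)) \<le> max 1 (D ^ n) * mu (bl x r)" .
  qed auto
qed

lemma qopen_measurable: "qopen X \<rho> U \<Longrightarrow> U \<in> sets M"
  using regular by (auto simp: borel_regular_def)

lemma space_eq_UN_balls: "x \<in> X \<Longrightarrow> X = (\<Union>n. bl x (real n + 1))"
proof -
  assume "x \<in> X"
  have "\<exists>n. \<rho> x y < real n + 1" for y
    using reals_Archimedean2[of "\<rho> x y"] by (meson less_add_one less_trans)
  then show ?thesis by (auto simp: qball_def)
qed

definition qinterior :: "'a set \<Rightarrow> 'a set" where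
  "qinterior A = {x \<in> X. \<exists>r>0. bl x r \<subseteq> A}"

text \<open>Balls may fail to be open, but this one-step interior is open: by the quasitriangle
  inequality, balls of radius \<open>r / (2 * \<kappa>)\<close> about points of
  \<open>bl x (r / (2 * \<kappa>))\<close> stay inside \<open>bl x r\<close>.\<close>

lemma qopen_qinterior: "qopen X \<rho> (qinterior A)"
  unfolding qopen_def
proof (intro conjI ballI)
  fix x assume "x \<in> qinterior A"
  then obtain r where r: "x \<in> X" "0 < r" "bl x r \<subseteq> A" by (auto simp: qinterior_def)
  have "bl x (r / (2 * \<kappa>)) \<subseteq> qinterior A"
  proof
    fix y assume y: "y \<in> bl x (r / (2 * \<kappa>))"
    have "bl y (r / (2 * \<kappa>)) \<subseteq> bl x r"
    proof
      fix z assume z: "z \<in> bl y (r / (2 * \<kappa>))"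
      have "\<rho> x z \<le> \<kappa> * (\<rho> x y + \<rho> y z)"
        using y z r by (intro rho_triangle) (auto simp: mem_ball)
      also have "\<dots> < \<kappa> * (r / (2 * \<kappa>) + r / (2 * \<kappa>))"
        using y z kappa_ge_1 by (intro mult_strict_left_mono add_strict_mono) (auto simp: mem_ball)
      also have "\<dots> = r" using kappa_ge_1 by (simp add: field_simps)
      finally show "z \<in> bl x r" using z by (simp add: mem_ball)
    qed
    then show "y \<in> qinterior A"
      using y r kappa_ge_1 unfolding qinterior_def mem_ball
      by (auto intro!: exI[of _ "r / (2 * \<kappa>)"])
  qed
  then show "\<exists>r>0. bl x r \<subseteq> qinterior A"
    using r kappa_ge_1 by (intro exI[of _ "r / (2 * \<kappa>)"]) auto
qed (auto simp: qinterior_def)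

lemma qinterior_subset: "qinterior A \<subseteq> A"
proof
  fix x assume "x \<in> qinterior A"
  then obtain r where r: "x \<in> X" "0 < r" "bl x r \<subseteq> A" by (auto simp: qinterior_def)
  then show "x \<in> A" using center_in_ball[of x r] by auto
qed

end

section \<open>One dyadic system: nestedness, countability and maximal cubes\<close>

locale dyadic_space = homogeneous_space M \<rho> \<kappa> D
  for M :: "'a measure" and \<rho> \<kappa> D +
  fixes \<D> :: "int \<Rightarrow> 'a set set" and \<delta> C0 \<epsilon> :: real
  assumes dyadic: "dyadic_decomposition M \<rho> \<delta> C0 \<epsilon> \<D>"
    and delta_gt_1: "1 < \<delta>" and C0_pos: "0 < C0" and eps_pos: "0 < \<epsilon>" and eps_lt_1: "\<epsilon> < 1"
begin

definition "\<Q> = (\<Union>k. \<D> k)"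

lemma generation_sets: "Q \<in> \<D> k \<Longrightarrow> Q \<in> sets M"
  using dyadic by (auto simp: dyadic_decomposition_def)

lemma generation_cover: "X = \<Union>(\<D> k)"
  using dyadic by (auto simp: dyadic_decomposition_def)

lemma generation_nested: "Q \<in> \<D> j \<Longrightarrow> R \<in> \<D> k \<Longrightarrow> Q \<inter> R \<noteq> {} \<Longrightarrow> Q \<subseteq> R \<or> R \<subseteq> Q"
  using dyadic unfolding dyadic_decomposition_def by meson

lemma child_ex: "Q \<in> \<D> k \<Longrightarrow> \<exists>R\<in>\<D> (k - 1). R \<subseteq> Q"
  using dyadic unfolding dyadic_decomposition_def by meson

lemma parent_ex1: "Q \<in> \<D> k \<Longrightarrow> \<exists>!P. P \<in> \<D> (k + 1) \<and> Q \<subseteq> P"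
proof -
  have "\<forall>k. \<forall>Q\<in>\<D> k. (\<exists>R\<in>\<D> (k - 1). R \<subseteq> Q) \<and> (\<exists>!P. P \<in> \<D> (k + 1) \<and> Q \<subseteq> P)"
    using dyadic unfolding dyadic_decomposition_def by (elim conjE) assumption
  then show "Q \<in> \<D> k \<Longrightarrow> \<exists>!P. P \<in> \<D> (k + 1) \<and> Q \<subseteq> P" by (elim allE[of _ k]) simp
qed

lemma child_measure:
  "Q \<in> \<D> k \<Longrightarrow> R \<in> \<D> (k - 1) \<Longrightarrow> R \<subseteq> Q \<Longrightarrow> ennreal \<epsilon> * emeasure M Q \<le> emeasure M R"
  using dyadic unfolding dyadic_decomposition_def by meson

lemma cube_center:
  assumes "Q \<in> \<D> k"
  obtains z where "z \<in> X" "bl z (\<delta> powi k) \<subseteq> Q" "Q \<subseteq> bl z (C0 * \<delta> powi k)"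
  using dyadic assms unfolding dyadic_decomposition_def by meson

lemma delta_powi_pos: "0 < \<delta> powi k"
  using delta_gt_1 by simp

lemma generation_fmeasurable: "Q \<in> \<D> k \<Longrightarrow> Q \<in> fmeasurable M"
proof -
  assume Q: "Q \<in> \<D> k"
  then obtain z where z: "z \<in> X" "Q \<subseteq> bl z (C0 * \<delta> powi k)" by (rule cube_center)
  have "bl z (C0 * \<delta> powi k) \<in> fmeasurable M"
    using z C0_pos delta_powi_pos by (intro ball_fmeasurable) auto
  then show ?thesis
    using z generation_sets[OF Q] by (meson fmeasurableI2)
qed

lemma generation_measure_pos: "Q \<in> \<D> k \<Longrightarrow> 0 < mu Q"
proof -
  assume Q: "Q \<in> \<D> k"
  then obtain z where z: "z \<in> X" "bl z (\<delta> powi k) \<subseteq> Q" by (rule cube_center)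
  have "0 < mu (bl z (\<delta> powi k))" using z delta_powi_pos by (intro ball_pos) auto
  also have "\<dots> \<le> mu Q"
    using z generation_fmeasurable[OF Q] delta_powi_pos by (intro measure_mono_fmeasurable) auto
  finally show ?thesis .
qed

lemma cube_fmeasurable: "Q \<in> \<Q> \<Longrightarrow> Q \<in> fmeasurable M"
  using generation_fmeasurable by (auto simp: \<Q>_def)

lemma cube_sets [measurable]: "Q \<in> \<Q> \<Longrightarrow> Q \<in> sets M"
  using generation_sets by (auto simp: \<Q>_def)

lemma cube_measure_pos: "Q \<in> \<Q> \<Longrightarrow> 0 < mu Q"
  using generation_measure_pos by (auto simp: \<Q>_def)

lemma cube_nonempty: "Q \<in> \<Q> \<Longrightarrow> Q \<noteq> {}"
  using cube_measure_pos by fastforce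

lemma cube_subset_space: "Q \<in> \<Q> \<Longrightarrow> Q \<subseteq> X"
  using cube_sets sets.sets_into_space by blast

lemma cube_nested: "Q \<in> \<Q> \<Longrightarrow> R \<in> \<Q> \<Longrightarrow> Q \<inter> R \<noteq> {} \<Longrightarrow> Q \<subseteq> R \<or> R \<subseteq> Q"
  using generation_nested by (auto simp: \<Q>_def) blast

text \<open>Uniqueness of the parent forces the cubes of one generation to be disjoint: a child of the
  smaller of two nested cubes of generation \<open>k\<close> would have both of them as parents.\<close>

lemma same_generation_subset:
  assumes "Q \<in> \<D> k" "R \<in> \<D> k" "Q \<subseteq> R" shows "Q = R"
proof -
  obtain P where P: "P \<in> \<D> (k - 1)" "P \<subseteq> Q" using child_ex[OF assms(1)] by auto
  have "\<exists>!R. R \<in> \<D> k \<and> P \<subseteq> R" using parent_ex1[OF P(1)] by simp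
  moreover have "Q \<in> \<D> k \<and> P \<subseteq> Q" "R \<in> \<D> k \<and> P \<subseteq> R" using assms P(2) by auto
  ultimately show ?thesis by blast
qed

lemma same_generation_eq: "Q \<in> \<D> k \<Longrightarrow> R \<in> \<D> k \<Longrightarrow> Q \<inter> R \<noteq> {} \<Longrightarrow> Q = R"
  using generation_nested same_generation_subset by metis

lemma ancestor_ex:
  assumes "j \<le> k" "Q \<in> \<D> j" shows "\<exists>P\<in>\<D> k. Q \<subseteq> P"
  using assms(1)
proof (induction k rule: int_ge_induct)
  case base
  then show ?case using assms by auto
next
  case (step i)
  then obtain P where "P \<in> \<D> i" "Q \<subseteq> P" by auto
  then show ?case using parent_ex1[of P i] by blast
qed

lemma generation_le_subset:
  assumes "j \<le> k" "Q \<in> \<D> j" "R \<in> \<D> k" "Q \<inter> R \<noteq> {}" shows "Q \<subseteq> R"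
proof -
  obtain P where P: "P \<in> \<D> k" "Q \<subseteq> P" using ancestor_ex assms by blast
  then have "P = R" using same_generation_eq[of P k R] assms by blast
  then show ?thesis using P by auto
qed

text \<open>The cubes are disjoint, so the masses they have in a ball of finite measure are summable
  and only countably many are nonzero. Countably many balls exhaust \<open>X\<close>, and a cube of
  positive measure has positive mass in one of them.\<close>

lemma countable_generation: "countable (\<D> k)"
proof (cases "X = {}")
  case True
  then have "\<D> k \<subseteq> {{}}" using generation_cover[of k] by auto
  then show ?thesis using countable_subset by fastforce
next
  case False
  then obtain x where x: "x \<in> X" by auto
  define B where "B n = bl x (real n + 1)" for n
  have B: "B n \<in> fmeasurable M" for n unfolding B_def using x by (intro ball_fmeasurable) auto
  have cnt: "countable {Q \<in> \<D> k. mu (Q \<inter> B n) \<noteq> 0}" for n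
  proof -
    have "(\<lambda>Q. mu (Q \<inter> B n)) summable_on \<D> k"
    proof (rule nonneg_bdd_above_summable_on)
      show "bdd_above (sum (\<lambda>Q. mu (Q \<inter> B n)) ` {F. F \<subseteq> \<D> k \<and> finite F})"
      proof (rule bdd_aboveI2)
        fix F assume F: "F \<in> {F. F \<subseteq> \<D> k \<and> finite F}"
        have "sum (\<lambda>Q. mu (Q \<inter> B n)) F = mu (\<Union>Q\<in>F. Q \<inter> B n)"
        proof (rule measure_UNION'[symmetric])
          show "pairwise (\<lambda>Q Q'. disjnt (Q \<inter> B n) (Q' \<inter> B n)) F"
            using F same_generation_eq by (auto simp: pairwise_def disjnt_def)
          fix Q assume "Q \<in> F"
          then have "Q \<in> fmeasurable M" using F generation_fmeasurable by auto
          then show "Q \<inter> B n \<in> fmeasurable M" using B by (rule fmeasurable.Int)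
        qed (use F in auto)
        also have "\<dots> \<le> mu (B n)"
          using F B generation_sets fmeasurableD[OF B[of n]]
          by (intro measure_mono_fmeasurable sets.finite_UN sets.Int) blast+
        finally show "sum (\<lambda>Q. mu (Q \<inter> B n)) F \<le> mu (B n)" .
      qed
    qed auto
    then show ?thesis using summable_countable_real by blast
  qed
  have "\<exists>n. mu (Q \<inter> B n) \<noteq> 0" if Q: "Q \<in> \<D> k" for Q
  proof (rule ccontr)
    assume "\<not> ?thesis"
    then have "mu (Q \<inter> B n) = 0" for n by auto
    moreover have "Q \<inter> B n \<in> fmeasurable M" for n
      using B generation_fmeasurable[OF Q] by (intro fmeasurable.Int)
    ultimately have "Q \<inter> B n \<in> null_sets M" for n
      by (intro null_setsI) (simp_all add: emeasure_eq_measure2 fmeasurableD)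
    then have "(\<Union>n. Q \<inter> B n) \<in> null_sets M" by (rule null_sets_UN)
    moreover have "(\<Union>n. Q \<inter> B n) = Q"
    proof -
      have "X = (\<Union>n. B n)" unfolding B_def by (rule space_eq_UN_balls[OF x])
      then have "Q \<subseteq> (\<Union>n. B n)" using sets.sets_into_space[OF generation_sets[OF Q]] by simp
      then show ?thesis by auto
    qed
    ultimately have "mu Q = 0" by (simp add: null_setsD1 measure_def)
    then show False using generation_measure_pos[OF Q] by auto
  qed
  then have "\<D> k \<subseteq> (\<Union>n. {Q \<in> \<D> k. mu (Q \<inter> B n) \<noteq> 0})" by auto
  then show ?thesis using cnt using cnt by (elim countable_subset) (rule countable_UN, auto)
qed

lemma countable_cubes: "countable \<Q>"
  using countable_generation by (auto simp: \<Q>_def)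

text \<open>A set may be a cube of many generations, so generations alone do not count the sets. A
  generation of \<open>R\<close> at or below that of \<open>P\<close> forces \<open>R = P\<close>,
  one at or above that of \<open>Q\<close> forces \<open>R = Q\<close>, and each generation in
  between contains at most one cube around \<open>P\<close>.\<close>

lemma finite_between:
  assumes P: "P \<in> \<Q>" and Q: "Q \<in> \<Q>" shows "finite {R \<in> \<Q>. P \<subseteq> R \<and> R \<subseteq> Q}"
proof -
  obtain i k where i: "P \<in> \<D> i" and k: "Q \<in> \<D> k" using P Q by (auto simp: \<Q>_def)
  have ne: "P \<noteq> {}" using P cube_nonempty by auto
  have "{R \<in> \<Q>. P \<subseteq> R \<and> R \<subseteq> Q} \<subseteq> {P, Q} \<union> (\<Union>l\<in>{i..k}. {R \<in> \<D> l. P \<subseteq> R})"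
  proof
    fix R assume R: "R \<in> {R \<in> \<Q>. P \<subseteq> R \<and> R \<subseteq> Q}"
    then obtain l where l: "R \<in> \<D> l" by (auto simp: \<Q>_def)
    have "R \<inter> P \<noteq> {}" "Q \<inter> R \<noteq> {}" using R ne by auto
    then have "l \<le> i \<Longrightarrow> R = P" "k \<le> l \<Longrightarrow> R = Q"
      using generation_le_subset[of l i R P] generation_le_subset[of k l Q R] i k l R by auto
    then show "R \<in> {P, Q} \<union> (\<Union>l\<in>{i..k}. {R \<in> \<D> l. P \<subseteq> R})"
      using R l by (cases "l \<le> i"; cases "k \<le> l") auto
  qed
  moreover have "finite {R \<in> \<D> l. P \<subseteq> R}" for l
  proof (cases "\<exists>R. R \<in> \<D> l \<and> P \<subseteq> R")
    case True
    then obtain R where R: "R \<in> \<D> l" "P \<subseteq> R" by auto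
    have "{R \<in> \<D> l. P \<subseteq> R} \<subseteq> {R}"
    proof
      fix R' assume "R' \<in> {R \<in> \<D> l. P \<subseteq> R}"
      then show "R' \<in> {R}" using same_generation_eq[of R' l R] R ne by auto
    qed
    then show ?thesis using finite_subset by auto
  next
    case False
    then have "{R \<in> \<D> l. P \<subseteq> R} = {}" by auto
    then show ?thesis by (metis finite.emptyI)
  qed
  ultimately show ?thesis by (elim finite_subset) simp
qed

definition maximal_cubes :: "'a set set \<Rightarrow> 'a set set" where
  "maximal_cubes \<C> = {P \<in> \<C>. \<forall>R\<in>\<C>. P \<subseteq> R \<longrightarrow> R = P}"

lemma maximal_cubes_subset: "maximal_cubes \<C> \<subseteq> \<C>"
  by (auto simp: maximal_cubes_def)

text \<open>Ascending chains stop because only finitely many cubes lie between \<open>P\<close> and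
  the common bound \<open>Q\<close>.\<close>

lemma maximal_cubes_cover:
  assumes "\<C> \<subseteq> \<Q>" "\<And>P. P \<in> \<C> \<Longrightarrow> P \<subseteq> Q" "Q \<in> \<Q>" "P \<in> \<C>"
  shows "\<exists>R\<in>maximal_cubes \<C>. P \<subseteq> R"
proof -
  have "finite {R \<in> \<C>. P \<subseteq> R}"
    by (rule finite_subset[OF _ finite_between[of P Q]]) (use assms in auto)
  then obtain R where "R \<in> {R \<in> \<C>. P \<subseteq> R}" "\<forall>R'\<in>{R \<in> \<C>. P \<subseteq> R}. R \<subseteq> R' \<longrightarrow> R = R'"
    using finite_has_maximal2[of "{R \<in> \<C>. P \<subseteq> R}" P] assms by auto
  then show ?thesis unfolding maximal_cubes_def by blast
qed

lemma maximal_cubes_disjoint: "\<C> \<subseteq> \<Q> \<Longrightarrow> disjoint (maximal_cubes \<C>)"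
proof (intro pairwiseI)
  assume \<C>: "\<C> \<subseteq> \<Q>"
  fix P R assume PR: "P \<in> maximal_cubes \<C>" "R \<in> maximal_cubes \<C>" "P \<noteq> R"
  then have "P \<in> \<C>" "R \<in> \<C>" "P \<subseteq> R \<Longrightarrow> R = P" "R \<subseteq> P \<Longrightarrow> P = R"
    by (auto simp: maximal_cubes_def)
  then show "disjnt P R"
    using cube_nested[of P R] \<C> PR(3) by (auto simp: disjnt_def)
qed

lemma maximal_cubes_Union:
  assumes "\<C> \<subseteq> \<Q>" "\<And>P. P \<in> \<C> \<Longrightarrow> P \<subseteq> Q" "Q \<in> \<Q>"
  shows "\<Union>(maximal_cubes \<C>) = \<Union>\<C>"
  using maximal_cubes_cover[OF assms] maximal_cubes_subset[of \<C>] by blast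

text \<open>The parent of \<open>P\<close> may be \<open>P\<close> itself as a set. Taking the
  largest generation to which \<open>P\<close> belongs makes the parent strictly larger, while the
  child condition still compares the measures.\<close>

lemma parent_strict:
  assumes "P \<in> \<Q>" "Q \<in> \<Q>" "P \<subset> Q"
  obtains R where "R \<in> \<Q>" "P \<subset> R" "R \<subseteq> Q" "\<epsilon> * mu R \<le> mu P"
proof -
  obtain k where k: "Q \<in> \<D> k" using assms by (auto simp: \<Q>_def)
  obtain i0 where i0: "P \<in> \<D> i0" using assms by (auto simp: \<Q>_def)
  have ne: "P \<noteq> {}" using assms(1) by (rule cube_nonempty)
  \<comment> \<open>A generation at or above that of \<open>Q\<close> would give
    \<open>Q \<subseteq> P\<close>; this bound makes the greatest generation exist.\<close>
  have bound: "i < k" if "P \<in> \<D> i" for i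
  proof (rule ccontr)
    assume "\<not> i < k"
    have "P \<subseteq> Q" "P \<noteq> Q" using assms(3) by auto
    with ne have "Q \<inter> P \<noteq> {}" by (simp add: Int_absorb1)
    with \<open>\<not> i < k\<close> have "Q \<subseteq> P" by (intro generation_le_subset[OF _ k that]) simp_all
    with \<open>P \<subseteq> Q\<close> \<open>P \<noteq> Q\<close> show False by simp
  qed
  define n where "n = (GREATEST n. P \<in> \<D> (i0 + int n))"
  have bn: "\<forall>n. P \<in> \<D> (i0 + int n) \<longrightarrow> n \<le> nat (k - i0)"
  proof (intro allI impI)
    fix n assume "P \<in> \<D> (i0 + int n)"
    from bound[OF this] show "n \<le> nat (k - i0)" by linarith
  qed
  have "P \<in> \<D> (i0 + int n)" unfolding n_def
    by (rule GreatestI_nat[of "\<lambda>n. P \<in> \<D> (i0 + int n)" 0 "nat (k - i0)"]) (use i0 bn in auto)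
  moreover have "P \<notin> \<D> (i0 + int n + 1)"
  proof
    assume "P \<in> \<D> (i0 + int n + 1)"
    then have "P \<in> \<D> (i0 + int (Suc n))" by (simp add: algebra_simps)
    then have "Suc n \<le> n" unfolding n_def
      by (rule Greatest_le_nat[of "\<lambda>n. P \<in> \<D> (i0 + int n)" _ "nat (k - i0)"]) (use bn in auto)
    then show False by simp
  qed
  ultimately obtain i where i: "P \<in> \<D> i" "P \<notin> \<D> (i + 1)" by metis
  obtain R where R: "R \<in> \<D> (i + 1)" "P \<subseteq> R" using parent_ex1[OF i(1)] by auto
  have "R \<inter> Q \<noteq> {}" using R ne assms(3) by auto
  moreover have "i + 1 \<le> k" using bound[OF i(1)] by simp
  ultimately have "R \<subseteq> Q" using generation_le_subset[of "i + 1" k R Q] R k by auto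
  moreover have "ennreal \<epsilon> * emeasure M R \<le> emeasure M P"
    using child_measure[OF R(1)] i R by auto
  then have "\<epsilon> * mu R \<le> mu P"
    using generation_fmeasurable[OF R(1)] generation_fmeasurable[OF i(1)] eps_pos
    by (simp add: emeasure_eq_measure2 flip: ennreal_mult)
  moreover have "R \<in> \<Q>" using R by (auto simp: \<Q>_def)
  moreover have "P \<subset> R" using R i by auto
  ultimately show thesis using that[of R] by blast
qed

end

subsection \<open>Regularity, density and stopping cubes\<close>

context dyadic_space
begin

definition cube_union :: "'a set \<Rightarrow> bool" where
  "cube_union U \<longleftrightarrow> (\<exists>\<C>\<subseteq>\<Q>. U = \<Union>\<C>)"

lemma cube_union_sets: "cube_union U \<Longrightarrow> U \<in> sets M"
proof -
  assume "cube_union U"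
  then obtain \<C> where \<C>: "\<C> \<subseteq> \<Q>" "U = \<Union>\<C>" by (auto simp: cube_union_def)
  have "countable \<C>" by (rule countable_subset[OF \<C>(1) countable_cubes])
  moreover have "\<C> \<subseteq> sets M" using \<C>(1) cube_sets by auto
  ultimately show ?thesis using \<C>(2) by (simp add: sets.countable_Union)
qed

lemma cube_union_cube: "Q \<in> \<Q> \<Longrightarrow> cube_union Q"
  unfolding cube_union_def by (intro exI[of _ "{Q}"]) auto

lemma cube_union_UN: "(\<And>i. i \<in> I \<Longrightarrow> cube_union (U i)) \<Longrightarrow> cube_union (\<Union>i\<in>I. U i)"
proof -
  assume "\<And>i. i \<in> I \<Longrightarrow> cube_union (U i)"
  then obtain \<C> where \<C>: "\<And>i. i \<in> I \<Longrightarrow> \<C> i \<subseteq> \<Q> \<and> U i = \<Union>(\<C> i)"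
    unfolding cube_union_def by metis
  show ?thesis unfolding cube_union_def
    by (rule exI[of _ "\<Union>i\<in>I. \<C> i"]) (use \<C> in auto)
qed

lemma cube_union_Int: "cube_union U \<Longrightarrow> cube_union V \<Longrightarrow> cube_union (U \<inter> V)"
proof -
  assume "cube_union U" "cube_union V"
  then obtain \<C> \<C>' where C: "\<C> \<subseteq> \<Q>" "U = \<Union>\<C>" "\<C>' \<subseteq> \<Q>" "V = \<Union>\<C>'"
    by (auto simp: cube_union_def)
  have "cube_union (\<Union>p\<in>{p\<in>\<C> \<times> \<C>'. fst p \<inter> snd p \<noteq> {}}. fst p \<inter> snd p)"
  proof (rule cube_union_UN)
    fix p assume "p \<in> {p\<in>\<C> \<times> \<C>'. fst p \<inter> snd p \<noteq> {}}"
    then have p: "fst p \<in> \<Q>" "snd p \<in> \<Q>" "fst p \<inter> snd p \<noteq> {}" using C by auto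
    then have "fst p \<inter> snd p = fst p \<or> fst p \<inter> snd p = snd p"
      using cube_nested[OF p] by auto
    then show "cube_union (fst p \<inter> snd p)" using p cube_union_cube by metis
  qed
  moreover have "(\<Union>p\<in>{p\<in>\<C> \<times> \<C>'. fst p \<inter> snd p \<noteq> {}}. fst p \<inter> snd p) = U \<inter> V"
    unfolding C by fastforce
  ultimately show ?thesis by simp
qed

lemma cube_union_space: "cube_union X"
  unfolding cube_union_def
  by (rule exI[of _ "\<D> 0"]) (use generation_cover[of 0] in \<open>auto simp: \<Q>_def\<close>)

text \<open>One generation partitions \<open>X\<close>, so cubes behave like clopen sets; this is
  what later allows complements to be approximated.\<close>

lemma cube_union_Diff_cube: "Q \<in> \<Q> \<Longrightarrow> cube_union (X - Q)"
proof -
  assume "Q \<in> \<Q>"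
  then obtain k where k: "Q \<in> \<D> k" by (auto simp: \<Q>_def)
  have "X - Q = \<Union>(\<D> k - {Q})"
    using generation_cover[of k] same_generation_eq[OF _ k] by auto
  then show ?thesis unfolding cube_union_def
    by (intro exI[of _ "\<D> k - {Q}"]) (auto simp: \<Q>_def)
qed

text \<open>Intersecting with \<open>X\<close> gives the case \<open>N = 0\<close> the right
  meaning.\<close>

lemma cube_union_finite_INT:
  "(\<And>n. cube_union (V n)) \<Longrightarrow> cube_union (X \<inter> (\<Inter>n<N. V n))" for V :: "nat \<Rightarrow> 'a set"
proof (induction N)
  case 0
  then show ?case using cube_union_space by simp
next
  case (Suc N)
  have "X \<inter> (\<Inter>n<Suc N. V n) = (X \<inter> (\<Inter>n<N. V n)) \<inter> V N" by (auto simp: less_Suc_eq)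
  then show ?case using Suc cube_union_Int by metis
qed

lemma small_cube:
  assumes "x \<in> X" "0 < r" obtains Q where "Q \<in> \<Q>" "x \<in> Q" "Q \<subseteq> bl x r"
proof -
  \<comment> \<open>Two points of a cube of generation \<open>k\<close> are closer than
    \<open>2 * \<kappa> * C0 * \<delta> powi k\<close>, which is below \<open>r\<close> once
    \<open>\<delta> powi k < inverse L\<close>.\<close>
  define L where "L = 2 * \<kappa> * C0 / r"
  have L: "0 < L" using assms kappa_ge_1 C0_pos by (simp add: L_def)
  obtain n :: nat where n: "L < \<delta> ^ n" using real_arch_pow[OF delta_gt_1] by auto
  define k where "k = - int n"
  have "\<delta> powi k = inverse (\<delta> ^ n)" by (simp add: k_def power_int_minus)
  also have "\<dots> < inverse L" using n L by (intro less_imp_inverse_less) auto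
  finally have dk: "\<delta> powi k < inverse L" .
  obtain Q where Q: "Q \<in> \<D> k" "x \<in> Q" using generation_cover[of k] assms by auto
  obtain z where z: "z \<in> X" "Q \<subseteq> bl z (C0 * \<delta> powi k)" using cube_center[OF Q(1)] by metis
  have "Q \<subseteq> bl x r"
  proof
    fix y assume y: "y \<in> Q"
    then have zy: "y \<in> X" "\<rho> z y < C0 * \<delta> powi k" "\<rho> z x < C0 * \<delta> powi k"
      using z Q by (auto simp: mem_ball)
    have "\<rho> x y \<le> \<kappa> * (\<rho> x z + \<rho> z y)" using assms z zy by (intro rho_triangle)
    also have "\<dots> \<le> \<kappa> * (C0 * \<delta> powi k + C0 * \<delta> powi k)"
      using zy kappa_ge_1 rho_sym[of x z] assms z by (intro mult_left_mono add_mono) auto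
    also have "\<dots> = 2 * \<kappa> * C0 * (\<delta> powi k)" by simp
    also have "\<dots> < 2 * \<kappa> * C0 * inverse L"
      using dk kappa_ge_1 C0_pos by (intro mult_strict_left_mono) auto
    also have "\<dots> = r" using L C0_pos kappa_ge_1 assms by (simp add: L_def)
    finally show "y \<in> bl x r" using zy by (simp add: mem_ball)
  qed
  then show thesis using that[of Q] Q by (auto simp: \<Q>_def)
qed

lemma cube_union_qopen: "qopen X \<rho> U \<Longrightarrow> cube_union U"
proof -
  assume U: "qopen X \<rho> U"
  have "U = \<Union>{Q \<in> \<Q>. Q \<subseteq> U}"
  proof
    show "U \<subseteq> \<Union>{Q \<in> \<Q>. Q \<subseteq> U}"
    proof
      fix x assume x: "x \<in> U"
      then obtain r where r: "0 < r" "bl x r \<subseteq> U" and xX: "x \<in> X"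
        using U unfolding qopen_def by blast
      obtain Q where "Q \<in> \<Q>" "x \<in> Q" "Q \<subseteq> bl x r" by (rule small_cube[OF xX r(1)])
      then show "x \<in> \<Union>{Q \<in> \<Q>. Q \<subseteq> U}" using r by auto
    qed
  qed auto
  then show ?thesis unfolding cube_union_def by (intro exI[of _ "{Q \<in> \<Q>. Q \<subseteq> U}"]) auto
qed

lemma UN_tail_small:
  fixes U :: "nat \<Rightarrow> 'a set"
  assumes "\<And>n. U n \<in> sets M" "Q \<in> fmeasurable M" "0 < (e::real)"
  obtains N where "mu (Q \<inter> ((\<Union>n. U n) - (\<Union>n<N. U n))) < e"
proof -
  define A where "A N = Q \<inter> ((\<Union>n. U n) - (\<Union>n<N. U n))" for N
  have Q: "Q \<in> sets M" using assms by auto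
  have A: "A N \<in> sets M" for N unfolding A_def using assms Q by auto
  have "(\<lambda>N. mu (A N)) \<longlonglongrightarrow> mu (\<Inter>N. A N)"
  proof (rule Lim_measure_decseq)
    show "decseq A" by (auto simp: A_def decseq_def)
    show "emeasure M (A N) \<noteq> \<infinity>" for N
      using A assms(2) by (metis A_def fmeasurableD2 fmeasurableI2 inf_le1 infinity_ennreal_def)
  qed (use A in auto)
  moreover have "(\<Inter>N. A N) = {}" unfolding A_def by auto
  ultimately have "(\<lambda>N. mu (A N)) \<longlonglongrightarrow> 0" by simp
  then have "eventually (\<lambda>N. mu (A N) < e) sequentially"
    using assms(3) by (rule order_tendstoD)
  then obtain N where "mu (A N) < e" by (auto simp: eventually_sequentially)
  then show thesis using that by (simp add: A_def)
qed

text \<open>The cubes play the role of open sets in the usual proof that Borel measures are regular.\<close>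

definition cube_approx :: "'a set \<Rightarrow> 'a set \<Rightarrow> bool" where
  "cube_approx Q A \<longleftrightarrow> (\<forall>e>0. \<exists>U V. cube_union U \<and> cube_union V \<and> A \<inter> Q \<subseteq> U \<and> Q - A \<subseteq> V \<and>
     mu (Q \<inter> U \<inter> V) < e)"

text \<open>Inside \<open>Q\<close> the property treats a set and its complement alike, so
  complements only exchange \<open>U\<close> and \<open>V\<close>; the content is in the open sets
  and the countable unions.\<close>

lemma cube_approx_Borel:
  assumes Q: "Q \<in> \<Q>" and A: "A \<in> sigma_sets X {U. qopen X \<rho> U}"
  shows "cube_approx Q A"
  using A
proof induction
  case (Basic A)
  then have "cube_union A" using cube_union_qopen by auto
  then obtain \<C> where \<C>: "\<C> \<subseteq> \<Q>" "A = \<Union>\<C>" by (auto simp: cube_union_def)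
  show ?case unfolding cube_approx_def
  proof (intro allI impI)
    fix e :: real assume e: "0 < e"
    show "\<exists>U V. cube_union U \<and> cube_union V \<and> A \<inter> Q \<subseteq> U \<and> Q - A \<subseteq> V \<and> mu (Q \<inter> U \<inter> V) < e"
    proof (cases "\<C> = {}")
      case True
      then show ?thesis
        using \<C> cube_union_space cube_union_cube[OF Q] e \<open>cube_union A\<close> cube_subset_space[OF Q]
        by (intro exI[of _ A] exI[of _ X]) auto
    next
      case False
      define q where "q = from_nat_into \<C>"
      have rq: "range q = \<C>"
        unfolding q_def by (intro range_from_nat_into False countable_subset[OF \<C>(1) countable_cubes])
      then have q: "q n \<in> \<Q>" for n using \<C>(1) by auto
      obtain N where N: "mu (Q \<inter> ((\<Union>n. q n) - (\<Union>n<N. q n))) < e"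
        by (rule UN_tail_small[of q Q e]) (use q Q cube_sets cube_fmeasurable e in auto)
      \<comment> \<open>The open set is its own outer approximation. Its complement is covered by
        the complement of finitely many of its cubes, and the overlap is the tail of the
        union.\<close>
      define V where "V = X \<inter> (\<Inter>n<N. X - q n)"
      have "cube_union V" unfolding V_def
        by (rule cube_union_finite_INT) (rule cube_union_Diff_cube[OF q])
      moreover have "Q - A \<subseteq> V" using cube_subset_space[OF Q] \<C> rq by (auto simp: V_def)
      moreover have "Q \<inter> A \<inter> V = Q \<inter> ((\<Union>n. q n) - (\<Union>n<N. q n))"
        unfolding V_def \<C>(2) using rq cube_subset_space[OF Q] by auto
      ultimately show ?thesis
        using N \<open>cube_union A\<close> by (intro exI[of _ A] exI[of _ V]) auto
    qed
  qed
next
  case Empty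
  show ?case unfolding cube_approx_def
  proof (intro allI impI)
    fix e :: real assume e: "0 < e"
    have "cube_union {}" unfolding cube_union_def by (rule exI[of _ "{}"]) auto
    then show "\<exists>U V. cube_union U \<and> cube_union V \<and> {} \<inter> Q \<subseteq> U \<and> Q - {} \<subseteq> V \<and> mu (Q \<inter> U \<inter> V) < e"
      using cube_union_cube[OF Q] e by (intro exI[of _ "{}"] exI[of _ Q]) auto
  qed
next
  case (Compl A)
  show ?case unfolding cube_approx_def
  proof (intro allI impI)
    fix e :: real assume "0 < e"
    with Compl.IH obtain U V where "cube_union U" "cube_union V" "A \<inter> Q \<subseteq> U" "Q - A \<subseteq> V"
        "mu (Q \<inter> U \<inter> V) < e"
      unfolding cube_approx_def by blast
    then show "\<exists>U V. cube_union U \<and> cube_union V \<and> (X - A) \<inter> Q \<subseteq> U \<and> Q - (X - A) \<subseteq> V \<and>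
        mu (Q \<inter> U \<inter> V) < e"
      using cube_subset_space[OF Q]
      by (intro exI[of _ V] exI[of _ U]) (auto simp: Int_ac)
  qed
next
  case (Union A)
  show ?case unfolding cube_approx_def
  proof (intro allI impI)
    fix e :: real assume e: "0 < e"
    \<comment> \<open>These errors add up to at most \<open>e / 2\<close>; the other half is spent
      on the tail of the union of the \<open>U n\<close>.\<close>
    have "\<exists>U V. cube_union U \<and> cube_union V \<and> A n \<inter> Q \<subseteq> U \<and> Q - A n \<subseteq> V \<and>
        mu (Q \<inter> U \<inter> V) < (e / 4) * (1/2) ^ n" for n
    proof -
      have "0 < (e / 4) * (1/2) ^ n" using e by simp
      with Union.IH[of n] show ?thesis unfolding cube_approx_def by blast
    qed
    then obtain U V where UV: "\<And>n. cube_union (U n)" "\<And>n. cube_union (V n)"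
        "\<And>n. A n \<inter> Q \<subseteq> U n" "\<And>n. Q - A n \<subseteq> V n"
        "\<And>n. mu (Q \<inter> U n \<inter> V n) < (e / 4) * (1/2) ^ n"
      by metis
    have ms: "U n \<in> sets M" "V n \<in> sets M" for n using UV cube_union_sets by auto
    have Qs: "Q \<in> sets M" using Q cube_sets by auto
    obtain N where N: "mu (Q \<inter> ((\<Union>n. U n) - (\<Union>n<N. U n))) < e / 2"
      by (rule UN_tail_small[of U Q "e / 2"]) (use ms e cube_fmeasurable[OF Q] in auto)
    \<comment> \<open>Only finite intersections of unions of cubes are known to be unions of cubes,
      hence the cut at \<open>N\<close>.\<close>
    define W where "W = X \<inter> (\<Inter>n<N. V n)"
    have W: "cube_union W" unfolding W_def by (rule cube_union_finite_INT) (rule UV)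
    have fm: "B \<in> sets M \<Longrightarrow> B \<subseteq> Q \<Longrightarrow> B \<in> fmeasurable M" for B
      using cube_fmeasurable[OF Q] fmeasurableI2 by blast
    have "mu (Q \<inter> (\<Union>n. U n) \<inter> W) \<le>
        mu ((\<Union>n<N. Q \<inter> U n \<inter> V n) \<union> (Q \<inter> ((\<Union>n. U n) - (\<Union>n<N. U n))))"
      by (rule measure_mono_fmeasurable) (use ms Qs W cube_union_sets in \<open>auto intro!: fm simp: W_def\<close>)
    also have "\<dots> \<le> mu (\<Union>n<N. Q \<inter> U n \<inter> V n) + mu (Q \<inter> ((\<Union>n. U n) - (\<Union>n<N. U n)))"
      by (rule measure_Un_le) (use ms Qs in auto)
    also have "mu (\<Union>n<N. Q \<inter> U n \<inter> V n) \<le> (\<Sum>n<N. mu (Q \<inter> U n \<inter> V n))"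
      by (rule measure_UNION_le) (use ms Qs in auto)
    also have "\<dots> \<le> (\<Sum>n<N. (e / 4) * (1/2) ^ n)"
      by (intro sum_mono less_imp_le UV)
    also have "\<dots> = (e / 4) * (\<Sum>n<N. (1/2) ^ n)" by (simp add: sum_distrib_left)
    also have "\<dots> \<le> (e / 4) * 2"
      using e by (intro mult_left_mono) (auto simp: sum_gp_strict)
    finally have "mu (Q \<inter> (\<Union>n. U n) \<inter> W) < e" using N by simp
    moreover have "cube_union (\<Union>n. U n)" by (rule cube_union_UN) (rule UV)
    moreover have "(\<Union>n. A n) \<inter> Q \<subseteq> (\<Union>n. U n)" using UV(3) by blast
    moreover have "Q - (\<Union>n. A n) \<subseteq> W"
      using UV(4) cube_subset_space[OF Q] unfolding W_def by blast
    ultimately show "\<exists>U V. cube_union U \<and> cube_union V \<and> (\<Union>n. A n) \<inter> Q \<subseteq> U \<and> Q - (\<Union>n. A n) \<subseteq> V \<and>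
        mu (Q \<inter> U \<inter> V) < e"
      using W by blast
  qed
qed

text \<open>Borel regularity enters here: the Borel hull of \<open>F\<close> has the same measure
  and can be approximated by cubes, and \<open>Q \<inter> U\<close> exceeds it by at most the
  overlap with \<open>V\<close>.\<close>

lemma cube_outer_regular:
  assumes Q: "Q \<in> \<Q>" and F: "F \<in> sets M" "F \<subseteq> Q" and e: "0 < (e::real)"
  obtains U where "cube_union U" "F \<subseteq> U" "mu (Q \<inter> U) < mu F + e"
proof -
  obtain B where B: "B \<in> sigma_sets X {U. qopen X \<rho> U}" "F \<subseteq> B" "emeasure M B = emeasure M F"
    using regular F(1) unfolding borel_regular_def by blast
  have Qf: "Q \<in> fmeasurable M" using Q by (rule cube_fmeasurable)
  have Ff: "F \<in> fmeasurable M" using fmeasurableI2[OF Qf F(2,1)] .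
  have "sigma_sets X {U. qopen X \<rho> U} \<subseteq> sets M"
    by (rule sets.sigma_sets_subset) (use qopen_measurable in auto)
  then have Bs: "B \<in> sets M" using B(1) by auto
  have Bf: "B \<in> fmeasurable M" using Bs B(3) Ff by (simp add: fmeasurable_def)
  have mB: "mu B = mu F" using B(3) by (simp add: measure_def)
  obtain U V where UV: "cube_union U" "cube_union V" "B \<inter> Q \<subseteq> U" "Q - B \<subseteq> V" "mu (Q \<inter> U \<inter> V) < e"
    using cube_approx_Borel[OF Q B(1)] e unfolding cube_approx_def by blast
  have s: "U \<in> sets M" "V \<in> sets M" "Q \<in> sets M" using UV cube_union_sets Qf by auto
  have "mu (Q \<inter> U) \<le> mu ((Q \<inter> U \<inter> V) \<union> (Q \<inter> B))"
  proof (rule measure_mono_fmeasurable)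
    show "Q \<inter> U \<subseteq> Q \<inter> U \<inter> V \<union> Q \<inter> B" using UV by auto
    show "Q \<inter> U \<inter> V \<union> Q \<inter> B \<in> fmeasurable M"
      by (rule fmeasurableI2[OF Qf]) (use s Bs in auto)
  qed (use s in auto)
  also have "\<dots> \<le> mu (Q \<inter> U \<inter> V) + mu (Q \<inter> B)" by (rule measure_Un_le) (use s Bs in auto)
  also have "mu (Q \<inter> B) \<le> mu B" by (rule measure_mono_fmeasurable) (use s Bs Bf in auto)
  finally have "mu (Q \<inter> U) < mu F + e" using UV mB by simp
  then show thesis using that[of U] UV B F by blast
qed

lemma emeasure_Union_cubes:
  assumes "\<P> \<subseteq> \<Q>" "disjoint \<P>" "F \<in> sets M"
  shows "emeasure M (F \<inter> \<Union>\<P>) = (\<integral>\<^sup>+P. emeasure M (F \<inter> P) \<partial>count_space \<P>)"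
proof -
  have "F \<inter> \<Union>\<P> = (\<Union>P\<in>\<P>. F \<inter> P)" by auto
  also have "emeasure M \<dots> = (\<integral>\<^sup>+P. emeasure M (F \<inter> P) \<partial>count_space \<P>)"
  proof (rule emeasure_UN_countable)
    show "countable \<P>" by (rule countable_subset[OF assms(1) countable_cubes])
    show "disjoint_family_on (\<lambda>P. F \<inter> P) \<P>"
      using assms(2) by (auto simp: disjoint_family_on_def disjoint_def)
  qed (use assms cube_sets in auto)
  finally show ?thesis .
qed

lemma Union_cubes_sets: "\<P> \<subseteq> \<Q> \<Longrightarrow> \<Union>\<P> \<in> sets M"
  using cube_union_sets unfolding cube_union_def by blast

text \<open>A substitute for Lebesgue's differentiation theorem.\<close>

lemma density:
  assumes Q: "Q \<in> \<Q>" and F: "F \<in> sets M" "F \<subseteq> Q" and \<theta>: "0 \<le> \<theta>" "\<theta> < 1"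
    and small: "\<And>P. P \<in> \<Q> \<Longrightarrow> P \<subseteq> Q \<Longrightarrow> mu (F \<inter> P) \<le> \<theta> * mu P"
  shows "F \<in> null_sets M"
proof -
  have Qf: "Q \<in> fmeasurable M" using Q by (rule cube_fmeasurable)
  have Ff: "F \<in> fmeasurable M" using fmeasurableI2[OF Qf F(2,1)] .
  \<comment> \<open>\<open>F\<close> is covered by a union of cubes with excess below
    \<open>e\<close>. Its maximal cubes are disjoint and \<open>F\<close> fills at most the fraction
    \<open>\<theta>\<close> of each; letting \<open>e\<close> tend to 0 leaves
    \<open>mu F \<le> \<theta> * mu F\<close>.\<close>
  have step: "mu F \<le> \<theta> * (mu F + e)" if e: "0 < e" for e
  proof -
    obtain U where U: "cube_union U" "F \<subseteq> U" "mu (Q \<inter> U) < mu F + e"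
      by (rule cube_outer_regular[OF Q F e])
    have "cube_union (Q \<inter> U)" by (rule cube_union_Int[OF cube_union_cube[OF Q] U(1)])
    then obtain \<C> where \<C>: "\<C> \<subseteq> \<Q>" "Q \<inter> U = \<Union>\<C>" by (auto simp: cube_union_def)
    define \<P> where "\<P> = maximal_cubes \<C>"
    have \<P>: "\<P> \<subseteq> \<Q>" "disjoint \<P>"
      using maximal_cubes_subset[of \<C>] maximal_cubes_disjoint[OF \<C>(1)] \<C>(1) by (auto simp: \<P>_def)
    have U\<P>: "\<Union>\<P> = Q \<inter> U"
      unfolding \<P>_def \<C>(2) by (rule maximal_cubes_Union[OF \<C>(1) _ Q]) (use \<C>(2) in auto)
    have "emeasure M F = emeasure M (F \<inter> \<Union>\<P>)" using U\<P> U F by (simp add: Int_absorb2)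
    also have "\<dots> = (\<integral>\<^sup>+P. emeasure M (F \<inter> P) \<partial>count_space \<P>)"
      by (rule emeasure_Union_cubes[OF \<P> F(1)])
    also have "\<dots> \<le> (\<integral>\<^sup>+P. ennreal \<theta> * emeasure M P \<partial>count_space \<P>)"
    proof (rule nn_integral_mono)
      fix P assume "P \<in> space (count_space \<P>)"
      then have P: "P \<in> \<Q>" "P \<subseteq> Q" using \<P> U\<P> by auto
      have fP: "P \<in> fmeasurable M" using P cube_fmeasurable by auto
      then have "F \<inter> P \<in> fmeasurable M" using Ff by (intro fmeasurable.Int)
      then show "emeasure M (F \<inter> P) \<le> ennreal \<theta> * emeasure M P"
        using small[OF P] fP \<theta> by (simp add: emeasure_eq_measure2 flip: ennreal_mult)
    qed
    also have "\<dots> = ennreal \<theta> * (\<integral>\<^sup>+P. emeasure M (X \<inter> P) \<partial>count_space \<P>)"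
    proof -
      have "(\<integral>\<^sup>+P. emeasure M P \<partial>count_space \<P>) = (\<integral>\<^sup>+P. emeasure M (X \<inter> P) \<partial>count_space \<P>)"
        by (rule nn_integral_cong) (use \<P>(1) cube_subset_space in \<open>auto simp: Int_absorb1\<close>)
      then show ?thesis by (simp add: nn_integral_cmult)
    qed
    also have "\<dots> = ennreal \<theta> * emeasure M (X \<inter> \<Union>\<P>)"
      by (subst emeasure_Union_cubes[OF \<P>]) auto
    also have "X \<inter> \<Union>\<P> = Q \<inter> U" using U\<P> cube_subset_space[OF Q] by auto
    also have "emeasure M (Q \<inter> U) = ennreal (mu (Q \<inter> U))"
    proof (rule emeasure_eq_measure2, rule fmeasurableI2[OF Qf])
      show "Q \<inter> U \<in> sets M" using cube_union_sets[OF U(1)] cube_sets[OF Q] by auto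
    qed auto
    finally have "ennreal (mu F) \<le> ennreal \<theta> * ennreal (mu (Q \<inter> U))"
      using Ff by (simp add: emeasure_eq_measure2)
    then have "mu F \<le> \<theta> * mu (Q \<inter> U)" using \<theta> by (simp flip: ennreal_mult)
    also have "\<dots> \<le> \<theta> * (mu F + e)" using U \<theta> by (intro mult_left_mono) auto
    finally show ?thesis .
  qed
  have "mu F \<le> \<theta> * mu F"
  proof (rule field_le_epsilon)
    fix e :: real assume e: "0 < e"
    have "mu F \<le> \<theta> * (mu F + e)" by (rule step[OF e])
    also have "\<dots> = \<theta> * mu F + \<theta> * e" by (simp add: algebra_simps)
    also have "\<dots> \<le> \<theta> * mu F + e" using \<theta> e by (simp add: mult_le_cancel_right1)
    finally show "mu F \<le> \<theta> * mu F + e" .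
  qed
  then have "mu F \<le> 0" using \<theta> measure_nonneg[of M F] by (smt (verit) mult_le_cancel_right1)
  then have "mu F = 0" using measure_nonneg[of M F] by linarith
  then show ?thesis using Ff by (intro null_setsI) (auto simp: emeasure_eq_measure2)
qed

text \<open>The selected cubes are the maximal ones with \<open>\<Phi>\<close>. They are strictly
  inside \<open>Q\<close> because \<open>Q\<close> fails \<open>\<Phi>\<close>, so each has a
  strictly larger cube of comparable measure, which fails \<open>\<Phi>\<close> by maximality. That
  larger cube gives the upper bounds on the selected ones.\<close>

lemma stopping_cubes:
  assumes Q: "Q \<in> \<Q>" and nQ: "\<not> \<Phi> Q"
  obtains \<P> where "\<P> \<subseteq> \<Q>" "disjoint \<P>" "\<And>P. P \<in> \<P> \<Longrightarrow> P \<subset> Q" "\<And>P. P \<in> \<P> \<Longrightarrow> \<Phi> P"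
    "\<And>P. P \<in> \<P> \<Longrightarrow> \<exists>R\<in>\<Q>. P \<subseteq> R \<and> R \<subseteq> Q \<and> \<not> \<Phi> R \<and> \<epsilon> * mu R \<le> mu P"
    "\<And>P. P \<in> \<Q> \<Longrightarrow> P \<subseteq> Q \<Longrightarrow> \<Phi> P \<Longrightarrow> \<exists>R\<in>\<P>. P \<subseteq> R"
proof -
  define \<C> where "\<C> = {P \<in> \<Q>. P \<subseteq> Q \<and> \<Phi> P}"
  have \<C>: "\<C> \<subseteq> \<Q>" "\<And>P. P \<in> \<C> \<Longrightarrow> P \<subseteq> Q" by (auto simp: \<C>_def)
  have sub: "P \<in> \<Q>" "P \<subset> Q" "\<Phi> P" if "P \<in> maximal_cubes \<C>" for P
  proof -
    have "P \<in> \<C>" using that maximal_cubes_subset by blast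
    then show "P \<in> \<Q>" "\<Phi> P" "P \<subset> Q" using nQ by (auto simp: \<C>_def)
  qed
  show thesis
  proof (rule that[of "maximal_cubes \<C>"])
    show "disjoint (maximal_cubes \<C>)" by (rule maximal_cubes_disjoint[OF \<C>(1)])
    show "\<exists>R\<in>maximal_cubes \<C>. P \<subseteq> R" if "P \<in> \<Q>" "P \<subseteq> Q" "\<Phi> P" for P
      by (rule maximal_cubes_cover[OF \<C> Q]) (use that in \<open>auto simp: \<C>_def\<close>)
    show "\<exists>R\<in>\<Q>. P \<subseteq> R \<and> R \<subseteq> Q \<and> \<not> \<Phi> R \<and> \<epsilon> * mu R \<le> mu P" if P: "P \<in> maximal_cubes \<C>" for P
    proof -
      obtain R where R: "R \<in> \<Q>" "P \<subset> R" "R \<subseteq> Q" "\<epsilon> * mu R \<le> mu P"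
        by (rule parent_strict[OF sub(1)[OF P] Q sub(2)[OF P]])
      have "\<not> \<Phi> R"
      proof
        assume "\<Phi> R"
        then have "R \<in> \<C>" using R by (auto simp: \<C>_def)
        then show False using P R(2) by (auto simp: maximal_cubes_def)
      qed
      then show ?thesis using R by blast
    qed
  qed (use sub in auto)
qed

end

subsection \<open>Adjacent dyadic systems and the maximal function\<close>

text \<open>The left index set depends on \<open>x\<close>; the right side is a supremum over a
  fixed family, whose measurability in \<open>x\<close> follows from countability.\<close>

lemma SUP_mem_eq_SUP_indicator:
  "(SUP Q\<in>{Q \<in> \<C>. x \<in> Q}. c Q) = (SUP Q\<in>\<C>. c Q * indicator Q x)" for c :: "'a set \<Rightarrow> ennreal"
proof (rule antisym)
  show "(SUP Q\<in>{Q \<in> \<C>. x \<in> Q}. c Q) \<le> (SUP Q\<in>\<C>. c Q * indicator Q x)"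
    by (rule SUP_least) (auto intro!: SUP_upper2)
  show "(SUP Q\<in>\<C>. c Q * indicator Q x) \<le> (SUP Q\<in>{Q \<in> \<C>. x \<in> Q}. c Q)"
  proof (rule SUP_least)
    fix Q assume "Q \<in> \<C>"
    then show "c Q * indicator Q x \<le> (SUP Q\<in>{Q \<in> \<C>. x \<in> Q}. c Q)"
      by (cases "x \<in> Q") (auto intro: SUP_upper)
  qed
qed

lemma L2_space_iff:
  "f \<in> L2_space N \<longleftrightarrow> f \<in> borel_measurable N \<and> integrable N (\<lambda>x. (f x)^2)"
proof -
  have "L2_norm N f < \<infinity> \<longleftrightarrow> (\<integral>\<^sup>+x. ennreal ((f x)^2) \<partial>N) < \<infinity>"
    by (auto simp: L2_norm_def ennreal_sqrt_def less_top)
  moreover have "f \<in> borel_measurable N \<Longrightarrow> 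
      (\<integral>\<^sup>+x. ennreal ((f x)^2) \<partial>N) < \<infinity> \<longleftrightarrow> integrable N (\<lambda>x. (f x)^2)"
    by (simp add: integrable_iff_bounded)
  ultimately show ?thesis by (auto simp: L2_space_def)
qed

lemma L2_norm_eq:
  assumes "integrable N (\<lambda>x. (f x)^2)"
  shows "L2_norm N f = ennreal (sqrt (LINT x|N. (f x)^2))"
proof -
  have "(\<integral>\<^sup>+x. ennreal ((f x)^2) \<partial>N) = ennreal (LINT x|N. (f x)^2)"
    by (rule nn_integral_eq_integral) (use assms in auto)
  then show ?thesis by (simp add: L2_norm_def ennreal_sqrt_def)
qed

context dyadic_space
begin

lemma finite_weak_type:
  fixes g :: "'a \<Rightarrow> ennreal"
  assumes g: "g \<in> borel_measurable M" and \<C>: "finite \<C>" "\<C> \<subseteq> \<Q>"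
    and big: "\<And>Q. Q \<in> \<C> \<Longrightarrow> ennreal l * emeasure M Q \<le> (\<integral>\<^sup>+x\<in>Q. g x \<partial>M)"
  shows "ennreal l * emeasure M (\<Union>\<C>) \<le> (\<integral>\<^sup>+x. g x \<partial>M)"
proof -
  define \<P> where "\<P> = maximal_cubes \<C>"
  have sub: "\<P> \<subseteq> \<C>" unfolding \<P>_def by (rule maximal_cubes_subset)
  have dis: "disjoint \<P>" unfolding \<P>_def by (rule maximal_cubes_disjoint[OF \<C>(2)])
  have fin: "finite \<P>" using sub \<C> finite_subset by auto
  have ms: "P \<in> \<P> \<Longrightarrow> P \<in> sets M" for P using sub \<C> cube_sets by auto
  have "\<Union>\<C> \<subseteq> \<Union>\<P>"
  proof
    fix x assume "x \<in> \<Union>\<C>"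
    then obtain P where P: "P \<in> \<C>" "x \<in> P" by auto
    obtain R where "R \<in> \<C>" "P \<subseteq> R" "\<forall>R'\<in>\<C>. R \<subseteq> R' \<longrightarrow> R = R'"
      using finite_has_maximal2[OF \<C>(1) P(1)] by auto
    then show "x \<in> \<Union>\<P>" using P unfolding \<P>_def maximal_cubes_def by blast
  qed
  then have "emeasure M (\<Union>\<C>) \<le> emeasure M (\<Union>\<P>)"
    by (rule emeasure_mono) (use ms fin in auto)
  also have "\<dots> \<le> (\<Sum>P\<in>\<P>. emeasure M P)"
    using emeasure_subadditive_finite[OF fin, of id M] ms by auto
  finally have "ennreal l * emeasure M (\<Union>\<C>) \<le> ennreal l * (\<Sum>P\<in>\<P>. emeasure M P)"
    by (rule mult_left_mono) auto
  also have "\<dots> = (\<Sum>P\<in>\<P>. ennreal l * emeasure M P)" by (simp add: sum_distrib_left)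
  also have "\<dots> \<le> (\<Sum>P\<in>\<P>. \<integral>\<^sup>+x\<in>P. g x \<partial>M)" using sub big by (intro sum_mono) auto
  also have "\<dots> = (\<integral>\<^sup>+x\<in>\<Union>\<P>. g x \<partial>M)"
  proof -
    have "disjoint_family_on (\<lambda>P. P) \<P>" using dis by (auto simp: disjoint_family_on_def disjoint_def)
    then have "g x * indicator (\<Union>\<P>) x = (\<Sum>P\<in>\<P>. g x * indicator P x)" for x
      using indicator_UN_disjoint[OF fin, of "\<lambda>P. P" x, where ?'c = ennreal] by (simp add: sum_distrib_left)
    then show ?thesis using g ms by (simp add: nn_integral_sum)
  qed
  also have "\<dots> \<le> (\<integral>\<^sup>+x. g x \<partial>M)" by (intro nn_integral_mono) (auto split: split_indicator)
  finally show ?thesis .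
qed

text \<open>Without a common bounding cube an infinite family may have no maximal members. It is
  exhausted by finite families, for which the maximal cubes exist and are disjoint.\<close>

lemma dyadic_weak_type:
  fixes g :: "'a \<Rightarrow> ennreal"
  assumes g: "g \<in> borel_measurable M" and \<C>: "\<C> \<subseteq> \<Q>"
    and big: "\<And>Q. Q \<in> \<C> \<Longrightarrow> ennreal l * emeasure M Q \<le> (\<integral>\<^sup>+x\<in>Q. g x \<partial>M)"
  shows "ennreal l * emeasure M (\<Union>\<C>) \<le> (\<integral>\<^sup>+x. g x \<partial>M)"
proof (cases "\<C> = {}")
  case False
  define q where "q = from_nat_into \<C>"
  have rq: "range q = \<C>"
    unfolding q_def by (intro range_from_nat_into False countable_subset[OF \<C> countable_cubes])
  have ms: "q n \<in> sets M" for n using rq \<C> cube_sets by blast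
  have "\<Union>\<C> = (\<Union>n. \<Union>(q ` {..n}))" using rq by blast
  also have "emeasure M \<dots> = (SUP n. emeasure M (\<Union>(q ` {..n})))"
  proof (rule SUP_emeasure_incseq[symmetric])
    show "incseq (\<lambda>n. \<Union> (q ` {..n}))" unfolding incseq_def by fastforce
  qed (use ms in auto)
  finally have "ennreal l * emeasure M (\<Union>\<C>) = (SUP n. ennreal l * emeasure M (\<Union>(q ` {..n})))"
    by (simp add: SUP_mult_left_ennreal)
  also have "\<dots> \<le> (\<integral>\<^sup>+x. g x \<partial>M)"
  proof (rule SUP_least)
    fix n
    have "q ` {..n} \<subseteq> \<C>" using rq by auto
    then show "ennreal l * emeasure M (\<Union>(q ` {..n})) \<le> (\<integral>\<^sup>+x. g x \<partial>M)"
      using \<C> by (intro finite_weak_type[OF g]) (auto intro: big)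
  qed
  finally show ?thesis .
qed simp

end

section \<open>Tail integrals of smooth kernels\<close>

context homogeneous_space
begin

text \<open>On the shell where \<open>\<rho> z y\<close> lies between \<open>2 ^ m * s\<close> and
  \<open>2 ^ Suc m * s\<close>, the factor is at most \<open>q ^ m / mu (B m)\<close>, while
  \<open>h\<close> contributes at most \<open>H\<close> times the measure of the doubled ball.
  Doubling leaves a geometric series, whose sum depends on neither \<open>z\<close> nor
  \<open>s\<close>.\<close>

lemma annulus_bound:
  assumes eta: "0 < \<eta>"
  obtains C where "0 < C" "\<And>z s h H. z \<in> X \<Longrightarrow> 0 < s \<Longrightarrow> h \<in> borel_measurable M \<Longrightarrow>
      (\<And>m. (\<integral>\<^sup>+y\<in>bl z (2 ^ m * s). h y \<partial>M) \<le> H * emeasure M (bl z (2 ^ m * s))) \<Longrightarrow>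
      (\<integral>\<^sup>+y\<in>X - bl z s. ennreal ((s / \<rho> z y) powr \<eta> / mu (bl z (\<rho> z y))) * h y \<partial>M) \<le> ennreal C * H"
proof -
  define q where "q = (2::real) powr - \<eta>"
  have q: "0 < q" "q < 1" using eta by (auto simp: q_def powr_minus inverse_less_1_iff)
  define C where "C = max 1 D * (\<Sum>m. q ^ m)"
  have C: "(\<lambda>m. max 1 D * q ^ m) sums C"
    unfolding C_def using q by (intro sums_mult summable_sums) auto
  have sq: "0 < (\<Sum>m. q ^ m)" using q by (simp add: suminf_geometric)
  have Cp: "0 < C" unfolding C_def using sq by (intro mult_pos_pos) auto
  show thesis
  proof (rule that[of C])
    show "0 < C" by (rule Cp)
    fix z s and h :: "'a \<Rightarrow> ennreal" and H
    assume z: "z \<in> X" and s: "0 < (s::real)" and h[measurable]: "h \<in> borel_measurable M"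
      and H: "\<And>m. (\<integral>\<^sup>+y\<in>bl z (2 ^ m * s). h y \<partial>M) \<le> H * emeasure M (bl z (2 ^ m * s))"
    define B where "B m = bl z (2 ^ m * s)" for m
    have Bs[measurable]: "B m \<in> sets M" for m unfolding B_def using z s by (intro ball_sets) auto
    have Bp: "0 < mu (B m)" for m unfolding B_def using z s by (intro ball_pos) auto
    have Bf: "emeasure M (B m) = ennreal (mu (B m))" for m
      unfolding B_def using z s by (intro emeasure_eq_measure2 ball_fmeasurable) auto
    have BD: "mu (B (Suc m)) \<le> max 1 D * mu (B m)" for m
    proof -
      have "mu (B (Suc m)) \<le> D * mu (B m)"
        unfolding B_def using doubling[of z "2 ^ m * s"] z s by (simp add: mult.assoc)
      also have "\<dots> \<le> max 1 D * mu (B m)" by (intro mult_right_mono) auto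
      finally show ?thesis .
    qed
    define t where "t m y = ennreal (q ^ m / mu (B m)) * (h y * indicator (B (Suc m)) y)" for m y
    have pt: "ennreal ((s / \<rho> z y) powr \<eta> / mu (bl z (\<rho> z y))) * h y * indicator (X - bl z s) y
        \<le> (\<Sum>m. t m y)" for y
    proof (cases "y \<in> X - bl z s")
      case True
      then have y: "y \<in> X" "s \<le> \<rho> z y" by (auto simp: mem_ball)
      obtain n where n: "\<rho> z y / s < 2 ^ n" using real_arch_pow[of 2 "\<rho> z y / s"] by auto
      \<comment> \<open>Since \<open>s \<le> \<rho> z y\<close>, this least exponent is not 0, and
        its predecessor numbers the shell of \<open>y\<close>.\<close>
      define k where "k = (LEAST n. \<rho> z y / s < 2 ^ n)"
      have k: "\<rho> z y / s < 2 ^ k" unfolding k_def by (rule LeastI) (rule n)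
      have "k \<noteq> 0" using k y s by (intro notI) (simp add: field_simps)
      then obtain m where m: "k = Suc m" by (cases k) auto
      have m1: "2 ^ m \<le> \<rho> z y / s"
        using not_less_Least[of m "\<lambda>n. \<rho> z y / s < 2 ^ n"] m k_def by auto
      have "(s / \<rho> z y) powr \<eta> \<le> (1 / 2 ^ m) powr \<eta>"
        using m1 s y eta by (intro powr_mono2) (auto simp: field_simps)
      also have "\<dots> = q ^ m"
        by (simp add: q_def powr_divide powr_power[symmetric] powr_minus_divide power_one_over
              powr_realpow[symmetric] powr_powr mult.commute)
      finally have p1: "(s / \<rho> z y) powr \<eta> \<le> q ^ m" .
      have p2: "mu (B m) \<le> mu (bl z (\<rho> z y))"
      proof (rule measure_mono_fmeasurable)
        show "B m \<subseteq> bl z (\<rho> z y)" unfolding B_def using m1 s by (intro ball_mono) (simp add: field_simps)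
        show "bl z (\<rho> z y) \<in> fmeasurable M" using z s y by (intro ball_fmeasurable) auto
      qed (rule Bs)
      have "(s / \<rho> z y) powr \<eta> / mu (bl z (\<rho> z y)) \<le> q ^ m / mu (B m)"
        using p1 p2 Bp[of m] q by (intro frac_le) auto
      moreover have "y \<in> B (Suc m)" unfolding B_def mem_ball using y k m s by (simp add: field_simps)
      ultimately have "ennreal ((s / \<rho> z y) powr \<eta> / mu (bl z (\<rho> z y))) * h y \<le> t m y"
        unfolding t_def by (auto intro!: mult_right_mono ennreal_leI)
      also have "\<dots> \<le> (\<Sum>m. t m y)" using sum_le_suminf[of "\<lambda>m. t m y" "{m}"] by auto
      finally show ?thesis using True by simp
    qed simp
    have "(\<integral>\<^sup>+y\<in>X - bl z s. ennreal ((s / \<rho> z y) powr \<eta> / mu (bl z (\<rho> z y))) * h y \<partial>M)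
        \<le> (\<integral>\<^sup>+y. (\<Sum>m. t m y) \<partial>M)"
      by (rule nn_integral_mono) (rule pt)
    also have "\<dots> = (\<Sum>m. \<integral>\<^sup>+y. t m y \<partial>M)"
      by (rule nn_integral_suminf) (simp add: t_def)
    also have "\<dots> \<le> (\<Sum>m. ennreal (max 1 D * q ^ m) * H)"
    proof (rule suminf_le)
      fix m
      have "(\<integral>\<^sup>+y. t m y \<partial>M) = ennreal (q ^ m / mu (B m)) * (\<integral>\<^sup>+y\<in>B (Suc m). h y \<partial>M)"
        unfolding t_def by (rule nn_integral_cmult) simp
      also have "\<dots> \<le> ennreal (q ^ m / mu (B m)) * (H * emeasure M (B (Suc m)))"
        using H[of "Suc m"] by (intro mult_left_mono) (simp_all add: B_def)
      also have "\<dots> = ennreal (q ^ m / mu (B m) * mu (B (Suc m))) * H"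
        using q Bp[of m] by (subst ennreal_mult) (auto simp: Bf mult_ac)
      also have "\<dots> \<le> ennreal (max 1 D * q ^ m) * H"
      proof (intro mult_right_mono ennreal_leI)
        have "q ^ m / mu (B m) * mu (B (Suc m)) \<le> q ^ m / mu (B m) * (max 1 D * mu (B m))"
          using q Bp[of m] by (intro mult_left_mono BD) auto
        also have "\<dots> = max 1 D * q ^ m" using Bp[of m] by simp
        finally show "q ^ m / mu (B m) * mu (B (Suc m)) \<le> max 1 D * q ^ m" .
      qed auto
      finally show "(\<integral>\<^sup>+y. t m y \<partial>M) \<le> ennreal (max 1 D * q ^ m) * H" .
    qed auto
    also have "\<dots> = (\<Sum>m. ennreal (max 1 D * q ^ m)) * H" by simp
    also have "(\<Sum>m. ennreal (max 1 D * q ^ m)) = ennreal C"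
    proof -
      have "(\<lambda>m. ennreal (max 1 D * q ^ m)) sums ennreal C"
        using C q Cp by (subst sums_ennreal) (auto intro!: mult_nonneg_nonneg)
      then show ?thesis by (rule sums_unique[symmetric])
    qed
    finally show "(\<integral>\<^sup>+y\<in>X - bl z s. ennreal ((s / \<rho> z y) powr \<eta> / mu (bl z (\<rho> z y))) * h y \<partial>M)
        \<le> ennreal C * H" .
  qed
qed

end

section \<open>Several systems at once and the weak type of the maximal function\<close>

locale adjacent_space = homogeneous_space M \<rho> \<kappa> D
  for M :: "'a measure" and \<rho> \<kappa> D +
  fixes S :: "(int \<Rightarrow> 'a set set) set" and \<delta> C0 \<epsilon> A :: real
  assumes finite_S: "finite S"
    and dyadic_S: "\<D> \<in> S \<Longrightarrow> dyadic_space M \<rho> \<kappa> D \<D> \<delta> C0 \<epsilon>"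
    and C0_pos: "0 < C0" and A_pos: "0 < A"
    and adjacent: "x \<in> space M \<Longrightarrow> 0 < r \<Longrightarrow> \<exists>Q\<in>cubes S. qball (space M) \<rho> x r \<subseteq> Q \<and>
      measure M Q \<le> A * measure M (qball (space M) \<rho> x r)"
begin

lemma cubes_dyadic:
  assumes "Q \<in> cubes S" obtains \<D> where "\<D> \<in> S" "dyadic_space M \<rho> \<kappa> D \<D> \<delta> C0 \<epsilon>" "Q \<in> dyadic_space.\<Q> \<D>"
proof -
  obtain \<D> k where \<D>: "\<D> \<in> S" "Q \<in> \<D> k" using assms by (auto simp: cubes_def)
  interpret dyadic_space M \<rho> \<kappa> D \<D> \<delta> C0 \<epsilon> using \<D>(1) by (rule dyadic_S)
  show thesis using that[OF \<D>(1) dyadic_S[OF \<D>(1)]] \<D> by (auto simp: \<Q>_def)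
qed

lemma cubes_eq: "cubes S = (\<Union>\<D>\<in>S. dyadic_space.\<Q> \<D>)"
proof -
  have "dyadic_space.\<Q> \<D> = (\<Union>k. \<D> k)" if "\<D> \<in> S" for \<D>
    by (rule dyadic_space.\<Q>_def[OF dyadic_S[OF that]])
  then show ?thesis by (auto simp: cubes_def)
qed

lemma adj_fmeasurable: "Q \<in> cubes S \<Longrightarrow> Q \<in> fmeasurable M"
  by (elim cubes_dyadic) (rule dyadic_space.cube_fmeasurable)

lemma adj_sets [measurable]: "Q \<in> cubes S \<Longrightarrow> Q \<in> sets M"
  using adj_fmeasurable by auto

lemma adj_subset_space: "Q \<in> cubes S \<Longrightarrow> Q \<subseteq> X"
  by (rule sets.sets_into_space[OF adj_sets])

lemma adj_measure_pos: "Q \<in> cubes S \<Longrightarrow> 0 < mu Q"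
  by (elim cubes_dyadic) (rule dyadic_space.cube_measure_pos)

lemma adj_emeasure: "Q \<in> cubes S \<Longrightarrow> emeasure M Q = ennreal (mu Q)"
  by (rule emeasure_eq_measure2[OF adj_fmeasurable])

lemma adj_countable: "countable (cubes S)"
  unfolding cubes_eq
  by (rule countable_UN[OF countable_finite[OF finite_S]])
     (rule dyadic_space.countable_cubes[OF dyadic_S])

lemma adj_center: "Q \<in> cubes S \<Longrightarrow> \<exists>p. fst p \<in> X \<and> 0 < snd p \<and> bl (fst p) (snd p) \<subseteq> Q \<and>
    Q \<subseteq> bl (fst p) (C0 * snd p)"
proof -
  assume "Q \<in> cubes S"
  then obtain \<D> k where \<D>: "\<D> \<in> S" "Q \<in> \<D> k" by (auto simp: cubes_def)
  interpret dyadic_space M \<rho> \<kappa> D \<D> \<delta> C0 \<epsilon> using \<D>(1) by (rule dyadic_S)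
  obtain z where "z \<in> X" "bl z (\<delta> powi k) \<subseteq> Q" "Q \<subseteq> bl z (C0 * \<delta> powi k)"
    by (rule cube_center[OF \<D>(2)])
  then show ?thesis using delta_powi_pos[of k] by (intro exI[of _ "(z, \<delta> powi k)"]) auto
qed

text \<open>A set may be a cube of several generations or systems. One pair of balls is fixed per
  set, so that centre and radius depend on the set alone.\<close>

definition "ball_data Q = (SOME p. fst p \<in> X \<and> 0 < snd p \<and> bl (fst p) (snd p) \<subseteq> Q \<and>
    Q \<subseteq> bl (fst p) (C0 * snd p))"

definition "ctr Q = fst (ball_data Q)"
definition "rad Q = snd (ball_data Q)"

lemma ctr_rad:
  assumes "Q \<in> cubes S"
  shows ctr_space: "ctr Q \<in> X" and rad_pos: "0 < rad Q"
    and ball_subset_cube: "bl (ctr Q) (rad Q) \<subseteq> Q"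
    and cube_subset_ball: "Q \<subseteq> bl (ctr Q) (C0 * rad Q)"
  using someI_ex[OF adj_center[OF assms]] unfolding ctr_def rad_def ball_data_def by auto

lemma dilate_ball:
  obtains c where "0 < c" "\<And>Q. Q \<in> cubes S \<Longrightarrow> mu (bl (ctr Q) (L * rad Q)) \<le> c * mu Q"
proof -
  obtain c where c: "0 < c" "\<And>x r. x \<in> X \<Longrightarrow> 0 < r \<Longrightarrow> mu (bl x (L * r)) \<le> c * mu (bl x r)"
    using doubling_scale[of L] by blast
  show thesis
  proof (rule that[of c])
    fix Q assume Q: "Q \<in> cubes S"
    have "mu (bl (ctr Q) (L * rad Q)) \<le> c * mu (bl (ctr Q) (rad Q))"
      using Q ctr_space rad_pos by (intro c)
    also have "\<dots> \<le> c * mu Q"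
      using c Q ball_subset_cube adj_fmeasurable ball_sets[OF ctr_space rad_pos]
      by (intro mult_left_mono measure_mono_fmeasurable) auto
    finally show "mu (bl (ctr Q) (L * rad Q)) \<le> c * mu Q" .
  qed (rule c)
qed

lemma dilate_cube:
  assumes "0 < L"
  obtains c d where "0 < c" "\<And>Q. Q \<in> cubes S \<Longrightarrow> d Q \<in> cubes S"
    "\<And>Q. Q \<in> cubes S \<Longrightarrow> bl (ctr Q) (L * rad Q) \<subseteq> d Q" "\<And>Q. Q \<in> cubes S \<Longrightarrow> mu (d Q) \<le> c * mu Q"
proof -
  obtain c where c: "0 < c" "\<And>Q. Q \<in> cubes S \<Longrightarrow> mu (bl (ctr Q) (L * rad Q)) \<le> c * mu Q"
    using dilate_ball[of L] by blast
  have "\<exists>R. R \<in> cubes S \<and> bl (ctr Q) (L * rad Q) \<subseteq> R \<and> mu R \<le> A * c * mu Q" if Q: "Q \<in> cubes S" for Q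
  proof -
    obtain R where R: "R \<in> cubes S" "bl (ctr Q) (L * rad Q) \<subseteq> R" "mu R \<le> A * mu (bl (ctr Q) (L * rad Q))"
      using adjacent[of "ctr Q" "L * rad Q"] ctr_space[OF Q] rad_pos[OF Q] assms by auto
    have "mu R \<le> A * (c * mu Q)"
      using R(3) mult_left_mono[OF c(2)[OF Q], of A] A_pos by linarith
    then show ?thesis using R by (auto simp: mult.assoc)
  qed
  then obtain d where "\<And>Q. Q \<in> cubes S \<Longrightarrow> d Q \<in> cubes S \<and> bl (ctr Q) (L * rad Q) \<subseteq> d Q \<and> mu (d Q) \<le> A * c * mu Q"
    by metis
  then show thesis using that[of "A * c" d] c(1) A_pos by auto
qed

lemma maximal_measurable [measurable]:
  "cube_maximal M S f \<in> borel_measurable M"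
  unfolding cube_maximal_def SUP_mem_eq_SUP_indicator
  by (intro borel_measurable_SUP adj_countable borel_measurable_times_ennreal borel_measurable_indicator adj_sets) auto

lemma maximal_ge: "Q \<in> cubes S \<Longrightarrow> x \<in> Q \<Longrightarrow>
    (\<integral>\<^sup>+y\<in>Q. ennreal \<bar>f y\<bar> \<partial>M) \<le> cube_maximal M S f x * emeasure M Q"
proof -
  assume Q: "Q \<in> cubes S" "x \<in> Q"
  have "(\<integral>\<^sup>+y\<in>Q. ennreal \<bar>f y\<bar> \<partial>M) / emeasure M Q \<le> cube_maximal M S f x"
    unfolding cube_maximal_def using Q by (intro SUP_upper) auto
  then have "(\<integral>\<^sup>+y\<in>Q. ennreal \<bar>f y\<bar> \<partial>M) / emeasure M Q * emeasure M Q \<le> cube_maximal M S f x * emeasure M Q"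
    by (rule mult_right_mono) auto
  moreover have "(\<integral>\<^sup>+y\<in>Q. ennreal \<bar>f y\<bar> \<partial>M) / emeasure M Q * emeasure M Q = (\<integral>\<^sup>+y\<in>Q. ennreal \<bar>f y\<bar> \<partial>M)"
    using adj_measure_pos[OF Q(1)] adj_emeasure[OF Q(1)]
    by (simp add: ennreal_divide_times ennreal_mult_divide_eq)
  ultimately show ?thesis by simp
qed

text \<open>The level set is covered by one union of cubes from each system; each satisfies the
  dyadic inequality, whence the factor \<open>card S\<close>.\<close>

lemma maximal_weak_type:
  assumes f[measurable]: "f \<in> borel_measurable M" and l: "0 < l"
  shows "ennreal l * emeasure M {x \<in> X. ennreal l < cube_maximal M S f x} \<le>
    ennreal (card S) * (\<integral>\<^sup>+x. ennreal \<bar>f x\<bar> \<partial>M)"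
proof -
  define \<C> where "\<C> \<D> = {Q \<in> dyadic_space.\<Q> \<D>. ennreal l * emeasure M Q \<le> (\<integral>\<^sup>+x\<in>Q. ennreal \<bar>f x\<bar> \<partial>M)}"
    for \<D> :: "int \<Rightarrow> 'a set set"
  have ms: "\<Union>(\<C> \<D>) \<in> sets M" if "\<D> \<in> S" for \<D>
    by (rule dyadic_space.Union_cubes_sets[OF dyadic_S[OF that]]) (auto simp: \<C>_def)
  have "{x \<in> X. ennreal l < cube_maximal M S f x} \<subseteq> (\<Union>\<D>\<in>S. \<Union>(\<C> \<D>))"
  proof
    fix x assume "x \<in> {x \<in> X. ennreal l < cube_maximal M S f x}"
    then obtain Q where Q: "Q \<in> cubes S" "x \<in> Q" "ennreal l < (\<integral>\<^sup>+y\<in>Q. ennreal \<bar>f y\<bar> \<partial>M) / emeasure M Q"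
      unfolding cube_maximal_def by (auto simp: less_SUP_iff)
    then obtain \<D> where \<D>: "\<D> \<in> S" "Q \<in> dyadic_space.\<Q> \<D>" using cubes_eq by auto
    have "ennreal l * emeasure M Q \<le> (\<integral>\<^sup>+y\<in>Q. ennreal \<bar>f y\<bar> \<partial>M) / emeasure M Q * emeasure M Q"
      using Q by (intro mult_right_mono) auto
    also have "\<dots> = (\<integral>\<^sup>+y\<in>Q. ennreal \<bar>f y\<bar> \<partial>M)"
      using adj_measure_pos[OF Q(1)] adj_emeasure[OF Q(1)]
      by (simp add: ennreal_divide_times ennreal_mult_divide_eq)
    finally have "Q \<in> \<C> \<D>" using \<D> by (simp add: \<C>_def)
    then show "x \<in> (\<Union>\<D>\<in>S. \<Union>(\<C> \<D>))" using Q \<D> by auto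
  qed
  then have "emeasure M {x \<in> X. ennreal l < cube_maximal M S f x} \<le> emeasure M (\<Union>\<D>\<in>S. \<Union>(\<C> \<D>))"
    by (rule emeasure_mono) (use ms finite_S in auto)
  also have "\<dots> \<le> (\<Sum>\<D>\<in>S. emeasure M (\<Union>(\<C> \<D>)))"
    by (rule emeasure_subadditive_finite) (use ms finite_S in auto)
  finally have "ennreal l * emeasure M {x \<in> X. ennreal l < cube_maximal M S f x} \<le>
      ennreal l * (\<Sum>\<D>\<in>S. emeasure M (\<Union>(\<C> \<D>)))"
    by (rule mult_left_mono) auto
  also have "\<dots> = (\<Sum>\<D>\<in>S. ennreal l * emeasure M (\<Union>(\<C> \<D>)))" by (simp add: sum_distrib_left)
  also have "\<dots> \<le> (\<Sum>\<D>\<in>S. \<integral>\<^sup>+x. ennreal \<bar>f x\<bar> \<partial>M)"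
    by (rule sum_mono, rule dyadic_space.dyadic_weak_type[OF dyadic_S]) (auto simp: \<C>_def)
  also have "\<dots> = ennreal (card S) * (\<integral>\<^sup>+x. ennreal \<bar>f x\<bar> \<partial>M)" by (simp add: ennreal_of_nat_eq_real_of_nat)
  finally show ?thesis .
qed

end

subsection \<open>Calderon--Zygmund kernels\<close>

lemma L2_space_add:
  assumes "f \<in> L2_space N" "g \<in> L2_space N"
  shows "(\<lambda>x. a * f x + b * g x) \<in> L2_space N"
proof -
  have [measurable]: "f \<in> borel_measurable N" "g \<in> borel_measurable N"
    and i: "integrable N (\<lambda>x. (f x)^2)" "integrable N (\<lambda>x. (g x)^2)"
    using assms by (auto simp: L2_space_iff)
  have "integrable N (\<lambda>x. (a * f x + b * g x)^2)"
  proof (rule Bochner_Integration.integrable_bound)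
    show "integrable N (\<lambda>x. 2 * a^2 * (f x)^2 + 2 * b^2 * (g x)^2)" using i by simp
    show "AE x in N. norm ((a * f x + b * g x)^2) \<le> norm (2 * a^2 * (f x)^2 + 2 * b^2 * (g x)^2)"
    proof (rule AE_I2)
      fix x
      have "0 \<le> (a * f x - b * g x)^2" by simp
      then have "(a * f x + b * g x)^2 \<le> 2 * a^2 * (f x)^2 + 2 * b^2 * (g x)^2"
        by (simp add: power2_eq_square algebra_simps)
      then show "norm ((a * f x + b * g x)^2) \<le> norm (2 * a^2 * (f x)^2 + 2 * b^2 * (g x)^2)"
        by simp
    qed
  qed simp
  then show ?thesis by (simp add: L2_space_iff)
qed

lemma L2_space_indicator:
  assumes "f \<in> L2_space N" "E \<in> sets N"
  shows "(\<lambda>x. f x * indicator E x) \<in> L2_space N"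
proof -
  have [measurable]: "f \<in> borel_measurable N" "E \<in> sets N"
    and i: "integrable N (\<lambda>x. (f x)^2)"
    using assms by (auto simp: L2_space_iff)
  have "integrable N (\<lambda>x. (f x)^2 * indicator E x)"
    by (rule integrable_real_mult_indicator[OF assms(2) i])
  moreover have "(f x * indicator E x)^2 = (f x)^2 * indicator E x" for x
    by (auto simp: indicator_def)
  ultimately show ?thesis by (simp add: L2_space_iff)
qed

lemma indicator_L2_space:
  assumes "E \<in> fmeasurable N" shows "(indicator E :: _ \<Rightarrow> real) \<in> L2_space N"
proof -
  have "(\<lambda>x. (indicator E x :: real)^2) = indicator E" by (auto simp: indicator_def)
  then show ?thesis using assms by (auto simp: L2_space_iff fmeasurable_def)
qed

lemma zero_L2_space: "(\<lambda>x. 0) \<in> L2_space N"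
  by (simp add: L2_space_iff)

lemma L2_space_integrable:
  assumes "f \<in> L2_space N" "E \<in> fmeasurable N" "\<And>x. x \<notin> E \<Longrightarrow> f x = 0"
  shows "integrable N f"
proof (rule Bochner_Integration.integrable_bound)
  show "integrable N (\<lambda>x. (f x)^2 + indicator E x)"
    using assms by (auto simp: L2_space_iff fmeasurable_def)
  show "AE x in N. norm (f x) \<le> norm ((f x)^2 + indicator E x)"
  proof (rule AE_I2)
    fix x
    have "2 * \<bar>f x\<bar> \<le> (f x)^2 + 1"
      using zero_le_power2[of "\<bar>f x\<bar> - 1"] by (simp add: power2_eq_square algebra_simps)
    then have "\<bar>f x\<bar> \<le> (f x)^2 + 1" by linarith
    then show "norm (f x) \<le> norm ((f x)^2 + indicator E x)"
      using assms(3)[of x] by (cases "x \<in> E") auto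
  qed
qed (use assms in \<open>simp add: L2_space_iff\<close>)

text \<open>\<open>Bn\<close> plays the role of the squared operator norm, so that
  \<open>T_bound\<close> compares real integrals without roots.\<close>

locale cz_space = adjacent_space M \<rho> \<kappa> D S \<delta> C0 \<epsilon> A
  for M :: "'a measure" and \<rho> \<kappa> D S \<delta> C0 \<epsilon> A +
  fixes T :: "('a \<Rightarrow> real) \<Rightarrow> 'a \<Rightarrow> real" and K :: "'a \<Rightarrow> 'a \<Rightarrow> real" and \<eta> CK Bn :: real
  assumes eta_pos: "0 < \<eta>"
    and K_size: "x \<in> space M \<Longrightarrow> y \<in> space M \<Longrightarrow> x \<noteq> y \<Longrightarrow>
      \<bar>K x y\<bar> \<le> CK / measure M (qball (space M) \<rho> x (\<rho> x y))"
    and K_smooth1: "x0 \<in> space M \<Longrightarrow> y \<in> space M \<Longrightarrow> x \<in> space M \<Longrightarrow> x0 \<noteq> y \<Longrightarrow> x \<noteq> y \<Longrightarrow>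
      \<rho> x0 x \<le> \<eta> * \<rho> x0 y \<Longrightarrow>
      \<bar>K x y - K x0 y\<bar> \<le> (\<rho> x x0 / \<rho> x0 y) powr \<eta> / measure M (qball (space M) \<rho> x0 (\<rho> x0 y))"
    and K_smooth2: "x0 \<in> space M \<Longrightarrow> y \<in> space M \<Longrightarrow> x \<in> space M \<Longrightarrow> x0 \<noteq> y \<Longrightarrow> x \<noteq> y \<Longrightarrow>
      \<rho> x0 x \<le> \<eta> * \<rho> x0 y \<Longrightarrow>
      \<bar>K y x - K y x0\<bar> \<le> (\<rho> x x0 / \<rho> x0 y) powr \<eta> / measure M (qball (space M) \<rho> x0 (\<rho> x0 y))"
    and T_L2: "f \<in> L2_space M \<Longrightarrow> T f \<in> L2_space M"
    and T_linear: "f \<in> L2_space M \<Longrightarrow> g \<in> L2_space M \<Longrightarrow>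
      AE x in M. T (\<lambda>y. a * f y + b * g y) x = a * T f x + b * T g x"
    and T_bound: "f \<in> L2_space M \<Longrightarrow> (LINT x|M. (T f x)^2) \<le> Bn * (LINT x|M. (f x)^2)"
    and T_repr: "f \<in> L2_space M \<Longrightarrow> AE x in M. x \<notin> ae_support M \<rho> f \<longrightarrow>
      T f x = (LINT y|M. K x y * f y)"
    and Bn_nonneg: "0 \<le> Bn"
begin

text \<open>Measurability of the kernel is not part of its definition. Smoothness in the second
  variable makes \<open>K x\<close> continuous away from \<open>x\<close>, so preimages of open sets
  are open up to the point \<open>x\<close>, where the arbitrary diagonal value is replaced by
  0.\<close>

lemma K_measurable:
  assumes x: "x \<in> X" shows "(\<lambda>y. if y = x then 0 else K x y) \<in> borel_measurable M"
proof (rule borel_measurableI)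
  fix U :: "real set" assume U: "open U"
  have open_part: "qopen X \<rho> {y \<in> X. y \<noteq> x \<and> K x y \<in> U}"
    unfolding qopen_def
  proof (intro conjI ballI)
    fix y0 assume "y0 \<in> {y \<in> X. y \<noteq> x \<and> K x y \<in> U}"
    then have y0: "y0 \<in> X" "y0 \<noteq> x" "K x y0 \<in> U" by auto
    obtain e where e: "0 < e" "ball (K x y0) e \<subseteq> U" using U y0(3) openE by blast
    define c where "c = mu (bl y0 (\<rho> y0 x))"
    define d where "d = \<rho> y0 x"
    have d: "0 < d" unfolding d_def using y0 x rho_nonneg[of y0 x] rho_eq_0[of y0 x] by force
    have c: "0 < c" unfolding c_def using y0 d d_def by (intro ball_pos) auto
    \<comment> \<open>The three bounds keep \<open>y\<close> away from \<open>x\<close>, make the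
      smoothness condition applicable, and push its right side below \<open>e\<close>.\<close>
    define r where "r = min d (min (\<eta> * d) (d * (e * c) powr (1 / \<eta>)))"
    have r: "0 < r" unfolding r_def using d eta_pos e c by auto
    have "bl y0 r \<subseteq> {y \<in> X. y \<noteq> x \<and> K x y \<in> U}"
    proof
      fix y assume y: "y \<in> bl y0 r"
      then have yX: "y \<in> X" and yr: "\<rho> y0 y < r" by (auto simp: mem_ball)
      have yx: "y \<noteq> x" using yr unfolding r_def d_def by auto
      have t: "0 \<le> \<rho> y y0 / d" using rho_nonneg[OF yX y0(1)] d by auto
      have "\<rho> y y0 < d * (e * c) powr (1 / \<eta>)" using yr rho_sym[OF yX y0(1)] by (simp add: r_def)
      then have "\<rho> y y0 / d < (e * c) powr (1 / \<eta>)" using d by (simp add: field_simps)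
      then have "(\<rho> y y0 / d) powr \<eta> < ((e * c) powr (1 / \<eta>)) powr \<eta>"
        using t eta_pos by (intro powr_less_mono2) auto
      also have "\<dots> = e * c" using eta_pos e c by (simp add: powr_powr)
      finally have lt: "(\<rho> y y0 / d) powr \<eta> / c < e" using c by (simp add: field_simps)
      have "\<bar>K x y - K x y0\<bar> \<le> (\<rho> y y0 / d) powr \<eta> / c"
        unfolding d_def c_def
        by (rule K_smooth2) (use y0 x yX yx yr in \<open>auto simp: r_def d_def\<close>)
      then have "K x y \<in> ball (K x y0) e" using lt by (simp add: dist_real_def)
      then show "y \<in> {y \<in> X. y \<noteq> x \<and> K x y \<in> U}" using e yX yx by auto
    qed
    then show "\<exists>r>0. bl y0 r \<subseteq> {y \<in> X. y \<noteq> x \<and> K x y \<in> U}" using r by blast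
  qed auto
  have "qopen X \<rho> (X - {x})"
    unfolding qopen_def
  proof (intro conjI ballI)
    fix y assume y: "y \<in> X - {x}"
    then have "0 < \<rho> y x" using x rho_nonneg[of y x] rho_eq_0[of y x] by force
    moreover have "bl y (\<rho> y x) \<subseteq> X - {x}" by (auto simp: mem_ball)
    ultimately show "\<exists>r>0. bl y r \<subseteq> X - {x}" by blast
  qed auto
  then have "X - (X - {x}) \<in> sets M" using qopen_measurable by blast
  moreover have "X - (X - {x}) = {x}" using x by auto
  ultimately have "{x} \<in> sets M" by simp
  then have "(if 0 \<in> U then {x} else {}) \<in> sets M" by simp
  moreover have "(\<lambda>y. if y = x then 0 else K x y) -` U \<inter> X =
      {y \<in> X. y \<noteq> x \<and> K x y \<in> U} \<union> (if 0 \<in> U then {x} else {})"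
    using x by (auto split: if_splits)
  ultimately show "(\<lambda>y. if y = x then 0 else K x y) -` U \<inter> X \<in> sets M"
    using sets.Un[OF qopen_measurable[OF open_part]] by presburger
qed

lemma K_times_measurable:
  assumes "x \<in> X" "h x = 0" and h: "h \<in> borel_measurable M"
  shows "(\<lambda>y. K x y * h y) \<in> borel_measurable M"
proof -
  have "(\<lambda>y. K x y * h y) = (\<lambda>y. (if y = x then 0 else K x y) * h y)" using assms by auto
  then show ?thesis using borel_measurable_times[OF K_measurable[OF assms(1)] h] by simp
qed

text \<open>Off the ball where \<open>h\<close> vanishes, the size condition bounds the kernel by a
  constant, as the measure of \<open>bl x (\<rho> x y)\<close> is at least that of
  \<open>bl x r\<close>.\<close>

lemma K_times_integrable:
  assumes x: "x \<in> X" and r: "0 < r" and h: "integrable M h" "\<And>y. y \<in> bl x r \<Longrightarrow> h y = 0"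
  shows "integrable M (\<lambda>y. K x y * h y)"
proof (rule Bochner_Integration.integrable_bound)
  have hx: "h x = 0" using h(2) center_in_ball[OF x r] by auto
  \<comment> \<open>The sign of \<open>CK\<close> is not known, so it is replaced by its nonnegative
    part.\<close>
  show "integrable M (\<lambda>y. (max 0 CK / mu (bl x r)) * \<bar>h y\<bar>)" using h by simp
  show "(\<lambda>y. K x y * h y) \<in> borel_measurable M"
    using h hx x by (intro K_times_measurable) auto
  show "AE y in M. norm (K x y * h y) \<le> norm ((max 0 CK / mu (bl x r)) * \<bar>h y\<bar>)"
  proof (rule AE_I2)
    fix y assume y: "y \<in> X"
    show "norm (K x y * h y) \<le> norm ((max 0 CK / mu (bl x r)) * \<bar>h y\<bar>)"
    proof (cases "h y = 0")
      case False
      then have "y \<notin> bl x r" using h by auto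
      then have ry: "r \<le> \<rho> x y" using y by (auto simp: mem_ball)
      then have ne: "x \<noteq> y" using rho_eq_0[OF x y] r by auto
      have "\<bar>K x y\<bar> \<le> CK / mu (bl x (\<rho> x y))" by (rule K_size[OF x y ne])
      also have "\<dots> \<le> max 0 CK / mu (bl x (\<rho> x y))" by (intro divide_right_mono) auto
      also have "\<dots> \<le> max 0 CK / mu (bl x r)"
      proof (intro divide_left_mono mult_pos_pos)
        show "mu (bl x r) \<le> mu (bl x (\<rho> x y))"
          using x r ry by (intro measure_mono_fmeasurable ball_mono ball_sets ball_fmeasurable) auto
      qed (use x r ry ball_pos in auto)
      finally have "\<bar>K x y\<bar> \<le> max 0 CK / mu (bl x r)" .
      then have "\<bar>K x y\<bar> * \<bar>h y\<bar> \<le> max 0 CK / mu (bl x r) * \<bar>h y\<bar>" by (rule mult_right_mono) simp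
      then show ?thesis by (simp add: abs_mult)
    qed simp
  qed
qed

text \<open>Such a point lies in the interior of the zero set of \<open>h\<close>. That interior is
  open, hence disjoint from the support, even though the ball itself need not be open.\<close>

lemma T_repr_local:
  assumes h: "h \<in> L2_space M"
  shows "AE x in M. (\<exists>r>0. \<forall>y\<in>bl x r. h y = 0) \<longrightarrow> T h x = (LINT y|M. K x y * h y)"
proof -
  let ?A = "{y \<in> X. h y = 0}"
  have "qopen X \<rho> (qinterior ?A) \<and> (AE y in M. y \<in> qinterior ?A \<longrightarrow> h y = 0)"
    using qopen_qinterior qinterior_subset[of ?A] by auto
  then have sup: "qinterior ?A \<inter> ae_support M \<rho> h = {}" unfolding ae_support_def by blast
  have "AE x in M. x \<in> X \<and> (x \<notin> ae_support M \<rho> h \<longrightarrow> T h x = (LINT y|M. K x y * h y))"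
    using T_repr[OF h] by simp
  then show ?thesis
  proof (rule AE_mp, intro AE_I2 impI)
    fix x assume a: "x \<in> X \<and> (x \<notin> ae_support M \<rho> h \<longrightarrow> T h x = (LINT y|M. K x y * h y))"
      and "\<exists>r>0. \<forall>y\<in>bl x r. h y = 0"
    then have "x \<in> qinterior ?A" unfolding qinterior_def by (auto simp: mem_ball subset_iff)
    then show "T h x = (LINT y|M. K x y * h y)" using sup a by auto
  qed
qed

text \<open>\<open>T\<close> acts on representatives; the norm bound is what makes it respect null
  functions.\<close>

lemma T_AE_zero:
  assumes f: "f \<in> L2_space M" "AE x in M. f x = 0" shows "AE x in M. T f x = 0"
proof -
  have "(LINT x|M. (f x)^2) = (LINT x|M. 0)"
    by (rule integral_cong_AE) (use f in \<open>auto simp: L2_space_iff\<close>)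
  then have "(LINT x|M. (T f x)^2) \<le> 0" using T_bound[OF f(1)] by simp
  moreover have "0 \<le> (LINT x|M. (T f x)^2)" by simp
  ultimately have "(LINT x|M. (T f x)^2) = 0" by linarith
  moreover have "integrable M (\<lambda>x. (T f x)^2)" using T_L2[OF f(1)] by (simp add: L2_space_iff)
  ultimately have "AE x in M. (T f x)^2 = 0" by (simp add: integral_nonneg_eq_0_iff_AE)
  then show ?thesis by simp
qed

lemma T_sum:
  assumes "finite I" "\<And>i. i \<in> I \<Longrightarrow> b i \<in> L2_space M"
  shows "(\<lambda>y. \<Sum>i\<in>I. b i y) \<in> L2_space M \<and> (AE x in M. T (\<lambda>y. \<Sum>i\<in>I. b i y) x = (\<Sum>i\<in>I. T (b i) x))"
  using assms
proof (induction I)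
  case empty
  show ?case using zero_L2_space T_AE_zero[OF zero_L2_space] by simp
next
  case (insert i I)
  then have IH: "(\<lambda>y. \<Sum>i\<in>I. b i y) \<in> L2_space M"
      "AE x in M. T (\<lambda>y. \<Sum>i\<in>I. b i y) x = (\<Sum>i\<in>I. T (b i) x)" and bi: "b i \<in> L2_space M" by auto
  have "AE x in M. T (\<lambda>y. 1 * b i y + 1 * (\<Sum>i\<in>I. b i y)) x = 1 * T (b i) x + 1 * T (\<lambda>y. \<Sum>i\<in>I. b i y) x"
    by (rule T_linear[OF bi IH(1)])
  with IH(2) have "AE x in M. T (\<lambda>y. b i y + (\<Sum>i\<in>I. b i y)) x = T (b i) x + (\<Sum>i\<in>I. T (b i) x)"
    by eventually_elim simp
  moreover have "(\<lambda>y. 1 * b i y + 1 * (\<Sum>i\<in>I. b i y)) \<in> L2_space M" by (rule L2_space_add[OF bi IH(1)])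
  ultimately show ?case using insert by simp
qed

text \<open>Outside the ball of radius \<open>L * rad Q\<close> about its centre, points are at distance at least
  \<open>rad Q\<close> from the cube \<open>Q\<close>, and the smoothness condition on the kernel applies to all points of \<open>Q\<close>.\<close>

definition "L = \<kappa> * (1 + C0) + C0 / \<eta>"

lemma L_props: "0 < L" "\<kappa> * (1 + C0) \<le> L" "C0 \<le> \<eta> * L" "C0 \<le> L"
proof -
  have "0 < \<kappa> * (1 + C0)" using kappa_ge_1 C0_pos by (intro mult_pos_pos) auto
  then show "0 < L" "\<kappa> * (1 + C0) \<le> L" using C0_pos eta_pos by (auto simp: L_def add_pos_pos)
  show "C0 \<le> \<eta> * L" using eta_pos kappa_ge_1 C0_pos by (simp add: L_def field_simps)
  have "1 * (1 + C0) \<le> \<kappa> * (1 + C0)" using kappa_ge_1 C0_pos by (intro mult_right_mono) auto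
  moreover have "0 \<le> C0 / \<eta>" using C0_pos eta_pos by auto
  ultimately show "C0 \<le> L" unfolding L_def by (intro add_increasing2) auto
qed

lemma ball_in_dilate:
  assumes Q: "Q \<in> cubes S" and x: "x \<in> Q"
  shows "bl x (rad Q) \<subseteq> bl (ctr Q) (L * rad Q)"
proof
  fix y assume y: "y \<in> bl x (rad Q)"
  have xz: "x \<in> X" "\<rho> (ctr Q) x < C0 * rad Q" using cube_subset_ball[OF Q] x by (auto simp: mem_ball)
  have "\<rho> (ctr Q) y \<le> \<kappa> * (\<rho> (ctr Q) x + \<rho> x y)"
    using y xz ctr_space[OF Q] by (intro rho_triangle) (auto simp: mem_ball)
  also have "\<dots> < \<kappa> * (C0 * rad Q + rad Q)"
    using y xz kappa_ge_1 by (intro mult_strict_left_mono add_strict_mono) (auto simp: mem_ball)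
  also have "\<dots> = \<kappa> * (1 + C0) * rad Q" by (simp add: algebra_simps)
  also have "\<dots> \<le> L * rad Q" using L_props rad_pos[OF Q] by (intro mult_right_mono) auto
  finally show "y \<in> bl (ctr Q) (L * rad Q)" using y by (simp add: mem_ball)
qed

lemma ball_away:
  assumes Q: "Q \<in> cubes S" and x: "x \<in> X" "x \<notin> bl (ctr Q) (L * rad Q)"
  shows "bl x (rad Q) \<inter> Q = {}"
proof (rule ccontr)
  assume "bl x (rad Q) \<inter> Q \<noteq> {}"
  then obtain y where y: "y \<in> bl x (rad Q)" "y \<in> Q" by auto
  then have "\<rho> y x < rad Q" using x rho_sym[of x y] by (auto simp: mem_ball)
  then have "x \<in> bl y (rad Q)" using x by (simp add: mem_ball)
  then show False using ball_in_dilate[OF Q y(2)] x by auto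
qed

text \<open>Mean zero allows \<open>K x z\<close>, with \<open>z\<close> the centre of
  \<open>P\<close>, to be subtracted under the integral. Smoothness in the second variable then
  gives a decaying pointwise bound, which \<open>annulus_bound\<close> integrates with a constant
  \<open>h\<close>.\<close>

lemma T_mean_zero:
  obtains C where "0 < C" "\<And>P b. P \<in> cubes S \<Longrightarrow> b \<in> L2_space M \<Longrightarrow> (\<And>y. y \<notin> P \<Longrightarrow> b y = 0) \<Longrightarrow>
    (LINT y|M. b y) = 0 \<Longrightarrow>
    (\<integral>\<^sup>+x\<in>X - bl (ctr P) (L * rad P). ennreal \<bar>T b x\<bar> \<partial>M) \<le> ennreal (C * (LINT y|M. \<bar>b y\<bar>))"
proof -
  obtain C where C: "0 < C" "\<And>z s h H. z \<in> X \<Longrightarrow> 0 < s \<Longrightarrow> h \<in> borel_measurable M \<Longrightarrow>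
      (\<And>m. (\<integral>\<^sup>+y\<in>bl z (2 ^ m * s). h y \<partial>M) \<le> H * emeasure M (bl z (2 ^ m * s))) \<Longrightarrow>
      (\<integral>\<^sup>+y\<in>X - bl z s. ennreal ((s / \<rho> z y) powr \<eta> / mu (bl z (\<rho> z y))) * h y \<partial>M) \<le> ennreal C * H"
    using annulus_bound[OF eta_pos] by blast
  show thesis
  proof (rule that[OF C(1)])
    fix P b assume P: "P \<in> cubes S" and b: "b \<in> L2_space M" "\<And>y. y \<notin> P \<Longrightarrow> b y = 0"
      and b0: "(LINT y|M. b y) = 0"
    define z where "z = ctr P"
    define s where "s = L * rad P"
    define I where "I = (LINT y|M. \<bar>b y\<bar>)"
    have z: "z \<in> X" and s: "0 < s" using ctr_space[OF P] rad_pos[OF P] L_props by (auto simp: z_def s_def)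
    have bi: "integrable M b" by (rule L2_space_integrable[OF b(1) adj_fmeasurable[OF P] b(2)])
    have I0: "0 \<le> I" by (simp add: I_def)
    have pw: "\<bar>T b x\<bar> \<le> (s / \<rho> z x) powr \<eta> / mu (bl z (\<rho> z x)) * I"
      if x: "x \<in> X" "x \<notin> bl z s" and Tx: "T b x = (LINT y|M. K x y * b y)" for x
    proof -
      have zx: "s \<le> \<rho> z x" "z \<noteq> x" using x z s rho_eq_0[of z x] by (auto simp: mem_ball)
      have i1: "integrable M (\<lambda>y. K x y * b y)"
        by (rule K_times_integrable[OF x(1) rad_pos[OF P] bi])
           (use b(2) ball_away[OF P x(1)] x(2) in \<open>auto simp: z_def s_def\<close>)
      have i2: "integrable M (\<lambda>y. K x z * b y)" using bi by simp
      have "T b x = (LINT y|M. K x y * b y) - (LINT y|M. K x z * b y)" using Tx b0 by simp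
      also have "\<dots> = (LINT y|M. K x y * b y - K x z * b y)"
        by (rule Bochner_Integration.integral_diff[OF i1 i2, symmetric])
      finally have "\<bar>T b x\<bar> \<le> (LINT y|M. \<bar>K x y * b y - K x z * b y\<bar>)"
        using integral_abs_bound by metis
      also have "\<dots> \<le> (LINT y|M. (s / \<rho> z x) powr \<eta> / mu (bl z (\<rho> z x)) * \<bar>b y\<bar>)"
      proof (rule integral_mono)
        fix y assume y: "y \<in> X"
        show "\<bar>K x y * b y - K x z * b y\<bar> \<le> (s / \<rho> z x) powr \<eta> / mu (bl z (\<rho> z x)) * \<bar>b y\<bar>"
        proof (cases "b y = 0")
          case False
          then have yP: "y \<in> P" using b(2) by auto
          then have zy: "\<rho> z y < C0 * rad P" using cube_subset_ball[OF P] by (auto simp: mem_ball z_def)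
          have "\<rho> z y \<le> C0 * rad P" using zy by simp
          also have "\<dots> \<le> \<eta> * L * rad P" using L_props rad_pos[OF P] by (intro mult_right_mono) auto
          also have "\<dots> \<le> \<eta> * \<rho> z x" using zx eta_pos by (simp add: s_def mult.assoc)
          finally have sm: "\<rho> z y \<le> \<eta> * \<rho> z x" .
          have "\<rho> z y < L * rad P"
            using zy mult_right_mono[OF L_props(4), of "rad P"] rad_pos[OF P] by linarith
          then have ys: "\<rho> z y < s" by (simp add: s_def)
          then have "y \<noteq> x" using zx by auto
          then have "\<bar>K x y - K x z\<bar> \<le> (\<rho> y z / \<rho> z x) powr \<eta> / mu (bl z (\<rho> z x))"
            using K_smooth2[of z x y] z x y zx sm by auto
          also have "\<dots> \<le> (s / \<rho> z x) powr \<eta> / mu (bl z (\<rho> z x))"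
            using ys zx s eta_pos rho_sym[OF y z] rho_nonneg[OF y z]
            by (intro divide_right_mono powr_mono2 divide_nonneg_nonneg) auto
          finally have "\<bar>K x y - K x z\<bar> * \<bar>b y\<bar> \<le> (s / \<rho> z x) powr \<eta> / mu (bl z (\<rho> z x)) * \<bar>b y\<bar>"
            by (rule mult_right_mono) simp
          then show ?thesis by (simp add: left_diff_distrib[symmetric] abs_mult)
        qed simp
      qed (use i1 i2 bi in auto)
      also have "\<dots> = (s / \<rho> z x) powr \<eta> / mu (bl z (\<rho> z x)) * I" by (simp add: I_def)
      finally show ?thesis .
    qed
    have "AE x in M. x \<in> X \<longrightarrow> x \<notin> bl z s \<longrightarrow> T b x = (LINT y|M. K x y * b y)"
      using T_repr_local[OF b(1)]
    proof (rule AE_mp, intro AE_I2 impI)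
      fix x assume a: "(\<exists>r>0. \<forall>y\<in>bl x r. b y = 0) \<longrightarrow> T b x = (LINT y|M. K x y * b y)"
        and x: "x \<in> X" "x \<notin> bl z s"
      have "\<forall>y\<in>bl x (rad P). b y = 0"
        using b(2) ball_away[OF P x(1)] x(2) by (auto simp: z_def s_def)
      then show "T b x = (LINT y|M. K x y * b y)" using a rad_pos[OF P] by blast
    qed
    then have ae: "AE x in M. ennreal \<bar>T b x\<bar> * indicator (X - bl z s) x \<le>
        ennreal ((s / \<rho> z x) powr \<eta> / mu (bl z (\<rho> z x))) * ennreal I * indicator (X - bl z s) x"
    proof (rule AE_mp, intro AE_I2 impI)
      fix x assume x: "x \<in> X" "x \<in> X \<longrightarrow> x \<notin> bl z s \<longrightarrow> T b x = (LINT y|M. K x y * b y)"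
      show "ennreal \<bar>T b x\<bar> * indicator (X - bl z s) x \<le>
        ennreal ((s / \<rho> z x) powr \<eta> / mu (bl z (\<rho> z x))) * ennreal I * indicator (X - bl z s) x"
      proof (cases "x \<in> bl z s")
        case False
        then have "ennreal \<bar>T b x\<bar> \<le> ennreal ((s / \<rho> z x) powr \<eta> / mu (bl z (\<rho> z x)) * I)"
          using pw x by (intro ennreal_leI) auto
        then have "ennreal \<bar>T b x\<bar> \<le> ennreal ((s / \<rho> z x) powr \<eta> / mu (bl z (\<rho> z x))) * ennreal I"
          by (simp only: ennreal_mult''[OF I0])
        then show ?thesis using x(1) False by simp
      qed simp
    qed
    have "(\<integral>\<^sup>+x\<in>X - bl z s. ennreal \<bar>T b x\<bar> \<partial>M) \<le>
        (\<integral>\<^sup>+x\<in>X - bl z s. ennreal ((s / \<rho> z x) powr \<eta> / mu (bl z (\<rho> z x))) * ennreal I \<partial>M)"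
      by (rule nn_integral_mono_AE[OF ae])
    also have "\<dots> \<le> ennreal C * ennreal I"
      by (rule C(2)) (use z s in \<open>auto simp: nn_integral_cmult_indicator\<close>)
    finally show "(\<integral>\<^sup>+x\<in>X - bl (ctr P) (L * rad P). ennreal \<bar>T b x\<bar> \<partial>M)
        \<le> ennreal (C * (LINT y|M. \<bar>b y\<bar>))"
      using C(1) I0 by (simp add: ennreal_mult' I_def z_def s_def)
  qed
qed

text \<open>Smoothness in the first variable makes \<open>T h\<close> nearly constant on
  \<open>P\<close> when \<open>h\<close> lives far away. The tail is controlled by averages of
  \<open>h\<close> over balls about the centre, hence by the maximal function at a single point of
  \<open>P\<close>. The reference value is a kernel integral, which is defined independently of the
  representative of \<open>T h\<close>.\<close>

lemma T_oscillation:
  obtains C where "0 < C" "\<And>P h H x'. P \<in> cubes S \<Longrightarrow> h \<in> L2_space M \<Longrightarrow> integrable M h \<Longrightarrow>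
    (\<And>y. y \<in> bl (ctr P) (L * rad P) \<Longrightarrow> h y = 0) \<Longrightarrow> x' \<in> P \<Longrightarrow> 0 \<le> H \<Longrightarrow>
    cube_maximal M S h x' \<le> ennreal H \<Longrightarrow>
    AE x in M. x \<in> P \<longrightarrow> \<bar>T h x - (LINT y|M. K (ctr P) y * h y)\<bar> \<le> C * H"
proof -
  obtain C where C: "0 < C" "\<And>z s h H. z \<in> X \<Longrightarrow> 0 < s \<Longrightarrow> h \<in> borel_measurable M \<Longrightarrow>
      (\<And>m. (\<integral>\<^sup>+y\<in>bl z (2 ^ m * s). h y \<partial>M) \<le> H * emeasure M (bl z (2 ^ m * s))) \<Longrightarrow>
      (\<integral>\<^sup>+y\<in>X - bl z s. ennreal ((s / \<rho> z y) powr \<eta> / mu (bl z (\<rho> z y))) * h y \<partial>M) \<le> ennreal C * H"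
    using annulus_bound[OF eta_pos] by blast
  show thesis
  proof (rule that[of "C * A"])
    show "0 < C * A" using C A_pos by simp
    fix P h H x' assume P: "P \<in> cubes S" and h: "h \<in> L2_space M" "integrable M h"
      and h0: "\<And>y. y \<in> bl (ctr P) (L * rad P) \<Longrightarrow> h y = 0"
      and x': "x' \<in> P" and H: "0 \<le> H" "cube_maximal M S h x' \<le> ennreal H"
    define z where "z = ctr P"
    define s where "s = L * rad P"
    have z: "z \<in> X" and s: "0 < s" using ctr_space[OF P] rad_pos[OF P] L_props by (auto simp: z_def s_def)
    have hm[measurable]: "h \<in> borel_measurable M" using h by (simp add: L2_space_iff)
    have Ps: "P \<subseteq> bl z s"
      using cube_subset_ball[OF P] ball_mono[of "C0 * rad P" s z] L_props(4) rad_pos[OF P]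
      by (auto simp: z_def s_def)
    have hz: "h y = 0" if "y \<in> bl z s" for y using h0 that by (simp add: z_def s_def)
    have int: "(\<integral>\<^sup>+y\<in>X - bl z s. ennreal ((s / \<rho> z y) powr \<eta> / mu (bl z (\<rho> z y))) * ennreal \<bar>h y\<bar> \<partial>M)
        \<le> ennreal C * ennreal (H * A)"
    proof (rule C(2)[OF z s])
      fix m
      have r: "0 < 2 ^ m * s" using s by simp
      \<comment> \<open>The ball contains \<open>P\<close>, hence \<open>x'\<close>; so the average
        over a cube of comparable measure around it is among those in the maximal function at
        \<open>x'\<close>.\<close>
      obtain R where R: "R \<in> cubes S" "bl z (2 ^ m * s) \<subseteq> R" "mu R \<le> A * mu (bl z (2 ^ m * s))"
        using adjacent[OF z r] by auto
      have "bl z s \<subseteq> bl z (2 ^ m * s)"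
        using s by (intro ball_mono) simp
      then have xR: "x' \<in> R" using x' Ps R by auto
      have "(\<integral>\<^sup>+y\<in>bl z (2 ^ m * s). ennreal \<bar>h y\<bar> \<partial>M) \<le> (\<integral>\<^sup>+y\<in>R. ennreal \<bar>h y\<bar> \<partial>M)"
        using R by (intro nn_integral_mono) (auto split: split_indicator)
      also have "\<dots> \<le> cube_maximal M S h x' * emeasure M R" by (rule maximal_ge[OF R(1) xR])
      also have "\<dots> \<le> ennreal H * ennreal (A * mu (bl z (2 ^ m * s)))"
        using H R by (intro mult_mono) (auto simp: adj_emeasure intro!: ennreal_leI)
      also have "\<dots> = ennreal (H * A) * emeasure M (bl z (2 ^ m * s))"
        unfolding emeasure_eq_measure2[OF ball_fmeasurable[OF z r]]
        using H A_pos by (simp add: mult.assoc flip: ennreal_mult)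
      finally show "(\<integral>\<^sup>+y\<in>bl z (2 ^ m * s). ennreal \<bar>h y\<bar> \<partial>M) \<le>
          ennreal (H * A) * emeasure M (bl z (2 ^ m * s))" .
    qed simp
    have iz: "integrable M (\<lambda>y. K z y * h y)"
      by (rule K_times_integrable[OF z s h(2) hz])
    show "AE x in M. x \<in> P \<longrightarrow> \<bar>T h x - (LINT y|M. K (ctr P) y * h y)\<bar> \<le> C * A * H"
      using T_repr_local[OF h(1)]
    proof (rule AE_mp, intro AE_I2 impI)
      fix x assume a: "(\<exists>r>0. \<forall>y\<in>bl x r. h y = 0) \<longrightarrow> T h x = (LINT y|M. K x y * h y)"
        and xP: "x \<in> P"
      have x: "x \<in> X" using xP adj_subset_space[OF P] by auto
      have hx: "h y = 0" if "y \<in> bl x (rad P)" for y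
        using ball_in_dilate[OF P xP] that h0 by auto
      then have Tx: "T h x = (LINT y|M. K x y * h y)" using a rad_pos[OF P] by blast
      have ix: "integrable M (\<lambda>y. K x y * h y)"
        by (rule K_times_integrable[OF x rad_pos[OF P] h(2) hx])
      have "T h x - (LINT y|M. K z y * h y) = (LINT y|M. K x y * h y - K z y * h y)"
        using Bochner_Integration.integral_diff[OF ix iz] Tx by simp
      then have "\<bar>T h x - (LINT y|M. K z y * h y)\<bar> \<le> (LINT y|M. \<bar>K x y * h y - K z y * h y\<bar>)"
        using integral_abs_bound by metis
      then have "ennreal \<bar>T h x - (LINT y|M. K z y * h y)\<bar> \<le>
          ennreal (LINT y|M. \<bar>K x y * h y - K z y * h y\<bar>)" by (rule ennreal_leI)
      also have "\<dots> = (\<integral>\<^sup>+y. ennreal \<bar>K x y * h y - K z y * h y\<bar> \<partial>M)"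
        using ix iz by (intro nn_integral_eq_integral[symmetric]) auto
      also have "\<dots> \<le> (\<integral>\<^sup>+y\<in>X - bl z s. ennreal ((s / \<rho> z y) powr \<eta> / mu (bl z (\<rho> z y))) * ennreal \<bar>h y\<bar> \<partial>M)"
      proof (rule nn_integral_mono)
        fix y assume y: "y \<in> X"
        show "ennreal \<bar>K x y * h y - K z y * h y\<bar> \<le>
          ennreal ((s / \<rho> z y) powr \<eta> / mu (bl z (\<rho> z y))) * ennreal \<bar>h y\<bar> * indicator (X - bl z s) y"
        proof (cases "y \<in> bl z s")
          case False
          then have zy: "s \<le> \<rho> z y" "z \<noteq> y" using y z s rho_eq_0[of z y] by (auto simp: mem_ball)
          have xy: "x \<noteq> y" using False xP Ps by auto
          have zx: "\<rho> z x < C0 * rad P" using xP cube_subset_ball[OF P] by (auto simp: mem_ball z_def)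
          then have "\<rho> z x \<le> C0 * rad P" by simp
          also have "\<dots> \<le> \<eta> * L * rad P" using L_props rad_pos[OF P] by (intro mult_right_mono) auto
          also have "\<dots> \<le> \<eta> * \<rho> z y" using zy eta_pos by (simp add: s_def mult.assoc)
          finally have sm: "\<rho> z x \<le> \<eta> * \<rho> z y" .
          have xs: "\<rho> x z < s" using xP Ps rho_sym[OF z x] by (auto simp: mem_ball)
          have "\<bar>K x y - K z y\<bar> \<le> (\<rho> x z / \<rho> z y) powr \<eta> / mu (bl z (\<rho> z y))"
            by (rule K_smooth1[OF z y x zy(2) xy sm])
          also have "\<dots> \<le> (s / \<rho> z y) powr \<eta> / mu (bl z (\<rho> z y))"
            using xs zy s eta_pos rho_nonneg[OF x z]
            by (intro divide_right_mono powr_mono2 divide_nonneg_nonneg) auto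
          finally have "\<bar>K x y - K z y\<bar> * \<bar>h y\<bar> \<le> (s / \<rho> z y) powr \<eta> / mu (bl z (\<rho> z y)) * \<bar>h y\<bar>"
            by (rule mult_right_mono) simp
          then have "\<bar>K x y * h y - K z y * h y\<bar> \<le> (s / \<rho> z y) powr \<eta> / mu (bl z (\<rho> z y)) * \<bar>h y\<bar>"
            by (simp add: left_diff_distrib[symmetric] abs_mult)
          then show ?thesis using False y by (simp add: ennreal_leI flip: ennreal_mult'')
        qed (use hz in simp)
      qed
      also note int
      also have "ennreal C * ennreal (H * A) = ennreal (C * A * H)"
        using C H A_pos by (simp add: mult_ac flip: ennreal_mult)
      finally show "\<bar>T h x - (LINT y|M. K (ctr P) y * h y)\<bar> \<le> C * A * H"
        using C H A_pos by (simp add: z_def)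
    qed
  qed
qed

end

subsection \<open>The weak type inequality\<close>

context cz_space
begin

lemma markov:
  assumes u: "u \<in> borel_measurable M" and E: "E \<in> sets M" and l: "0 < l"
    and int: "(\<integral>\<^sup>+x\<in>E. ennreal \<bar>u x\<bar> \<partial>M) \<le> ennreal I"
  shows "emeasure M {x \<in> E. l < \<bar>u x\<bar>} \<le> ennreal (I / l)"
proof -
  have "{x \<in> E. l < \<bar>u x\<bar>} \<subseteq> {x \<in> E. 1 \<le> ennreal (1 / l) * ennreal \<bar>u x\<bar>}"
  proof
    fix x assume x: "x \<in> {x \<in> E. l < \<bar>u x\<bar>}"
    then have "ennreal 1 \<le> ennreal (1 / l * \<bar>u x\<bar>)" using l by (intro ennreal_leI) (auto simp: field_simps)
    also have "\<dots> = ennreal (1 / l) * ennreal \<bar>u x\<bar>" using l by (intro ennreal_mult) auto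
    finally show "x \<in> {x \<in> E. 1 \<le> ennreal (1 / l) * ennreal \<bar>u x\<bar>}" using x by simp
  qed
  moreover have "{x \<in> E. 1 \<le> ennreal (1 / l) * ennreal \<bar>u x\<bar>} \<in> sets M"
  proof -
    have "{x \<in> E. 1 \<le> ennreal (1 / l) * ennreal \<bar>u x\<bar>} = E \<inter> {x \<in> X. 1 \<le> ennreal (1 / l) * ennreal \<bar>u x\<bar>}"
      using sets.sets_into_space[OF E] by auto
    then show ?thesis using u E by simp
  qed
  ultimately have "emeasure M {x \<in> E. l < \<bar>u x\<bar>} \<le> emeasure M {x \<in> E. 1 \<le> ennreal (1 / l) * ennreal \<bar>u x\<bar>}"
    by (rule emeasure_mono)
  also have "\<dots> \<le> ennreal (1 / l) * (\<integral>\<^sup>+x\<in>E. ennreal \<bar>u x\<bar> \<partial>M)"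
    by (rule nn_integral_Markov_inequality) (use u E in auto)
  also have "\<dots> \<le> ennreal (1 / l) * ennreal I" by (rule mult_left_mono[OF int]) simp
  also have "\<dots> = ennreal (I / l)" using l by (simp flip: ennreal_mult')
  finally show ?thesis .
qed

lemma markov_square:
  assumes u: "u \<in> L2_space M" and l: "0 < l" and int: "(LINT x|M. (u x)^2) \<le> I"
  shows "emeasure M {x \<in> X. l < \<bar>u x\<bar>} \<le> ennreal (I / l^2)"
proof -
  have [measurable]: "u \<in> borel_measurable M" using u by (simp add: L2_space_iff)
  have "l^2 < (u x)^2" if "l < \<bar>u x\<bar>" for x
    using power_strict_mono[OF that, of 2] l by simp
  then have eq: "{x \<in> X. l < \<bar>u x\<bar>} \<subseteq> {x \<in> X. l^2 < \<bar>(u x)^2\<bar>}" by auto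
  have "(\<integral>\<^sup>+x\<in>X. ennreal \<bar>(u x)^2\<bar> \<partial>M) = (\<integral>\<^sup>+x. ennreal ((u x)^2) \<partial>M)"
    by (rule nn_integral_cong) simp
  also have "\<dots> = ennreal (LINT x|M. (u x)^2)"
    by (rule nn_integral_eq_integral) (use u in \<open>auto simp: L2_space_iff\<close>)
  also have "\<dots> \<le> ennreal I" using int by (rule ennreal_leI)
  finally have "(\<integral>\<^sup>+x\<in>X. ennreal \<bar>(u x)^2\<bar> \<partial>M) \<le> ennreal I" .
  then have "emeasure M {x \<in> X. l^2 < \<bar>(u x)^2\<bar>} \<le> ennreal (I / l^2)"
    by (intro markov) (use u l in \<open>auto simp: L2_space_iff\<close>)
  moreover have "emeasure M {x \<in> X. l < \<bar>u x\<bar>} \<le> emeasure M {x \<in> X. l^2 < \<bar>(u x)^2\<bar>}"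
    by (rule emeasure_mono[OF eq]) measurable
  ultimately show ?thesis by (rule order_trans[rotated])
qed

lemma integral_disjoint_sum_le:
  fixes f :: "'a \<Rightarrow> real"
  assumes "finite \<P>" "disjoint \<P>" "\<And>P. P \<in> \<P> \<Longrightarrow> P \<in> sets M" "integrable M f" "\<And>x. 0 \<le> f x"
  shows "(\<Sum>P\<in>\<P>. LINT x|M. f x * indicator P x) \<le> (LINT x|M. f x)"
proof -
  have i: "integrable M (\<lambda>x. f x * indicator P x)" if "P \<in> \<P>" for P
    by (rule integrable_real_mult_indicator) (use that assms in auto)
  have "(\<Sum>P\<in>\<P>. LINT x|M. f x * indicator P x) = (LINT x|M. (\<Sum>P\<in>\<P>. f x * indicator P x))"
    by (rule Bochner_Integration.integral_sum[symmetric]) (rule i)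
  also have "\<dots> \<le> (LINT x|M. f x)"
  proof (rule integral_mono)
    show "integrable M (\<lambda>x. \<Sum>P\<in>\<P>. f x * indicator P x)" using i by auto
    show "(\<Sum>P\<in>\<P>. f x * indicator P x) \<le> f x" for x
    proof -
      have "disjoint_family_on (\<lambda>P. P) \<P>"
        using assms(2) by (auto simp: disjoint_family_on_def disjoint_def)
      then have "(\<Sum>P\<in>\<P>. f x * indicator P x) = f x * indicator (\<Union>\<P>) x"
        using indicator_UN_disjoint[OF assms(1), of "\<lambda>P. P" x, where ?'c = real] by (simp add: sum_distrib_left)
      then show ?thesis using assms(5)[of x] by (auto simp: indicator_def)
    qed
  qed (rule assms)
  finally show ?thesis .
qed

text \<open>Only finitely many stopping cubes are used in the Calderon--Zygmund decomposition; the \<open>L\<^sup>2\<close>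
  mass of \<open>f\<close> on the others is small and goes into the good part.\<close>

lemma T_weak_type:
  obtains C where "0 < C" "\<And>R f l. R \<in> cubes S \<Longrightarrow> f \<in> L2_space M \<Longrightarrow> (\<And>y. y \<notin> R \<Longrightarrow> f y = 0) \<Longrightarrow>
    0 < l \<Longrightarrow> (LINT y|M. \<bar>f y\<bar>) \<le> l * mu R \<Longrightarrow>
    emeasure M {x \<in> X. l < \<bar>T f x\<bar>} \<le> ennreal (C / l * (LINT y|M. \<bar>f y\<bar>))"
proof -
  obtain C1 where C1: "0 < C1" "\<And>P b. P \<in> cubes S \<Longrightarrow> b \<in> L2_space M \<Longrightarrow> (\<And>y. y \<notin> P \<Longrightarrow> b y = 0) \<Longrightarrow>
      (LINT y|M. b y) = 0 \<Longrightarrow>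
      (\<integral>\<^sup>+x\<in>X - bl (ctr P) (L * rad P). ennreal \<bar>T b x\<bar> \<partial>M) \<le> ennreal (C1 * (LINT y|M. \<bar>b y\<bar>))"
    by (rule T_mean_zero) blast
  obtain c where c: "0 < c" "\<And>Q. Q \<in> cubes S \<Longrightarrow> mu (bl (ctr Q) (L * rad Q)) \<le> c * mu Q"
    using dilate_ball[of L] by blast
  \<comment> \<open>The terms come from the dilated stopping cubes, the good part and the bad part.
    Positivity of \<open>\<epsilon>\<close> is available only inside an actual system, hence the
    absolute value.\<close>
  define C where "C = c + 4 * Bn * (2 + 1 / \<bar>\<epsilon>\<bar>) + 4 * C1"
  show thesis
  proof (rule that[of C])
    show "0 < C" unfolding C_def using c(1) C1(1) Bn_nonneg
      by (intro add_pos_nonneg add_nonneg_nonneg mult_nonneg_nonneg) auto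
    fix R f l
    assume R: "R \<in> cubes S" and f: "f \<in> L2_space M" "\<And>y. y \<notin> R \<Longrightarrow> f y = 0" and l: "0 < l"
      and avg: "(LINT y|M. \<bar>f y\<bar>) \<le> l * mu R"
    define I where "I = (LINT y|M. \<bar>f y\<bar>)"
    have fm[measurable]: "f \<in> borel_measurable M" and f2: "integrable M (\<lambda>x. (f x)^2)"
      using f by (auto simp: L2_space_iff)
    have fi: "integrable M f" by (rule L2_space_integrable[OF f(1) adj_fmeasurable[OF R] f(2)])
    have I0: "0 \<le> I" by (simp add: I_def)
    have Tfm: "T f \<in> borel_measurable M" using T_L2[OF f(1)] by (simp add: L2_space_iff)
    show "emeasure M {x \<in> X. l < \<bar>T f x\<bar>} \<le> ennreal (C / l * (LINT y|M. \<bar>f y\<bar>))"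
    \<comment> \<open>The finite subfamily is chosen with the threshold \<open>l * I\<close>, which
      must be positive.\<close>
    proof (cases "I = 0")
      case True
      then have "AE x in M. \<bar>f x\<bar> = 0"
        using fi by (subst integral_nonneg_eq_0_iff_AE[symmetric]) (auto simp: I_def)
      then have "AE x in M. T f x = 0" using T_AE_zero[OF f(1)] by simp
      then have "AE x in M. \<not> (l < \<bar>T f x\<bar>)" using l by auto
      then have "{x \<in> X. l < \<bar>T f x\<bar>} \<in> null_sets M" using Tfm by (subst (asm) AE_iff_null) auto
      then show ?thesis by (simp add: null_setsD1)
    next
      case False
      then have Ip: "0 < I" using I0 by simp
      obtain \<D> where \<D>: "\<D> \<in> S" "dyadic_space M \<rho> \<kappa> D \<D> \<delta> C0 \<epsilon>" "R \<in> dyadic_space.\<Q> \<D>"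
        by (rule cubes_dyadic[OF R])
      interpret dyadic_space M \<rho> \<kappa> D \<D> \<delta> C0 \<epsilon> by (rule \<D>(2))
      have Qadj: "Q \<in> \<Q> \<Longrightarrow> Q \<in> cubes S" for Q using \<D>(1) cubes_eq by auto
      define J where "J P = (LINT y|M. \<bar>f y\<bar> * indicator P y)" for P
      have Ji: "integrable M (\<lambda>y. \<bar>f y\<bar> * indicator P y)" if "P \<in> sets M" for P
        by (rule integrable_real_mult_indicator) (use that fi in auto)
      have fPi: "integrable M (\<lambda>y. f y * indicator P y)" if "P \<in> sets M" for P
        by (rule integrable_real_mult_indicator) (use that fi in auto)
      define \<Phi> where "\<Phi> P \<longleftrightarrow> l * mu P < J P" for P
      have JR: "J R = I" unfolding J_def I_def
        by (rule Bochner_Integration.integral_cong) (use f(2) in \<open>auto simp: indicator_def\<close>)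
      \<comment> \<open>The bound on the average of \<open>f\<close> is assumed precisely so that
        the stopping construction can start at \<open>R\<close>.\<close>
      have nR: "\<not> \<Phi> R" using avg JR by (simp add: \<Phi>_def I_def)
      obtain \<P> where \<P>: "\<P> \<subseteq> \<Q>" "disjoint \<P>" "\<And>P. P \<in> \<P> \<Longrightarrow> P \<subset> R" "\<And>P. P \<in> \<P> \<Longrightarrow> \<Phi> P"
        "\<And>P. P \<in> \<P> \<Longrightarrow> \<exists>Q\<in>\<Q>. P \<subseteq> Q \<and> Q \<subseteq> R \<and> \<not> \<Phi> Q \<and> \<epsilon> * mu Q \<le> mu P"
        "\<And>P. P \<in> \<Q> \<Longrightarrow> P \<subseteq> R \<Longrightarrow> \<Phi> P \<Longrightarrow> \<exists>Q\<in>\<P>. P \<subseteq> Q"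
        by (rule stopping_cubes[where Q = R and \<Phi> = \<Phi>, OF \<D>(3) nR]) blast
      have Ps: "P \<in> sets M" if "P \<in> \<P>" for P using \<P>(1) that cube_sets by auto
      have U\<P>s: "\<Union>\<P> \<in> sets M" by (rule Union_cubes_sets[OF \<P>(1)])
      have up: "J P \<le> l / \<epsilon> * mu P" if P: "P \<in> \<P>" for P
      proof -
        obtain Q where Q: "Q \<in> \<Q>" "P \<subseteq> Q" "\<not> \<Phi> Q" "\<epsilon> * mu Q \<le> mu P" using \<P>(5)[OF P] by auto
        have "J P \<le> J Q" unfolding J_def
          using Q Ji[OF Ps[OF P]] Ji[OF cube_sets[OF Q(1)]]
          by (intro integral_mono) (auto simp: indicator_def)
        also have "\<dots> \<le> l * mu Q" using Q by (simp add: \<Phi>_def)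
        also have "\<dots> \<le> l * (mu P / \<epsilon>)" using Q eps_pos l by (intro mult_left_mono) (auto simp: field_simps)
        finally show ?thesis by simp
      qed

      have small: "AE x in M. x \<in> R - \<Union>\<P> \<longrightarrow> \<bar>f x\<bar> \<le> l"
      proof -
        \<comment> \<open>\<open>density\<close> needs a ratio strictly below 1. So the set where
          \<open>\<bar>f\<bar>\<close> exceeds \<open>l\<close> is exhausted by sets where it does
          so by a fixed factor; on a subcube with average at most \<open>l\<close> such a set has at
          most the inverse factor as density.\<close>
        define F where "F n = {x \<in> X. l * (1 + 1 / real (Suc n)) < \<bar>f x\<bar>} \<inter> (R - \<Union>\<P>)" for n
        have Fs: "F n \<in> sets M" for n
          unfolding F_def using adj_sets[OF R] U\<P>s by (intro sets.Int sets.Diff) auto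
        have "F n \<in> null_sets M" for n
        proof (rule density[OF \<D>(3) Fs])
          let ?t = "1 + 1 / real (Suc n)"
          have t: "1 < ?t" by simp
          show "F n \<subseteq> R" by (auto simp: F_def)
          show "0 \<le> inverse ?t" "inverse ?t < 1" using t by (auto intro: inverse_less_1_iff[THEN iffD2])
          fix P assume P: "P \<in> \<Q>" "P \<subseteq> R"
          show "mu (F n \<inter> P) \<le> inverse ?t * mu P"
          proof (cases "\<Phi> P")
            case True
            then have "F n \<inter> P = {}" using \<P>(6)[OF P] by (auto simp: F_def)
            then show ?thesis using t by simp
          next
            case False
            have fin: "F n \<inter> P \<in> fmeasurable M"
              by (rule fmeasurableI2[OF cube_fmeasurable[OF P(1)]]) (use Fs cube_sets[OF P(1)] in auto)
            have "l * ?t * mu (F n \<inter> P) = (LINT y|M. l * ?t * indicator (F n \<inter> P) y)"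
              using fin by simp
            also have "\<dots> \<le> J P" unfolding J_def
            proof (rule integral_mono)
              show "integrable M (\<lambda>y. l * ?t * indicator (F n \<inter> P) y)"
                using fin by (auto simp: fmeasurable_def)
            qed (use Ji[OF cube_sets[OF P(1)]] in \<open>auto simp: indicator_def F_def\<close>)
            also have "\<dots> \<le> l * mu P" using False by (simp add: \<Phi>_def)
            finally have "?t * mu (F n \<inter> P) \<le> mu P" using l by (simp add: mult.assoc)
            then show ?thesis using t by (simp add: divide_simps mult.commute)
          qed
        qed
        then have "(\<Union>n. F n) \<in> null_sets M" by (rule null_sets_UN)
        moreover have "{x \<in> R - \<Union>\<P>. l < \<bar>f x\<bar>} \<subseteq> (\<Union>n. F n)"
        proof
          fix x assume x: "x \<in> {x \<in> R - \<Union>\<P>. l < \<bar>f x\<bar>}"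
          then have "0 < (\<bar>f x\<bar> - l) / l" using l by simp
          then obtain n where n: "inverse (real (Suc n)) < (\<bar>f x\<bar> - l) / l" using reals_Archimedean by blast
          then have "l * inverse (real (Suc n)) < \<bar>f x\<bar> - l"
            using l by (simp add: pos_less_divide_eq mult.commute)
          then have "l * (1 + 1 / real (Suc n)) < \<bar>f x\<bar>" by (simp add: distrib_left inverse_eq_divide)
          then show "x \<in> (\<Union>n. F n)" using x adj_subset_space[OF R] unfolding F_def by blast
        qed
        ultimately show ?thesis by (intro AE_I'[of "\<Union>n. F n"]) auto
      qed

      obtain \<P>' where \<P>': "finite \<P>'" "\<P>' \<subseteq> \<P>"
        "(LINT y|M. (f y)^2 * indicator (\<Union>\<P> - \<Union>\<P>') y) \<le> l * I"
      proof (cases "\<P> = {}")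
        case True
        then show thesis using that[of "{}"] l I0 by simp
      next
        case ne: False
        define q where "q = from_nat_into \<P>"
        have rq: "range q = \<P>"
          unfolding q_def by (intro range_from_nat_into ne countable_subset[OF \<P>(1) countable_cubes])
        have qs: "q n \<in> sets M" for n using rq Ps by blast
        have "(\<lambda>N. LINT y|M. (f y)^2 * indicator (\<Union>\<P> - (\<Union>n<N. q n)) y) \<longlonglongrightarrow> (LINT y|M. 0)"
        proof (rule integral_dominated_convergence[where w = "\<lambda>y. (f y)^2"])
          show "AE y in M. (\<lambda>N. (f y)^2 * indicator (\<Union>\<P> - (\<Union>n<N. q n)) y) \<longlonglongrightarrow> 0"
          proof (rule AE_I2)
            fix y
            show "(\<lambda>N. (f y)^2 * indicator (\<Union>\<P> - (\<Union>n<N. q n)) y) \<longlonglongrightarrow> 0"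
            proof (cases "y \<in> \<Union>\<P>")
              case True
              then obtain n where "y \<in> q n" using rq by blast
              then have "eventually (\<lambda>N. (f y)^2 * indicator (\<Union>\<P> - (\<Union>n<N. q n)) y = 0) sequentially"
                by (intro eventually_sequentiallyI[of "Suc n"]) (auto simp: indicator_def)
              then show ?thesis by (rule tendsto_eventually)
            qed simp
          qed
          show "(\<lambda>y. (f y)^2 * indicator (\<Union>\<P> - (\<Union>n<N. q n)) y) \<in> borel_measurable M" for N
            using qs U\<P>s by (intro borel_measurable_times borel_measurable_indicator sets.Diff) auto
        qed (use f2 in \<open>auto simp: indicator_def\<close>)
        then have "eventually (\<lambda>N. (LINT y|M. (f y)^2 * indicator (\<Union>\<P> - (\<Union>n<N. q n)) y) < l * I) sequentially"
          using l Ip by (intro order_tendstoD) auto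
        then obtain N where "(LINT y|M. (f y)^2 * indicator (\<Union>\<P> - (\<Union>n<N. q n)) y) < l * I"
          by (auto simp: eventually_sequentially)
        then show thesis using that[of "q ` {..<N}"] rq by auto
      qed
      have P's: "P \<in> sets M" "P \<in> cubes S" "P \<in> \<Q>" "P \<in> fmeasurable M" if "P \<in> \<P>'" for P
        using that \<P>'(2) \<P>(1) cube_sets cube_fmeasurable Qadj by auto
      have P'd: "disjoint \<P>'" using \<P>(2) \<P>'(2) by (rule pairwise_subset)
      have sumJ: "(\<Sum>P\<in>\<P>'. J P) \<le> I" unfolding J_def I_def
        by (rule integral_disjoint_sum_le[OF \<P>'(1) P'd]) (use P's fi in auto)

      define a where "a P = (LINT y|M. f y * indicator P y) / mu P" for P
      define b where "b P y = f y * indicator P y - a P * indicator P y" for P y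
      \<comment> \<open>The coefficients are written out to match \<open>L2_space_add\<close> and
        \<open>T_linear\<close>.\<close>
      define g where "g y = 1 * f y + (-1) * (\<Sum>P\<in>\<P>'. b P y)" for y
      have aJ: "\<bar>a P\<bar> * mu P \<le> J P" if P: "P \<in> \<P>'" for P
      proof -
        have "\<bar>LINT y|M. f y * indicator P y\<bar> \<le> (LINT y|M. \<bar>f y * indicator P y\<bar>)"
          by (rule integral_abs_bound)
        also have "\<dots> = J P" unfolding J_def by (simp add: abs_mult)
        finally show ?thesis using cube_measure_pos[OF P's(3)[OF P]] by (simp add: a_def)
      qed
      have al: "\<bar>a P\<bar> \<le> l / \<epsilon>" if P: "P \<in> \<P>'" for P
      proof -
        have "\<bar>a P\<bar> * mu P \<le> l / \<epsilon> * mu P" using aJ[OF P] up[of P] P \<P>'(2) by auto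
        then show ?thesis
          using mult_right_le_imp_le cube_measure_pos[OF P's(3)[OF P]] by blast
      qed
      have bL: "b P \<in> L2_space M" if P: "P \<in> \<P>'" for P
      proof -
        have "(\<lambda>y. 1 * (f y * indicator P y) + (- a P) * indicator P y) \<in> L2_space M"
          by (rule L2_space_add[OF L2_space_indicator[OF f(1) P's(1)[OF P]] indicator_L2_space[OF P's(4)[OF P]]])
        then show ?thesis by (simp add: b_def[abs_def])
      qed
      have bint: "(LINT y|M. b P y) = 0" if P: "P \<in> \<P>'" for P
      proof -
        have "(LINT y|M. b P y) = (LINT y|M. f y * indicator P y) - (LINT y|M. a P * indicator P y)"
          unfolding b_def
          by (rule Bochner_Integration.integral_diff)
             (use fPi P's[OF P] in \<open>auto simp: fmeasurable_def\<close>)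
        also have "(LINT y|M. a P * indicator P y) = a P * mu P" using P's[OF P] by simp
        finally show ?thesis using cube_measure_pos[OF P's(3)[OF P]] by (simp add: a_def)
      qed
      have babs: "(LINT y|M. \<bar>b P y\<bar>) \<le> 2 * J P" if P: "P \<in> \<P>'" for P
      proof -
        have ia: "integrable M (\<lambda>y. \<bar>a P\<bar> * indicator P y)" using P's[OF P] by (auto simp: fmeasurable_def)
        have "(LINT y|M. \<bar>b P y\<bar>) \<le> (LINT y|M. \<bar>f y\<bar> * indicator P y + \<bar>a P\<bar> * indicator P y)"
        proof (rule integral_mono)
          show "integrable M (\<lambda>y. \<bar>b P y\<bar>)"
            by (rule Bochner_Integration.integrable_abs,
                rule L2_space_integrable[OF bL[OF P] P's(4)[OF P]]) (auto simp: b_def)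
          show "integrable M (\<lambda>y. \<bar>f y\<bar> * indicator P y + \<bar>a P\<bar> * indicator P y)"
            using Ji[OF P's(1)[OF P]] ia by simp
        qed (auto simp: b_def indicator_def)
        also have "\<dots> = J P + \<bar>a P\<bar> * mu P"
          using Ji[OF P's(1)[OF P]] ia P's[OF P] by (simp add: J_def)
        finally show ?thesis using aJ[OF P] by simp
      qed
      define bs where "bs y = (\<Sum>P\<in>\<P>'. b P y)" for y
      have bsum: "bs \<in> L2_space M" "AE x in M. T bs x = (\<Sum>P\<in>\<P>'. T (b P) x)"
        using T_sum[OF \<P>'(1) bL] by (auto simp: bs_def[abs_def])
      have gL: "g \<in> L2_space M"
        using L2_space_add[OF f(1) bsum(1), of 1 "-1"] by (simp add: g_def[abs_def] bs_def)

      define tl where "tl y = (f y)^2 * indicator (\<Union>\<P> - \<Union>\<P>') y" for y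
      have tli: "integrable M tl" unfolding tl_def
        by (rule integrable_real_mult_indicator[OF _ f2])
             (intro sets.Diff U\<P>s sets.finite_Union \<P>'(1), use P's(1) in auto)
      \<comment> \<open>Three regions: on a chosen cube \<open>g\<close> is its mean, at most
        \<open>l / \<epsilon>\<close> in size; on the other stopping cubes \<open>g = f\<close> and
        \<open>tl\<close> takes over; elsewhere \<open>\<bar>f\<bar> \<le> l\<close>. Integrated,
        they give the factor \<open>2 + 1 / \<epsilon>\<close>.\<close>
      have gpt: "AE y in M. (g y)^2 \<le> l * \<bar>f y\<bar> + tl y + (\<Sum>P\<in>\<P>'. l / \<epsilon> * \<bar>a P\<bar> * indicator P y)"
        using small
      proof (rule AE_mp, intro AE_I2 impI)
        fix y assume sm: "y \<in> R - \<Union>\<P> \<longrightarrow> \<bar>f y\<bar> \<le> l"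
        have pos: "0 \<le> l * \<bar>f y\<bar>" "0 \<le> tl y" "0 \<le> (\<Sum>P\<in>\<P>'. l / \<epsilon> * \<bar>a P\<bar> * indicator P y)"
          using l eps_pos by (auto simp: tl_def intro!: sum_nonneg)
        show "(g y)^2 \<le> l * \<bar>f y\<bar> + tl y + (\<Sum>P\<in>\<P>'. l / \<epsilon> * \<bar>a P\<bar> * indicator P y)"
        proof (cases "y \<in> \<Union>\<P>'")
          case True
          then obtain P where P: "P \<in> \<P>'" "y \<in> P" by auto
          have "(\<Sum>P\<in>\<P>'. b P y) = (\<Sum>P\<in>{P}. b P y)"
            using P P'd \<P>'(1) by (intro sum.mono_neutral_right) (auto simp: disjoint_def b_def indicator_def)
          then have "g y = a P" using P by (simp add: g_def b_def)
          then have "(g y)^2 = \<bar>a P\<bar> * \<bar>a P\<bar>" by (simp add: power2_eq_square)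
          also have "\<dots> \<le> l / \<epsilon> * \<bar>a P\<bar>" using al[OF P(1)] by (rule mult_right_mono) simp
          also have "\<dots> = l / \<epsilon> * \<bar>a P\<bar> * indicator P y" using P by simp
          also have "\<dots> \<le> (\<Sum>P\<in>\<P>'. l / \<epsilon> * \<bar>a P\<bar> * indicator P y)"
            by (rule member_le_sum) (use P \<P>'(1) l eps_pos in auto)
          finally show ?thesis using pos by linarith
        next
          case False
          then have "(\<Sum>P\<in>\<P>'. b P y) = 0" by (intro sum.neutral) (auto simp: b_def indicator_def)
          then have gf: "g y = f y" by (simp add: g_def)
          show ?thesis
          proof (cases "y \<in> \<Union>\<P>")
            case True
            then have "(g y)^2 = tl y" using False gf by (simp add: tl_def)
            then show ?thesis using pos by linarith
          next
            case False
            then have "\<bar>f y\<bar> \<le> l" using sm f(2)[of y] l by (cases "y \<in> R") auto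
            then have "\<bar>f y\<bar> * \<bar>f y\<bar> \<le> l * \<bar>f y\<bar>" by (rule mult_right_mono) simp
            then have "(g y)^2 \<le> l * \<bar>f y\<bar>" using gf by (simp add: power2_eq_square)
            then show ?thesis using pos by linarith
          qed
        qed
      qed
      have ind_i: "integrable M (\<lambda>y. l / \<epsilon> * \<bar>a P\<bar> * indicator P y)" if "P \<in> \<P>'" for P
        using P's[OF that] by (auto simp: fmeasurable_def)
      have "(LINT y|M. (g y)^2) \<le> (LINT y|M. l * \<bar>f y\<bar> + tl y + (\<Sum>P\<in>\<P>'. l / \<epsilon> * \<bar>a P\<bar> * indicator P y))"
      proof (rule integral_mono_AE[OF _ _ gpt])
        show "integrable M (\<lambda>y. (g y)^2)" using gL by (simp add: L2_space_iff)
        show "integrable M (\<lambda>y. l * \<bar>f y\<bar> + tl y + (\<Sum>P\<in>\<P>'. l / \<epsilon> * \<bar>a P\<bar> * indicator P y))"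
          by (intro Bochner_Integration.integrable_add Bochner_Integration.integrable_sum ind_i tli) (use fi in auto)
      qed
      also have "\<dots> = l * I + (LINT y|M. tl y) + (\<Sum>P\<in>\<P>'. LINT y|M. l / \<epsilon> * \<bar>a P\<bar> * indicator P y)"
        using fi tli ind_i by (simp add: I_def Bochner_Integration.integral_sum)
      also have "(\<Sum>P\<in>\<P>'. LINT y|M. l / \<epsilon> * \<bar>a P\<bar> * indicator P y) \<le> (\<Sum>P\<in>\<P>'. l / \<epsilon> * J P)"
      proof (rule sum_mono)
        fix P assume P: "P \<in> \<P>'"
        have "(LINT y|M. l / \<epsilon> * \<bar>a P\<bar> * indicator P y) = l / \<epsilon> * (\<bar>a P\<bar> * mu P)" using P's[OF P] by simp
        also have "\<dots> \<le> l / \<epsilon> * J P" using aJ[OF P] l eps_pos by (intro mult_left_mono) auto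
        finally show "(LINT y|M. l / \<epsilon> * \<bar>a P\<bar> * indicator P y) \<le> l / \<epsilon> * J P" .
      qed
      also have "\<dots> = l / \<epsilon> * (\<Sum>P\<in>\<P>'. J P)" by (simp add: sum_distrib_left)
      also have "\<dots> \<le> l / \<epsilon> * I" using sumJ l eps_pos by (intro mult_left_mono) auto
      also have "(LINT y|M. tl y) \<le> l * I" using \<P>'(3) by (simp add: tl_def)
      finally have "(LINT y|M. (g y)^2) \<le> (2 + 1 / \<epsilon>) * l * I" by (simp add: algebra_simps)
      then have "Bn * (LINT y|M. (g y)^2) \<le> Bn * ((2 + 1 / \<epsilon>) * l * I)" using Bn_nonneg by (rule mult_left_mono)
      then have Tg2: "(LINT y|M. (T g y)^2) \<le> Bn * ((2 + 1 / \<epsilon>) * l * I)" using T_bound[OF gL] by linarith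
      have "emeasure M {x \<in> X. l / 2 < \<bar>T g x\<bar>} \<le> ennreal (Bn * ((2 + 1 / \<epsilon>) * l * I) / (l / 2)^2)"
        by (rule markov_square[OF T_L2[OF gL] _ Tg2]) (use l in simp)
      also have "Bn * ((2 + 1 / \<epsilon>) * l * I) / (l / 2)^2 = 4 * Bn * (2 + 1 / \<epsilon>) * I / l"
        using l by (simp add: power2_eq_square field_simps)
      finally have e1: "emeasure M {x \<in> X. l / 2 < \<bar>T g x\<bar>} \<le> ennreal (4 * Bn * (2 + 1 / \<epsilon>) * I / l)" .

      \<comment> \<open>Nothing is estimated on the dilated cubes. They are small because each
        chosen cube has average above \<open>l\<close>, so its measure is below
        \<open>J P / l\<close>.\<close>
      define \<Omega> where "\<Omega> = (\<Union>P\<in>\<P>'. bl (ctr P) (L * rad P))"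
      have bls: "bl (ctr P) (L * rad P) \<in> fmeasurable M" if P: "P \<in> \<P>'" for P
        using ctr_space[OF P's(2)[OF P]] rad_pos[OF P's(2)[OF P]] L_props by (intro ball_fmeasurable) auto
      have \<Omega>s: "\<Omega> \<in> sets M" unfolding \<Omega>_def using bls \<P>'(1) by auto
      have e2: "emeasure M \<Omega> \<le> ennreal (c * I / l)"
      proof -
        have "emeasure M \<Omega> \<le> (\<Sum>P\<in>\<P>'. emeasure M (bl (ctr P) (L * rad P)))"
          unfolding \<Omega>_def by (rule emeasure_subadditive_finite) (use \<P>'(1) bls in auto)
        also have "\<dots> \<le> (\<Sum>P\<in>\<P>'. ennreal (c / l * J P))"
        proof (rule sum_mono)
          fix P assume P: "P \<in> \<P>'"
          have "emeasure M (bl (ctr P) (L * rad P)) = ennreal (mu (bl (ctr P) (L * rad P)))"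
            by (rule emeasure_eq_measure2[OF bls[OF P]])
          also have "\<dots> \<le> ennreal (c / l * J P)"
          proof (rule ennreal_leI)
            have "mu (bl (ctr P) (L * rad P)) \<le> c * mu P" by (rule c(2)[OF P's(2)[OF P]])
            also have "\<dots> \<le> c * (J P / l)"
              using \<P>(4)[of P] P \<P>'(2) l c(1) by (intro mult_left_mono) (auto simp: \<Phi>_def field_simps)
            finally show "mu (bl (ctr P) (L * rad P)) \<le> c / l * J P" by simp
          qed
          finally show "emeasure M (bl (ctr P) (L * rad P)) \<le> ennreal (c / l * J P)" .
        qed
        also have "\<dots> = ennreal (\<Sum>P\<in>\<P>'. c / l * J P)"
          by (rule sum_ennreal) (use c l in \<open>auto simp: J_def\<close>)
        also have "\<dots> \<le> ennreal (c * I / l)"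
        proof (rule ennreal_leI)
          have "(\<Sum>P\<in>\<P>'. c / l * J P) = c / l * (\<Sum>P\<in>\<P>'. J P)" by (simp add: sum_distrib_left)
          also have "\<dots> \<le> c / l * I" using sumJ c l by (intro mult_left_mono) auto
          finally show "(\<Sum>P\<in>\<P>'. c / l * J P) \<le> c * I / l" by simp
        qed
        finally show ?thesis .
      qed
      define u where "u x = (\<Sum>P\<in>\<P>'. T (b P) x)" for x
      have Tbm: "T (b P) \<in> borel_measurable M" if "P \<in> \<P>'" for P
        using T_L2[OF bL[OF that]] by (simp add: L2_space_iff)
      have um: "u \<in> borel_measurable M" unfolding u_def using Tbm by auto
      have "(\<integral>\<^sup>+x\<in>X - \<Omega>. ennreal \<bar>u x\<bar> \<partial>M) \<le>
          (\<integral>\<^sup>+x. (\<Sum>P\<in>\<P>'. ennreal \<bar>T (b P) x\<bar> * indicator (X - bl (ctr P) (L * rad P)) x) \<partial>M)"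
      proof (rule nn_integral_mono)
        fix x assume x: "x \<in> X"
        show "ennreal \<bar>u x\<bar> * indicator (X - \<Omega>) x \<le>
          (\<Sum>P\<in>\<P>'. ennreal \<bar>T (b P) x\<bar> * indicator (X - bl (ctr P) (L * rad P)) x)"
        proof (cases "x \<in> \<Omega>")
          case False
          have "ennreal \<bar>u x\<bar> \<le> ennreal (\<Sum>P\<in>\<P>'. \<bar>T (b P) x\<bar>)"
            unfolding u_def by (intro ennreal_leI sum_abs)
          also have "\<dots> = (\<Sum>P\<in>\<P>'. ennreal \<bar>T (b P) x\<bar>)" by (rule sum_ennreal[symmetric]) simp
          also have "\<dots> = (\<Sum>P\<in>\<P>'. ennreal \<bar>T (b P) x\<bar> * indicator (X - bl (ctr P) (L * rad P)) x)"
            using False x by (intro sum.cong) (auto simp: \<Omega>_def)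
          finally show ?thesis using False x by simp
        qed simp
      qed
      also have "\<dots> = (\<Sum>P\<in>\<P>'. (\<integral>\<^sup>+x\<in>X - bl (ctr P) (L * rad P). ennreal \<bar>T (b P) x\<bar> \<partial>M))"
        by (rule nn_integral_sum) (use Tbm bls in auto)
      also have "\<dots> \<le> (\<Sum>P\<in>\<P>'. ennreal (2 * C1 * J P))"
      proof (rule sum_mono)
        fix P assume P: "P \<in> \<P>'"
        have "(\<integral>\<^sup>+x\<in>X - bl (ctr P) (L * rad P). ennreal \<bar>T (b P) x\<bar> \<partial>M) \<le> ennreal (C1 * (LINT y|M. \<bar>b P y\<bar>))"
          by (rule C1(2)[OF P's(2)[OF P] bL[OF P] _ bint[OF P]]) (auto simp: b_def)
        also have "\<dots> \<le> ennreal (C1 * (2 * J P))"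
          using babs[OF P] C1(1) by (intro ennreal_leI mult_left_mono) auto
        finally show "(\<integral>\<^sup>+x\<in>X - bl (ctr P) (L * rad P). ennreal \<bar>T (b P) x\<bar> \<partial>M) \<le> ennreal (2 * C1 * J P)"
          by (simp add: mult_ac)
      qed
      also have "\<dots> = ennreal (\<Sum>P\<in>\<P>'. 2 * C1 * J P)"
        by (rule sum_ennreal) (use C1 in \<open>auto simp: J_def\<close>)
      also have "\<dots> \<le> ennreal (2 * C1 * I)"
      proof (rule ennreal_leI)
        have "(\<Sum>P\<in>\<P>'. 2 * C1 * J P) = 2 * C1 * (\<Sum>P\<in>\<P>'. J P)" by (simp add: sum_distrib_left)
        also have "\<dots> \<le> 2 * C1 * I" using sumJ C1 by (intro mult_left_mono) auto
        finally show "(\<Sum>P\<in>\<P>'. 2 * C1 * J P) \<le> 2 * C1 * I" .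
      qed
      finally have "emeasure M {x \<in> X - \<Omega>. l / 2 < \<bar>u x\<bar>} \<le> ennreal (2 * C1 * I / (l / 2))"
        by (intro markov[OF um]) (use l \<Omega>s in auto)
      then have e3: "emeasure M {x \<in> X - \<Omega>. l / 2 < \<bar>u x\<bar>} \<le> ennreal (4 * C1 * I / l)"
        by (simp add: mult.assoc)

      have "AE x in M. T (\<lambda>y. 1 * g y + 1 * bs y) x = 1 * T g x + 1 * T bs x"
        by (rule T_linear[OF gL bsum(1)])
      moreover have "(\<lambda>y. 1 * g y + 1 * bs y) = f" by (auto simp: g_def bs_def)
      ultimately have "AE x in M. T f x = T g x + T bs x" by simp
      with bsum(2) have dec: "AE x in M. T f x = T g x + u x" by eventually_elim (simp add: u_def)
      have "AE x in M. x \<in> {x \<in> X. l < \<bar>T f x\<bar>} \<longrightarrow>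
          x \<in> \<Omega> \<union> {x \<in> X. l / 2 < \<bar>T g x\<bar>} \<union> {x \<in> X - \<Omega>. l / 2 < \<bar>u x\<bar>}"
        using dec by eventually_elim auto
      then have "emeasure M {x \<in> X. l < \<bar>T f x\<bar>} \<le>
          emeasure M (\<Omega> \<union> {x \<in> X. l / 2 < \<bar>T g x\<bar>} \<union> {x \<in> X - \<Omega>. l / 2 < \<bar>u x\<bar>})"
        by (rule emeasure_mono_AE) (use \<Omega>s um T_L2[OF gL] in \<open>auto simp: L2_space_iff\<close>)
      also have "\<dots> \<le> emeasure M (\<Omega> \<union> {x \<in> X. l / 2 < \<bar>T g x\<bar>}) + emeasure M {x \<in> X - \<Omega>. l / 2 < \<bar>u x\<bar>}"
        by (rule emeasure_subadditive) (use \<Omega>s um T_L2[OF gL] in \<open>auto simp: L2_space_iff\<close>)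
      also have "emeasure M (\<Omega> \<union> {x \<in> X. l / 2 < \<bar>T g x\<bar>}) \<le> emeasure M \<Omega> + emeasure M {x \<in> X. l / 2 < \<bar>T g x\<bar>}"
        by (rule emeasure_subadditive) (use \<Omega>s um T_L2[OF gL] in \<open>auto simp: L2_space_iff\<close>)
      also have "emeasure M \<Omega> + emeasure M {x \<in> X. l / 2 < \<bar>T g x\<bar>} + emeasure M {x \<in> X - \<Omega>. l / 2 < \<bar>u x\<bar>}
          \<le> ennreal (c * I / l) + ennreal (4 * Bn * (2 + 1 / \<epsilon>) * I / l) + ennreal (4 * C1 * I / l)"
        by (intro add_mono e1 e2 e3)
      also have "\<dots> = ennreal (c * I / l + 4 * Bn * (2 + 1 / \<epsilon>) * I / l + 4 * C1 * I / l)"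
        using c C1 I0 l Bn_nonneg eps_pos by (simp add: ennreal_plus[symmetric] del: ennreal_plus)
      also have "c * I / l + 4 * Bn * (2 + 1 / \<epsilon>) * I / l + 4 * C1 * I / l = C / l * I"
        using eps_pos by (simp add: C_def add_divide_distrib algebra_simps)
      finally show ?thesis by (simp add: I_def)
    qed
  qed
qed

end

subsection \<open>Sparse domination\<close>

primrec iterate_family :: "('b \<Rightarrow> 'b set) \<Rightarrow> nat \<Rightarrow> 'b \<Rightarrow> 'b set" where
  "iterate_family st 0 P = {P}"
| "iterate_family st (Suc n) P = (\<Union>R\<in>st P. iterate_family st n R)"

context dyadic_space
begin

definition "stop_family Q \<P> \<longleftrightarrow> \<P> \<subseteq> \<Q> \<and> disjoint \<P> \<and> (\<forall>P\<in>\<P>. P \<subset> Q) \<and> mu (\<Union>\<P>) \<le> mu Q / 2"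

definition "stopping st \<longleftrightarrow> (\<forall>Q\<in>\<Q>. stop_family Q (st Q))"

context
  fixes st assumes st: "stopping st"
begin

lemma stD:
  assumes "Q \<in> \<Q>"
  shows "st Q \<subseteq> \<Q>" "disjoint (st Q)" "\<And>P. P \<in> st Q \<Longrightarrow> P \<subset> Q" "mu (\<Union>(st Q)) \<le> mu Q / 2"
  using st assms unfolding stopping_def stop_family_def by auto

lemma iterate_sub: "Q \<in> \<Q> \<Longrightarrow> P \<in> iterate_family st n Q \<Longrightarrow> P \<in> \<Q> \<and> P \<subseteq> Q"
proof (induction n arbitrary: Q)
  case (Suc n)
  then obtain R where R: "R \<in> st Q" "P \<in> iterate_family st n R" by auto
  then have "R \<in> \<Q>" "R \<subset> Q" using stD[OF Suc.prems(1)] by auto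
  then show ?case using Suc.IH R by blast
qed auto

lemma iterate_Union_sets: "Q \<in> \<Q> \<Longrightarrow> \<Union>(iterate_family st n Q) \<in> sets M"
  using iterate_sub by (intro Union_cubes_sets) auto

lemma iterate_measure:
  "Q \<in> \<Q> \<Longrightarrow> emeasure M (\<Union>(iterate_family st n Q)) \<le> ennreal ((1/2) ^ n) * emeasure M Q"
proof (induction n arbitrary: Q)
  case (Suc n)
  note Q = Suc.prems
  have R: "R \<in> \<Q>" "R \<subseteq> Q" if "R \<in> st Q" for R using stD[OF Q] that by auto
  have "\<Union>(iterate_family st (Suc n) Q) = (\<Union>R\<in>st Q. \<Union>(iterate_family st n R))" by auto
  also have "emeasure M \<dots> = (\<integral>\<^sup>+R. emeasure M (\<Union>(iterate_family st n R)) \<partial>count_space (st Q))"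
  proof (rule emeasure_UN_countable)
    show "countable (st Q)" by (rule countable_subset[OF stD(1)[OF Q] countable_cubes])
    show "disjoint_family_on (\<lambda>R. \<Union>(iterate_family st n R)) (st Q)"
      unfolding disjoint_family_on_def
    proof (intro ballI impI)
      fix R R' assume RR: "R \<in> st Q" "R' \<in> st Q" "R \<noteq> R'"
      then have "R \<inter> R' = {}" using stD(2)[OF Q] by (auto simp: disjoint_def)
      moreover have "\<Union>(iterate_family st n R) \<subseteq> R" "\<Union>(iterate_family st n R') \<subseteq> R'"
        using iterate_sub R RR by blast+
      ultimately show "\<Union>(iterate_family st n R) \<inter> \<Union>(iterate_family st n R') = {}" by blast
    qed
  qed (use R iterate_Union_sets in auto)
  also have "\<dots> \<le> (\<integral>\<^sup>+R. ennreal ((1/2) ^ n) * emeasure M (X \<inter> R) \<partial>count_space (st Q))"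
  proof (rule nn_integral_mono)
    fix R assume "R \<in> space (count_space (st Q))"
    then have "R \<in> \<Q>" using R by auto
    then show "emeasure M (\<Union>(iterate_family st n R)) \<le> ennreal ((1/2) ^ n) * emeasure M (X \<inter> R)"
      using Suc.IH cube_subset_space by (simp add: Int_absorb1)
  qed
  also have "\<dots> = ennreal ((1/2) ^ n) * emeasure M (X \<inter> \<Union>(st Q))"
    by (subst emeasure_Union_cubes[OF stD(1,2)[OF Q]]) (auto simp: nn_integral_cmult)
  also have "X \<inter> \<Union>(st Q) = \<Union>(st Q)" using R cube_subset_space by blast
  also have "ennreal ((1/2) ^ n) * emeasure M (\<Union>(st Q)) \<le> ennreal ((1/2) ^ n) * (ennreal (1/2) * emeasure M Q)"
  proof (rule mult_left_mono)
    have "\<Union>(st Q) \<in> fmeasurable M"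
      by (rule fmeasurableI2[OF cube_fmeasurable[OF Q]])
         (use R Union_cubes_sets[OF stD(1)[OF Q]] in auto)
    then have "emeasure M (\<Union>(st Q)) \<le> ennreal (1/2 * mu Q)"
      using stD(4)[OF Q] by (simp add: emeasure_eq_measure2 ennreal_leI)
    also have "\<dots> = ennreal (1/2) * emeasure M Q"
      unfolding emeasure_eq_measure2[OF cube_fmeasurable[OF Q]] by (rule ennreal_mult') simp
    finally show "emeasure M (\<Union>(st Q)) \<le> ennreal (1/2) * emeasure M Q" .
  qed simp
  also have "\<dots> = ennreal ((1/2) ^ Suc n) * emeasure M Q"
    by (simp only: mult.assoc[symmetric] ennreal_mult'[symmetric] power_Suc2 zero_le_power
          zero_le_divide_1_iff zero_le_numeral)
  finally show ?case .
qed simp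

text \<open>Each round halves the measure, so almost every point leaves the stopping cubes after
  finitely many rounds.\<close>

lemma iterate_Inter_null:
  assumes Q: "Q \<in> \<Q>" shows "(\<Inter>n. \<Union>(iterate_family st n Q)) \<in> null_sets M"
proof -
  let ?N = "\<Inter>n. \<Union>(iterate_family st n Q)"
  have Ns: "?N \<in> sets M" using iterate_Union_sets[OF Q] by auto
  have "emeasure M ?N \<le> ennreal ((1/2) ^ n * mu Q)" for n
  proof -
    have "emeasure M ?N \<le> emeasure M (\<Union>(iterate_family st n Q))"
      by (rule emeasure_mono) (use iterate_Union_sets[OF Q] in auto)
    also have "\<dots> \<le> ennreal ((1/2) ^ n) * emeasure M Q" by (rule iterate_measure[OF Q])
    also have "\<dots> = ennreal ((1/2) ^ n * mu Q)"
      using cube_fmeasurable[OF Q] by (simp add: emeasure_eq_measure2 ennreal_mult')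
    finally show ?thesis .
  qed
  moreover have "(\<lambda>n. ennreal ((1/2) ^ n * mu Q)) \<longlonglongrightarrow> ennreal (0 * mu Q)"
    by (intro tendsto_ennrealI tendsto_mult LIMSEQ_realpow_zero tendsto_const) auto
  ultimately have "emeasure M ?N \<le> ennreal (0 * mu Q)"
    by (intro LIMSEQ_le_const) auto
  then show ?thesis using Ns by (intro null_setsI) auto
qed

definition "remainder P = P - \<Union>(st P)"

text \<open>Descend along both chains of stopping cubes. If they part, the two cubes lie in disjoint
  children; if one chain ends first, the other cube lies in a child of its end, which the remainder
  omits.\<close>

lemma iterate_disjoint:
  "Q \<in> \<Q> \<Longrightarrow> P1 \<in> iterate_family st n Q \<Longrightarrow> P2 \<in> iterate_family st m Q \<Longrightarrow>
    P1 = P2 \<or> remainder P1 \<inter> remainder P2 = {}"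
proof (induction n arbitrary: m Q)
  case 0
  show ?case
  proof (cases m)
    case (Suc m')
    then obtain R where R: "R \<in> st Q" "P2 \<in> iterate_family st m' R" using 0 by auto
    then have "P2 \<subseteq> R" using iterate_sub stD(1)[OF 0(1)] by blast
    then show ?thesis using R 0 by (auto simp: remainder_def)
  qed (use 0 in auto)
next
  case (Suc n)
  obtain R1 where R1: "R1 \<in> st Q" "P1 \<in> iterate_family st n R1" using Suc.prems by auto
  have R1Q: "R1 \<in> \<Q>" using R1 stD(1)[OF Suc.prems(1)] by auto
  have P1: "P1 \<subseteq> R1" using iterate_sub R1 R1Q by blast
  show ?case
  proof (cases m)
    case 0
    then show ?thesis using Suc.prems P1 R1 by (auto simp: remainder_def)
  next
    case (Suc m')
    then obtain R2 where R2: "R2 \<in> st Q" "P2 \<in> iterate_family st m' R2" using Suc.prems by auto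
    have R2Q: "R2 \<in> \<Q>" using R2 stD(1)[OF Suc.prems(1)] by auto
    have P2: "P2 \<subseteq> R2" using iterate_sub R2 R2Q by blast
    show ?thesis
    proof (cases "R1 = R2")
      case True
      then show ?thesis using Suc.IH[OF R1Q R1(2)] R2 by auto
    next
      case False
      then have "R1 \<inter> R2 = {}" using stD(2)[OF Suc.prems(1)] R1 R2 by (auto simp: disjoint_def)
      then show ?thesis using P1 P2 by (auto simp: remainder_def)
    qed
  qed
qed

lemma remainder_props:
  assumes P: "P \<in> \<Q>" shows "remainder P \<in> sets M" "remainder P \<subseteq> P" "mu P \<le> 2 * mu (remainder P)"
proof -
  have Us: "\<Union>(st P) \<in> sets M" by (rule Union_cubes_sets[OF stD(1)[OF P]])
  show "remainder P \<in> sets M" unfolding remainder_def using Us cube_sets[OF P] by (rule sets.Diff[rotated])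
  show "remainder P \<subseteq> P" by (auto simp: remainder_def)
  have "mu (remainder P) = mu P - mu (\<Union>(st P))" unfolding remainder_def
  proof (rule measure_Diff)
    show "emeasure M P \<noteq> \<infinity>" using cube_fmeasurable[OF P] by (auto simp: fmeasurable_def)
    show "\<Union>(st P) \<subseteq> P" using stD(3)[OF P] by auto
  qed (use Us cube_sets[OF P] in auto)
  then show "mu P \<le> 2 * mu (remainder P)" using stD(4)[OF P] by simp
qed

text \<open>\<open>H\<close> may depend on \<open>x\<close>: at a given point only finitely many
  stopping cubes matter, and no infinite sum occurs.\<close>

definition "iterate_bound G F c Q x \<longleftrightarrow> (\<exists>H. finite H \<and> H \<subseteq> (\<Union>i. iterate_family st i Q) \<and> Q \<in> H \<and>
  (\<forall>P\<in>H. x \<in> P) \<and> G Q x \<le> c * F Q + 2 * c * (\<Sum>P\<in>H - {Q}. F P))"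
  for G :: "'a set \<Rightarrow> 'a \<Rightarrow> real" and F :: "'a set \<Rightarrow> real"

text \<open>Iterating from the top keeps the induction hypothesis uniform in the starting cube. The cube
  \<open>Q\<close> itself is counted with the smaller constant \<open>c\<close>, because in each step the average over a
  stopping cube enters twice.\<close>

lemma iterate_domination:
  fixes F :: "'a set \<Rightarrow> real" and G :: "'a set \<Rightarrow> 'a \<Rightarrow> real"
  assumes top: "\<And>Q. Q \<in> \<Q> \<Longrightarrow> AE x in M. x \<in> Q - \<Union>(st Q) \<longrightarrow> G Q x \<le> c * F Q"
    and step: "\<And>Q P. Q \<in> \<Q> \<Longrightarrow> P \<in> st Q \<Longrightarrow> AE x in M. x \<in> P \<longrightarrow> G Q x \<le> G P x + c * (F Q + F P)"
    and Q: "Q \<in> \<Q>"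
  shows "AE x in M. x \<in> Q \<longrightarrow> x \<notin> \<Union>(iterate_family st n Q) \<longrightarrow> iterate_bound G F c Q x"
  using Q
proof (induction n arbitrary: Q)
  case (Suc n)
  note Q = Suc.prems
  have cnt: "countable (st Q)" by (rule countable_subset[OF stD(1)[OF Q] countable_cubes])
  have "AE x in M. \<forall>R\<in>st Q. x \<in> R \<longrightarrow> x \<notin> \<Union>(iterate_family st n R) \<longrightarrow> iterate_bound G F c R x"
    using Suc.IH stD(1)[OF Q] by (subst AE_ball_countable[OF cnt]) blast
  moreover have "AE x in M. \<forall>R\<in>st Q. x \<in> R \<longrightarrow> G Q x \<le> G R x + c * (F Q + F R)"
    using step[OF Q] by (subst AE_ball_countable[OF cnt]) blast
  ultimately show ?case using top[OF Q]
  proof (eventually_elim, intro impI)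
    fix x
    assume IH: "\<forall>R\<in>st Q. x \<in> R \<longrightarrow> x \<notin> \<Union>(iterate_family st n R) \<longrightarrow> iterate_bound G F c R x"
      and st1: "\<forall>R\<in>st Q. x \<in> R \<longrightarrow> G Q x \<le> G R x + c * (F Q + F R)"
      and tp: "x \<in> Q - \<Union>(st Q) \<longrightarrow> G Q x \<le> c * F Q"
      and x: "x \<in> Q" "x \<notin> \<Union>(iterate_family st (Suc n) Q)"
    show "iterate_bound G F c Q x"
    proof (cases "x \<in> \<Union>(st Q)")
      case False
      have "Q \<in> iterate_family st 0 Q" by simp
      then have "{Q} \<subseteq> (\<Union>i. iterate_family st i Q)" by blast
      then show ?thesis
        unfolding iterate_bound_def using tp x False by (intro exI[of _ "{Q}"]) auto
    next
      case True
      then obtain R where R: "R \<in> st Q" "x \<in> R" by auto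
      have xn: "x \<notin> \<Union>(iterate_family st n R)" using x(2) R(1) unfolding iterate_family.simps by blast
      obtain H where H: "finite H" "H \<subseteq> (\<Union>i. iterate_family st i R)" "R \<in> H" "\<forall>P\<in>H. x \<in> P"
          "G R x \<le> c * F R + 2 * c * (\<Sum>P\<in>H - {R}. F P)"
        using IH[rule_format, OF R xn] unfolding iterate_bound_def by (elim exE conjE) (rule that)
      have RQ: "R \<in> \<Q>" "R \<subset> Q" using stD(1,3)[OF Q] R by auto
      \<comment> \<open>Stopping cubes are strictly smaller, so adding \<open>Q\<close> to
        \<open>H\<close> really adds a new term.\<close>
      have QH: "Q \<notin> H"
      proof
        assume "Q \<in> H"
        then obtain i where "Q \<in> iterate_family st i R" using H(2) by auto
        then show False using iterate_sub[OF RQ(1)] RQ(2) by blast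
      qed
      have sub: "insert Q H \<subseteq> (\<Union>i. iterate_family st i Q)"
      proof
        fix P assume "P \<in> insert Q H"
        then consider "P = Q" | i where "P \<in> iterate_family st i R" using H(2) by auto
        then show "P \<in> (\<Union>i. iterate_family st i Q)"
        proof cases
          case 1
          then have "P \<in> iterate_family st 0 Q" by simp
          then show ?thesis by blast
        next
          case (2 i)
          then have "P \<in> iterate_family st (Suc i) Q" using R by auto
          then show ?thesis by blast
        qed
      qed
      have "(\<Sum>P\<in>H. F P) = F R + (\<Sum>P\<in>H - {R}. F P)" by (rule sum.remove[OF H(1,3)])
      moreover have "G Q x \<le> G R x + c * (F Q + F R)" using st1 R by auto
      ultimately have "G Q x \<le> c * F Q + 2 * c * (\<Sum>P\<in>H. F P)"
        using H(5) by (simp add: algebra_simps)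
      moreover have "insert Q H - {Q} = H" using QH by auto
      ultimately show ?thesis
        unfolding iterate_bound_def using H sub x(1) by (intro exI[of _ "insert Q H"]) auto
    qed
  qed
qed simp

end

end

context homogeneous_space
begin

definition "sparse_family E \<S> \<longleftrightarrow> disjoint_family_on E \<S> \<and>
  (\<forall>P\<in>\<S>. E P \<in> sets M \<and> E P \<subseteq> P \<and> mu P \<le> 2 * mu (E P))"

lemma sparse_familyD:
  assumes "sparse_family E \<S>"
  shows "disjoint_family_on E \<S>" "P \<in> \<S> \<Longrightarrow> E P \<in> sets M \<and> E P \<subseteq> P \<and> mu P \<le> 2 * mu (E P)"
  using assms by (auto simp: sparse_family_def)

lemma sparse_family_subset: "sparse_family E \<S> \<Longrightarrow> \<S>' \<subseteq> \<S> \<Longrightarrow> sparse_family E \<S>'"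
  unfolding sparse_family_def by (auto intro: disjoint_family_on_mono)

end

context adjacent_space
begin

lemma maximal_add:
  assumes [measurable]: "f \<in> borel_measurable M" "g \<in> borel_measurable M"
    and h: "\<And>y. \<bar>h y\<bar> \<le> \<bar>f y\<bar> + \<bar>g y\<bar>"
  shows "cube_maximal M S h x \<le> cube_maximal M S f x + cube_maximal M S g x"
  unfolding cube_maximal_def[of M S h]
proof (rule SUP_least)
  fix Q assume Q: "Q \<in> {Q \<in> cubes S. x \<in> Q}"
  then have [measurable]: "Q \<in> sets M" using adj_sets by auto
  have "(\<integral>\<^sup>+y\<in>Q. ennreal \<bar>h y\<bar> \<partial>M) \<le> (\<integral>\<^sup>+y. ennreal \<bar>f y\<bar> * indicator Q y + ennreal \<bar>g y\<bar> * indicator Q y \<partial>M)"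
    using h by (intro nn_integral_mono)
      (auto split: split_indicator simp: ennreal_plus[symmetric] simp del: ennreal_plus intro!: ennreal_leI)
  also have "\<dots> = (\<integral>\<^sup>+y\<in>Q. ennreal \<bar>f y\<bar> \<partial>M) + (\<integral>\<^sup>+y\<in>Q. ennreal \<bar>g y\<bar> \<partial>M)"
    by (rule nn_integral_add) auto
  finally have "(\<integral>\<^sup>+y\<in>Q. ennreal \<bar>h y\<bar> \<partial>M) / emeasure M Q \<le>
      ((\<integral>\<^sup>+y\<in>Q. ennreal \<bar>f y\<bar> \<partial>M) + (\<integral>\<^sup>+y\<in>Q. ennreal \<bar>g y\<bar> \<partial>M)) / emeasure M Q"
    by (rule divide_right_mono_ennreal)
  also have "\<dots> = (\<integral>\<^sup>+y\<in>Q. ennreal \<bar>f y\<bar> \<partial>M) / emeasure M Q + (\<integral>\<^sup>+y\<in>Q. ennreal \<bar>g y\<bar> \<partial>M) / emeasure M Q"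
    by (rule add_divide_distrib_ennreal)
  also have "\<dots> \<le> cube_maximal M S f x + cube_maximal M S g x"
    unfolding cube_maximal_def using Q by (intro add_mono SUP_upper)
  finally show "(\<integral>\<^sup>+y\<in>Q. ennreal \<bar>h y\<bar> \<partial>M) / emeasure M Q \<le> cube_maximal M S f x + cube_maximal M S g x" .
qed

lemma maximal_zero:
  assumes "AE y in M. f y = 0" shows "cube_maximal M S f x = 0"
proof -
  have "(\<integral>\<^sup>+y\<in>Q. ennreal \<bar>f y\<bar> \<partial>M) = 0" for Q
  proof -
    have "(\<integral>\<^sup>+y\<in>Q. ennreal \<bar>f y\<bar> \<partial>M) = (\<integral>\<^sup>+y. 0 \<partial>M)"
      by (rule nn_integral_cong_AE) (use assms in eventually_elim, simp)
    then show ?thesis by simp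
  qed
  then have "cube_maximal M S f x \<le> 0" unfolding cube_maximal_def by (intro SUP_least) auto
  then show ?thesis by simp
qed

text \<open>Radii were chosen per set and are not tied to generations. A point of \<open>Q\<close>
  outside \<open>P\<close> is at distance at least \<open>rad P\<close> from the centre of
  \<open>P\<close>, yet both points lie in \<open>Q\<close>.\<close>

lemma rad_strict_subset:
  assumes "P \<in> cubes S" "Q \<in> cubes S" "P \<subset> Q" shows "rad P \<le> 2 * \<kappa> * C0 * rad Q"
proof -
  obtain y where y: "y \<in> Q" "y \<notin> P" using assms by auto
  have cP: "ctr P \<in> X" by (rule ctr_space[OF assms(1)])
  have yX: "y \<in> X" using y adj_subset_space[OF assms(2)] by auto
  have "ctr P \<in> Q"
    using center_in_ball[OF cP rad_pos[OF assms(1)]] ball_subset_cube[OF assms(1)] assms(3) by auto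
  then have d: "\<rho> (ctr Q) (ctr P) < C0 * rad Q" "\<rho> (ctr Q) y < C0 * rad Q"
    using y cube_subset_ball[OF assms(2)] by (auto simp: mem_ball)
  have "rad P \<le> \<rho> (ctr P) y"
    using y yX ball_subset_cube[OF assms(1)] by (force simp: qball_def)
  also have "\<dots> \<le> \<kappa> * (\<rho> (ctr P) (ctr Q) + \<rho> (ctr Q) y)"
    by (rule rho_triangle[OF cP ctr_space[OF assms(2)] yX])
  also have "\<dots> \<le> \<kappa> * (C0 * rad Q + C0 * rad Q)"
    using d kappa_ge_1 rho_sym[OF cP ctr_space[OF assms(2)]]
    by (intro mult_left_mono add_mono) auto
  finally show ?thesis by (simp add: algebra_simps)
qed

end

section \<open>One stopping step for the operator, and its iteration\<close>

context cz_space
begin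

text \<open>With this dilation factor, the cube attached to \<open>Q\<close> contains \<open>bl (ctr P) (L * rad P)\<close> not only
  for \<open>P = Q\<close> but for every cube \<open>P\<close> strictly inside \<open>Q\<close>.\<close>

definition "L' = L + \<kappa> * (C0 + 2 * \<kappa> * C0 * L)"

lemma L'_pos: "0 < L'" and L'_ge: "L \<le> L'"
proof -
  have "0 \<le> \<kappa> * (C0 + 2 * \<kappa> * C0 * L)"
    using kappa_ge_1 C0_pos L_props by (intro mult_nonneg_nonneg add_nonneg_nonneg) auto
  then show "0 < L'" "L \<le> L'" using L_props by (auto simp: L'_def)
qed

text \<open>Constant and map are selected together, so that one \<open>cd\<close> serves all cubes.
  The enlarged cube may belong to another system than \<open>Q\<close>.\<close>

definition "dilation = (SOME p. 0 < fst p \<and> (\<forall>Q\<in>cubes S. snd p Q \<in> cubes S \<and>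
  bl (ctr Q) (L' * rad Q) \<subseteq> snd p Q \<and> mu (snd p Q) \<le> fst p * mu Q))"

definition "cd = fst dilation"
definition "star = snd dilation"

lemma star:
  shows cd_pos: "0 < cd"
    and star_cube: "Q \<in> cubes S \<Longrightarrow> star Q \<in> cubes S"
    and star_ball: "Q \<in> cubes S \<Longrightarrow> bl (ctr Q) (L' * rad Q) \<subseteq> star Q"
    and star_measure: "Q \<in> cubes S \<Longrightarrow> mu (star Q) \<le> cd * mu Q"
proof -
  obtain c d where cdd: "0 < c" "\<And>Q. Q \<in> cubes S \<Longrightarrow> d Q \<in> cubes S"
    "\<And>Q. Q \<in> cubes S \<Longrightarrow> bl (ctr Q) (L' * rad Q) \<subseteq> d Q" "\<And>Q. Q \<in> cubes S \<Longrightarrow> mu (d Q) \<le> c * mu Q"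
    by (rule dilate_cube[OF L'_pos]) blast
  have "\<exists>p. 0 < fst p \<and> (\<forall>Q\<in>cubes S. snd p Q \<in> cubes S \<and>
      bl (ctr Q) (L' * rad Q) \<subseteq> snd p Q \<and> mu (snd p Q) \<le> fst p * mu Q)"
    by (rule exI[of _ "(c, d)"]) (use cdd in auto)
  from someI_ex[OF this] have *: "0 < cd \<and> (\<forall>Q\<in>cubes S. star Q \<in> cubes S \<and>
      bl (ctr Q) (L' * rad Q) \<subseteq> star Q \<and> mu (star Q) \<le> cd * mu Q)"
    unfolding cd_def star_def dilation_def .
  then show "0 < cd" "Q \<in> cubes S \<Longrightarrow> star Q \<in> cubes S"
    "Q \<in> cubes S \<Longrightarrow> bl (ctr Q) (L' * rad Q) \<subseteq> star Q"
    "Q \<in> cubes S \<Longrightarrow> mu (star Q) \<le> cd * mu Q" by blast+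
qed

lemma ball_subset_star: "Q \<in> cubes S \<Longrightarrow> bl (ctr Q) (L * rad Q) \<subseteq> star Q"
  using star_ball[of Q] ball_mono[of "L * rad Q" "L' * rad Q" "ctr Q"]
    mult_right_mono[OF L'_ge, of "rad Q"] rad_pos[of Q] by auto

lemma cube_subset_star: "Q \<in> cubes S \<Longrightarrow> Q \<subseteq> star Q"
  using ball_subset_star[of Q] cube_subset_ball[of Q] ball_mono[of "C0 * rad Q" "L * rad Q" "ctr Q"]
    mult_right_mono[OF L_props(4), of "rad Q"] rad_pos[of Q] by auto

lemma ball_subset_star_strict:
  assumes "P \<in> cubes S" "Q \<in> cubes S" "P \<subset> Q" shows "bl (ctr P) (L * rad P) \<subseteq> star Q"
proof -
  have cP: "ctr P \<in> X" and cQ: "ctr Q \<in> X" using ctr_space assms by auto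
  have "ctr P \<in> Q"
    using center_in_ball[OF cP rad_pos[OF assms(1)]] ball_subset_cube[OF assms(1)] assms(3) by auto
  then have d: "\<rho> (ctr Q) (ctr P) < C0 * rad Q" using cube_subset_ball[OF assms(2)] by (auto simp: mem_ball)
  have "bl (ctr P) (L * rad P) \<subseteq> bl (ctr Q) (L' * rad Q)"
  proof
    fix y assume y: "y \<in> bl (ctr P) (L * rad P)"
    then have yX: "y \<in> X" "\<rho> (ctr P) y < L * rad P" by (auto simp: mem_ball)
    have "\<rho> (ctr Q) y \<le> \<kappa> * (\<rho> (ctr Q) (ctr P) + \<rho> (ctr P) y)"
      by (rule rho_triangle[OF cQ cP yX(1)])
    also have "\<dots> \<le> \<kappa> * (C0 * rad Q + L * (2 * \<kappa> * C0 * rad Q))"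
    proof (intro mult_left_mono add_mono)
      have "L * rad P \<le> L * (2 * \<kappa> * C0 * rad Q)"
        using L_props(1) by (intro mult_left_mono rad_strict_subset[OF assms]) simp
      then show "\<rho> (ctr P) y \<le> L * (2 * \<kappa> * C0 * rad Q)" using yX by linarith
    qed (use d kappa_ge_1 in auto)
    also have "\<dots> = \<kappa> * (C0 + 2 * \<kappa> * C0 * L) * rad Q" by (simp add: algebra_simps)
    also have "\<dots> < L' * rad Q" unfolding L'_def using L_props rad_pos[OF assms(2)] by (simp add: distrib_right)
    finally show "y \<in> bl (ctr Q) (L' * rad Q)" using yX by (simp add: mem_ball)
  qed
  then show ?thesis using star_ball[OF assms(2)] by auto
qed

definition "loc f Q = (\<lambda>y. f y * indicator (star Q) y)" for f :: "'a \<Rightarrow> real"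
definition "avg f Q = (LINT y|M. \<bar>f y\<bar> * indicator (star Q) y) / mu (star Q)" for f :: "'a \<Rightarrow> real"

lemma loc_L2: "f \<in> L2_space M \<Longrightarrow> Q \<in> cubes S \<Longrightarrow> loc f Q \<in> L2_space M"
  unfolding loc_def by (rule L2_space_indicator) (auto intro: adj_sets star_cube)

lemma loc_integrable: "f \<in> L2_space M \<Longrightarrow> Q \<in> cubes S \<Longrightarrow> integrable M (loc f Q)"
  using L2_space_integrable[OF loc_L2 adj_fmeasurable[OF star_cube]] by (auto simp: loc_def)

lemma avg_nonneg: "0 \<le> avg f Q"
  unfolding avg_def by (intro divide_nonneg_nonneg) auto

lemma avg_times: "Q \<in> cubes S \<Longrightarrow> (LINT y|M. \<bar>loc f Q y\<bar>) = avg f Q * mu (star Q)"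
  using adj_measure_pos[OF star_cube, of Q] by (simp add: avg_def loc_def abs_mult)

definition "bad c f Q = {x \<in> Q. \<not> (\<bar>T (loc f Q) x\<bar> \<le> c * avg f Q \<and>
  cube_maximal M S (loc f Q) x \<le> ennreal (c * avg f Q))}"

lemma bad_sets:
  assumes "f \<in> L2_space M" "Q \<in> cubes S" shows "bad c f Q \<in> sets M"
proof -
  have [measurable]: "T (loc f Q) \<in> borel_measurable M" "Q \<in> sets M"
    using T_L2[OF loc_L2[OF assms]] adj_sets[OF assms(2)] by (auto simp: L2_space_iff)
  have "bad c f Q = Q \<inter> {x \<in> X. \<not> (\<bar>T (loc f Q) x\<bar> \<le> c * avg f Q \<and>
      cube_maximal M S (loc f Q) x \<le> ennreal (c * avg f Q))}"
    using adj_subset_space[OF assms(2)] by (auto simp: bad_def)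
  then show ?thesis by simp
qed

text \<open>Both weak type inequalities are used at the level \<open>c * avg f Q\<close>. The mass
  of \<open>loc f Q\<close> is \<open>avg f Q * mu (star Q)\<close>, so the average cancels and the
  bad set has measure at most a fixed multiple of \<open>mu Q / c\<close>.\<close>

lemma bad_small:
  assumes "0 < e"
  obtains c where "1 \<le> c" "\<And>f Q. f \<in> L2_space M \<Longrightarrow> Q \<in> cubes S \<Longrightarrow> mu (bad c f Q) \<le> e * mu Q"
proof -
  obtain Cw where Cw: "0 < Cw" "\<And>R f l. R \<in> cubes S \<Longrightarrow> f \<in> L2_space M \<Longrightarrow> (\<And>y. y \<notin> R \<Longrightarrow> f y = 0) \<Longrightarrow>
    0 < l \<Longrightarrow> (LINT y|M. \<bar>f y\<bar>) \<le> l * mu R \<Longrightarrow>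
    emeasure M {x \<in> X. l < \<bar>T f x\<bar>} \<le> ennreal (Cw / l * (LINT y|M. \<bar>f y\<bar>))"
    by (rule T_weak_type) blast
  define c where "c = max 1 ((Cw + card S) * cd / e)"
  show thesis
  proof (rule that[of c])
    show c1: "1 \<le> c" by (simp add: c_def)
    fix f Q assume f: "f \<in> L2_space M" and Q: "Q \<in> cubes S"
    have fQ: "loc f Q \<in> L2_space M" by (rule loc_L2[OF f Q])
    have m[measurable]: "loc f Q \<in> borel_measurable M" "T (loc f Q) \<in> borel_measurable M"
      using fQ T_L2[OF fQ] by (auto simp: L2_space_iff)
    have bs: "bad c f Q \<in> sets M" by (rule bad_sets[OF f Q])
    have bf: "bad c f Q \<in> fmeasurable M"
      by (rule fmeasurableI2[OF adj_fmeasurable[OF Q] _ bs]) (auto simp: bad_def)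
    show "mu (bad c f Q) \<le> e * mu Q"
    \<comment> \<open>The weak type inequalities need a positive level; for average 0 both functions
      vanish almost everywhere.\<close>
    proof (cases "avg f Q = 0")
      case True
      then have "(LINT y|M. \<bar>loc f Q y\<bar>) = 0" by (simp add: avg_times[OF Q])
      then have z: "AE y in M. loc f Q y = 0"
        using loc_integrable[OF f Q] by (subst (asm) integral_nonneg_eq_0_iff_AE) auto
      have "AE x in M. T (loc f Q) x = 0" by (rule T_AE_zero[OF fQ z])
      then have "AE x in M. x \<notin> bad c f Q"
        by eventually_elim (simp add: bad_def True maximal_zero[OF z])
      then have "bad c f Q \<in> null_sets M" using bs by (simp add: AE_iff_null_sets)
      then show ?thesis using assms by (simp add: null_setsD1 measure_def)
    next
      case False
      then have ap: "0 < avg f Q" using avg_nonneg[of f Q] by simp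
      define l where "l = c * avg f Q"
      have l: "0 < l" using ap c1 by (simp add: l_def)
      have I: "(LINT y|M. \<bar>loc f Q y\<bar>) = avg f Q * mu (star Q)" by (rule avg_times[OF Q])
      have e1: "emeasure M {x \<in> X. l < \<bar>T (loc f Q) x\<bar>} \<le> ennreal (Cw / l * (LINT y|M. \<bar>loc f Q y\<bar>))"
      proof (rule Cw(2)[OF star_cube[OF Q] fQ _ l])
        \<comment> \<open>This condition of \<open>T_weak_type\<close> is the reason for
          \<open>1 \<le> c\<close>.\<close>
        show "(LINT y|M. \<bar>loc f Q y\<bar>) \<le> l * mu (star Q)"
          unfolding I l_def using c1 ap by (intro mult_right_mono) auto
      qed (auto simp: loc_def)
      have e2: "emeasure M {x \<in> X. ennreal l < cube_maximal M S (loc f Q) x} \<le>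
          ennreal (card S / l * (LINT y|M. \<bar>loc f Q y\<bar>))"
      proof -
        have "ennreal l * emeasure M {x \<in> X. ennreal l < cube_maximal M S (loc f Q) x} \<le>
            ennreal (card S) * (\<integral>\<^sup>+y. ennreal \<bar>loc f Q y\<bar> \<partial>M)"
          by (rule maximal_weak_type[OF m(1) l])
        also have "(\<integral>\<^sup>+y. ennreal \<bar>loc f Q y\<bar> \<partial>M) = ennreal (LINT y|M. \<bar>loc f Q y\<bar>)"
          by (rule nn_integral_eq_integral) (use loc_integrable[OF f Q] in auto)
        finally have "ennreal (1 / l) * (ennreal l * emeasure M {x \<in> X. ennreal l < cube_maximal M S (loc f Q) x})
            \<le> ennreal (1 / l) * (ennreal (card S) * ennreal (LINT y|M. \<bar>loc f Q y\<bar>))"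
          by (rule mult_left_mono) simp
        moreover have "ennreal (1 / l) * (ennreal l * emeasure M {x \<in> X. ennreal l < cube_maximal M S (loc f Q) x})
            = emeasure M {x \<in> X. ennreal l < cube_maximal M S (loc f Q) x}"
          using l by (simp add: mult.assoc[symmetric] flip: ennreal_mult)
        moreover have "ennreal (1 / l) * (ennreal (card S) * ennreal (LINT y|M. \<bar>loc f Q y\<bar>)) =
            ennreal (card S / l * (LINT y|M. \<bar>loc f Q y\<bar>))"
          using l by (simp add: mult.commute flip: ennreal_mult)
        ultimately show ?thesis by simp
      qed
      have "emeasure M (bad c f Q) \<le> emeasure M ({x \<in> X. l < \<bar>T (loc f Q) x\<bar>} \<union>
          {x \<in> X. ennreal l < cube_maximal M S (loc f Q) x})"
        by (rule emeasure_mono) (use adj_subset_space[OF Q] in \<open>auto simp: bad_def l_def not_le\<close>)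
      also have "\<dots> \<le> emeasure M {x \<in> X. l < \<bar>T (loc f Q) x\<bar>} +
          emeasure M {x \<in> X. ennreal l < cube_maximal M S (loc f Q) x}"
        by (rule emeasure_subadditive) auto
      also have "\<dots> \<le> ennreal (Cw / l * (LINT y|M. \<bar>loc f Q y\<bar>)) + ennreal (card S / l * (LINT y|M. \<bar>loc f Q y\<bar>))"
        by (intro add_mono e1 e2)
      also have "\<dots> = ennreal ((Cw + card S) / l * (LINT y|M. \<bar>loc f Q y\<bar>))"
        using l Cw(1) by (simp add: ennreal_plus[symmetric] add_divide_distrib distrib_right del: ennreal_plus)
      finally have "ennreal (mu (bad c f Q)) \<le> ennreal ((Cw + card S) / l * (LINT y|M. \<bar>loc f Q y\<bar>))"
        by (simp add: emeasure_eq_measure2[OF bf])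
      then have "mu (bad c f Q) \<le> (Cw + card S) / l * (LINT y|M. \<bar>loc f Q y\<bar>)"
        using l Cw(1) by (subst (asm) ennreal_le_iff) auto
      also have "\<dots> = (Cw + card S) / c * mu (star Q)" using ap by (simp add: I l_def)
      also have "\<dots> \<le> (Cw + card S) / c * (cd * mu Q)"
        using star_measure[OF Q] Cw(1) c1 by (intro mult_left_mono) auto
      also have "\<dots> = ((Cw + card S) * cd) / c * mu Q" by simp
      also have "\<dots> \<le> e * mu Q"
      proof (rule mult_right_mono)
        have "(Cw + card S) * cd / e \<le> c" by (simp add: c_def)
        then show "(Cw + card S) * cd / c \<le> e" using assms c1 by (simp add: field_simps)
      qed simp
      finally show ?thesis .
    qed
  qed
qed

definition "local_control c f Q \<P> \<longleftrightarrow>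
  (AE x in M. x \<in> Q - \<Union>\<P> \<longrightarrow> \<bar>T (loc f Q) x\<bar> \<le> c * avg f Q) \<and>
  (\<forall>P\<in>\<P>. AE x in M. x \<in> P \<longrightarrow> \<bar>T (loc f Q) x\<bar> \<le> \<bar>T (loc f P) x\<bar> + c * (avg f Q + avg f P))"

text \<open>On a stopping cube \<open>P\<close> the difference \<open>h\<close> of the two
  localizations vanishes near \<open>P\<close>, so \<open>T h\<close> is nearly constant there. Its
  size is read off at a point good for both \<open>Q\<close> and \<open>P\<close>; the stopping rule
  ensures that such points fill a set of positive measure.\<close>

lemma local_step:
  obtains c where "0 \<le> c" "\<And>\<D> f Q. \<D> \<in> S \<Longrightarrow> f \<in> L2_space M \<Longrightarrow> Q \<in> dyadic_space.\<Q> \<D> \<Longrightarrow>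
    \<exists>\<P>. dyadic_space.stop_family M \<D> Q \<P> \<and> local_control c f Q \<P>"
proof (cases "S = {}")
  case True
  then show thesis using that[of 0] by simp
next
  case False
  \<comment> \<open>The bounds on \<open>\<epsilon>\<close> come from an actual system, so one has
    to be picked.\<close>
  then obtain \<D>0 where "\<D>0 \<in> S" by auto
  then interpret d0: dyadic_space M \<rho> \<kappa> D \<D>0 \<delta> C0 \<epsilon> by (rule dyadic_S)
  have eps: "0 < \<epsilon>" "\<epsilon> < 1" by (rule d0.eps_pos, rule d0.eps_lt_1)
  \<comment> \<open>With \<open>B\<close> of measure at most \<open>\<epsilon> / 8 * mu Q\<close>,
    cubes filled by \<open>B\<close> beyond the fraction \<open>\<epsilon> / 4\<close> make up at
    most half of \<open>Q\<close>. The factor \<open>\<epsilon>\<close> is lost again in passing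
    from a stopping cube to a larger cube that was not selected.\<close>
  obtain c where c: "1 \<le> c" "\<And>f Q. f \<in> L2_space M \<Longrightarrow> Q \<in> cubes S \<Longrightarrow> mu (bad c f Q) \<le> \<epsilon> / 8 * mu Q"
    using bad_small[of "\<epsilon> / 8"] eps by auto
  obtain Co where Co: "0 < Co" "\<And>P h H x'. P \<in> cubes S \<Longrightarrow> h \<in> L2_space M \<Longrightarrow> integrable M h \<Longrightarrow>
    (\<And>y. y \<in> bl (ctr P) (L * rad P) \<Longrightarrow> h y = 0) \<Longrightarrow> x' \<in> P \<Longrightarrow> 0 \<le> H \<Longrightarrow>
    cube_maximal M S h x' \<le> ennreal H \<Longrightarrow>
    AE x in M. x \<in> P \<longrightarrow> \<bar>T h x - (LINT y|M. K (ctr P) y * h y)\<bar> \<le> Co * H"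
    by (rule T_oscillation) blast
  \<comment> \<open>Two oscillation errors \<open>Co * H\<close>, plus \<open>H\<close> for the size
    of \<open>T h\<close> at one good point.\<close>
  define c' where "c' = (2 * Co + 1) * c"
  have "1 * c \<le> (2 * Co + 1) * c" using c(1) Co(1) by (intro mult_right_mono) auto
  then have cc': "c \<le> c'" by (simp add: c'_def)
  show thesis
  proof (rule that[of c'])
    show "0 \<le> c'" using cc' c(1) by linarith
    fix \<D> f Q assume \<D>: "\<D> \<in> S" and f: "f \<in> L2_space M" and Q: "Q \<in> dyadic_space.\<Q> \<D>"
    interpret dyadic_space M \<rho> \<kappa> D \<D> \<delta> C0 \<epsilon> by (rule dyadic_S[OF \<D>])
    have Qadj: "R \<in> \<Q> \<Longrightarrow> R \<in> cubes S" for R using \<D> cubes_eq by auto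
    note Qc = Qadj[OF Q]
    define B where "B = bad c f Q"
    have Bs: "B \<in> sets M" unfolding B_def by (rule bad_sets[OF f Qc])
    have BQ: "B \<subseteq> Q" by (auto simp: B_def bad_def)
    define \<Phi> where "\<Phi> P \<longleftrightarrow> \<epsilon> / 4 * mu P < mu (B \<inter> P)" for P
    have nQ: "\<not> \<Phi> Q"
    proof -
      have "mu (B \<inter> Q) \<le> \<epsilon> / 8 * mu Q" using c(2)[OF f Qc] BQ by (simp add: B_def Int_absorb2)
      also have "\<dots> \<le> \<epsilon> / 4 * mu Q" using eps by (intro mult_right_mono) auto
      finally show ?thesis by (simp add: \<Phi>_def)
    qed
    obtain \<P> where \<P>: "\<P> \<subseteq> \<Q>" "disjoint \<P>" "\<And>P. P \<in> \<P> \<Longrightarrow> P \<subset> Q" "\<And>P. P \<in> \<P> \<Longrightarrow> \<Phi> P"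
      "\<And>P. P \<in> \<P> \<Longrightarrow> \<exists>R\<in>\<Q>. P \<subseteq> R \<and> R \<subseteq> Q \<and> \<not> \<Phi> R \<and> \<epsilon> * mu R \<le> mu P"
      "\<And>P. P \<in> \<Q> \<Longrightarrow> P \<subseteq> Q \<Longrightarrow> \<Phi> P \<Longrightarrow> \<exists>R\<in>\<P>. P \<subseteq> R"
      by (rule stopping_cubes[where Q = Q and \<Phi> = \<Phi>, OF Q nQ]) blast
    have fB: "B \<inter> P \<in> fmeasurable M" if "P \<in> \<Q>" for P
      by (rule fmeasurableI2[OF cube_fmeasurable[OF that]]) (use Bs cube_sets[OF that] in auto)
    have U\<P>s: "\<Union>\<P> \<in> sets M" by (rule Union_cubes_sets[OF \<P>(1)])
    have U\<P>f: "\<Union>\<P> \<in> fmeasurable M"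
      by (rule fmeasurableI2[OF cube_fmeasurable[OF Q] _ U\<P>s]) (use \<P>(3) in auto)
    have half: "mu (\<Union>\<P>) \<le> mu Q / 2"
    proof -
      have "ennreal (\<epsilon> / 4) * emeasure M (X \<inter> \<Union>\<P>) =
          (\<integral>\<^sup>+P. ennreal (\<epsilon> / 4) * emeasure M (X \<inter> P) \<partial>count_space \<P>)"
        by (subst emeasure_Union_cubes[OF \<P>(1,2)]) (auto simp: nn_integral_cmult)
      also have "\<dots> \<le> (\<integral>\<^sup>+P. emeasure M (B \<inter> P) \<partial>count_space \<P>)"
      proof (rule nn_integral_mono)
        fix P assume "P \<in> space (count_space \<P>)"
        then have P: "P \<in> \<Q>" "\<Phi> P" using \<P>(1,4) by auto
        then have "ennreal (\<epsilon> / 4 * mu P) \<le> ennreal (mu (B \<inter> P))" by (intro ennreal_leI) (auto simp: \<Phi>_def)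
        then have "ennreal (\<epsilon> / 4) * ennreal (mu P) \<le> ennreal (mu (B \<inter> P))"
          by (subst ennreal_mult'[symmetric]) (use eps in auto)
        then show "ennreal (\<epsilon> / 4) * emeasure M (X \<inter> P) \<le> emeasure M (B \<inter> P)"
          using P(1) cube_subset_space[OF P(1)]
          by (simp add: emeasure_eq_measure2 fB cube_fmeasurable Int_absorb1)
      qed
      also have "\<dots> = emeasure M (B \<inter> \<Union>\<P>)" by (rule emeasure_Union_cubes[OF \<P>(1,2) Bs, symmetric])
      also have "\<dots> \<le> emeasure M (B \<inter> Q)" by (rule emeasure_mono) (use \<P>(3) Bs cube_sets[OF Q] in auto)
      also have "\<dots> = ennreal (mu (B \<inter> Q))" by (rule emeasure_eq_measure2[OF fB[OF Q]])
      also have "\<dots> \<le> ennreal (\<epsilon> / 8 * mu Q)"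
        using c(2)[OF f Qc] BQ by (intro ennreal_leI) (simp add: B_def Int_absorb2)
      also have "X \<inter> \<Union>\<P> = \<Union>\<P>" using U\<P>s by (auto dest: sets.sets_into_space)
      finally have "ennreal (\<epsilon> / 4) * ennreal (mu (\<Union>\<P>)) \<le> ennreal (\<epsilon> / 8 * mu Q)"
        unfolding emeasure_eq_measure2[OF U\<P>f] .
      moreover have "ennreal (\<epsilon> / 4 * mu (\<Union>\<P>)) = ennreal (\<epsilon> / 4) * ennreal (mu (\<Union>\<P>))"
        using eps by (intro ennreal_mult') simp
      ultimately have "ennreal (\<epsilon> / 4 * mu (\<Union>\<P>)) \<le> ennreal (\<epsilon> / 8 * mu Q)" by simp
      then have "\<epsilon> / 4 * mu (\<Union>\<P>) \<le> \<epsilon> / 8 * mu Q" using eps by (subst (asm) ennreal_le_iff) auto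
      then have "\<epsilon> * (2 * mu (\<Union>\<P>)) \<le> \<epsilon> * mu Q" by simp
      then show ?thesis using eps by (subst (asm) mult_le_cancel_left_pos) auto
    qed
    have top: "AE x in M. x \<in> Q - \<Union>\<P> \<longrightarrow> \<bar>T (loc f Q) x\<bar> \<le> c' * avg f Q"
    proof -
      \<comment> \<open>A subcube not selected contains \<open>B\<close> only up to the fraction
        \<open>\<epsilon> / 4\<close>, and a selected one lies in the removed union; so the density
        lemma applies.\<close>
      have "B - \<Union>\<P> \<in> null_sets M"
      proof (rule density[OF Q _ _ _ _, where \<theta> = "\<epsilon> / 4"])
        fix P assume P: "P \<in> \<Q>" "P \<subseteq> Q"
        show "mu ((B - \<Union>\<P>) \<inter> P) \<le> \<epsilon> / 4 * mu P"
        proof (cases "\<Phi> P")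
          case True
          then obtain R where "R \<in> \<P>" "P \<subseteq> R" using \<P>(6)[OF P] by blast
          then have "(B - \<Union>\<P>) \<inter> P = {}" by blast
          then show ?thesis using eps by simp
        next
          case False
          have "mu ((B - \<Union>\<P>) \<inter> P) \<le> mu (B \<inter> P)"
            by (rule measure_mono_fmeasurable) (use fB[OF P(1)] Bs U\<P>s cube_sets[OF P(1)] in auto)
          then show ?thesis using False by (simp add: \<Phi>_def)
        qed
      next
        show "B - \<Union>\<P> \<in> sets M" by (rule sets.Diff[OF Bs U\<P>s])
        show "B - \<Union>\<P> \<subseteq> Q" using BQ by auto
      qed (use eps in auto)
      then have "AE x in M. x \<notin> B - \<Union>\<P>" by (rule AE_not_in)
      then show ?thesis
      proof (eventually_elim, intro impI)
        fix x assume "x \<notin> B - \<Union>\<P>" "x \<in> Q - \<Union>\<P>"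
        then have "\<bar>T (loc f Q) x\<bar> \<le> c * avg f Q" by (auto simp: B_def bad_def)
        also have "\<dots> \<le> c' * avg f Q" using cc' avg_nonneg by (rule mult_right_mono)
        finally show "\<bar>T (loc f Q) x\<bar> \<le> c' * avg f Q" .
      qed
    qed
    have step: "AE x in M. x \<in> P \<longrightarrow> \<bar>T (loc f Q) x\<bar> \<le> \<bar>T (loc f P) x\<bar> + c' * (avg f Q + avg f P)"
      if P: "P \<in> \<P>" for P
    proof -
      have PQ: "P \<in> \<Q>" "P \<subset> Q" using \<P>(1,3) P by auto
      note Pc = Qadj[OF PQ(1)]
      \<comment> \<open>Points of \<open>P\<close> good for both cubes: \<open>B\<close> takes at
        most a quarter of \<open>P\<close> and the bad set of \<open>P\<close> at most an
        eighth.\<close>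
      define W where "W = P - (B \<inter> P) - bad c f P"
      have bPs: "bad c f P \<in> sets M" by (rule bad_sets[OF f Pc])
      have Ws: "W \<in> sets M" unfolding W_def using Bs bPs cube_sets[OF PQ(1)] by auto
      have "mu (B \<inter> P) \<le> mu P / 4"
      proof -
        obtain R where R: "R \<in> \<Q>" "P \<subseteq> R" "\<not> \<Phi> R" "\<epsilon> * mu R \<le> mu P" using \<P>(5)[OF P] by auto
        have "mu (B \<inter> P) \<le> mu (B \<inter> R)"
          by (rule measure_mono_fmeasurable) (use fB R Bs cube_sets[OF PQ(1)] in auto)
        also have "\<dots> \<le> \<epsilon> / 4 * mu R" using R by (simp add: \<Phi>_def)
        finally show ?thesis using R(4) by simp
      qed
      moreover have "mu (bad c f P) \<le> mu P / 8"
      proof -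
        have "mu (bad c f P) \<le> \<epsilon> / 8 * mu P" by (rule c(2)[OF f Pc])
        also have "\<dots> \<le> 1 / 8 * mu P" using eps by (intro mult_right_mono) auto
        finally show ?thesis by simp
      qed
      moreover have "mu P \<le> mu W + mu (B \<inter> P) + mu (bad c f P)"
      proof -
        have bPf: "bad c f P \<in> fmeasurable M"
          by (rule fmeasurableI2[OF cube_fmeasurable[OF PQ(1)] _ bPs]) (auto simp: bad_def)
        have Wf: "W \<in> fmeasurable M"
          by (rule fmeasurableI2[OF cube_fmeasurable[OF PQ(1)] _ Ws]) (auto simp: W_def)
        have "mu P \<le> mu ((W \<union> (B \<inter> P)) \<union> bad c f P)"
          by (rule measure_mono_fmeasurable)
             (use cube_sets[OF PQ(1)] bPf Wf fB[OF PQ(1)] in \<open>auto simp: W_def\<close>)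
        also have "\<dots> \<le> mu (W \<union> (B \<inter> P)) + mu (bad c f P)"
          by (rule measure_Un_le) (use Ws bPs fB[OF PQ(1)] in auto)
        also have "mu (W \<union> (B \<inter> P)) \<le> mu W + mu (B \<inter> P)"
          by (rule measure_Un_le) (use Ws fB[OF PQ(1)] in auto)
        finally show ?thesis by simp
      qed
      ultimately have Wp: "0 < mu W" using cube_measure_pos[OF PQ(1)] by linarith
      define h where "h y = 1 * loc f Q y + (-1) * loc f P y" for y
      have hL: "h \<in> L2_space M"
        unfolding h_def[abs_def] by (rule L2_space_add[OF loc_L2[OF f Qc] loc_L2[OF f Pc]])
      have hi: "integrable M h"
        unfolding h_def using loc_integrable[OF f Qc] loc_integrable[OF f Pc] by simp
      have h0: "h y = 0" if "y \<in> bl (ctr P) (L * rad P)" for y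
      proof -
        have "y \<in> star P" "y \<in> star Q"
          using that ball_subset_star[OF Pc] ball_subset_star_strict[OF Pc Qc PQ(2)] by auto
        then show ?thesis by (simp add: h_def loc_def)
      qed
      define H where "H = c * avg f Q + c * avg f P"
      have H0: "0 \<le> H" unfolding H_def using c(1) avg_nonneg by (intro add_nonneg_nonneg mult_nonneg_nonneg) auto
      have good: "\<bar>T (loc f Q) x\<bar> \<le> c * avg f Q" "cube_maximal M S (loc f Q) x \<le> ennreal (c * avg f Q)"
          "\<bar>T (loc f P) x\<bar> \<le> c * avg f P" "cube_maximal M S (loc f P) x \<le> ennreal (c * avg f P)"
        if "x \<in> W" for x
        using that PQ(2) by (auto simp: W_def B_def bad_def)
      have Th: "AE x in M. T h x = T (loc f Q) x - T (loc f P) x"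
        using T_linear[OF loc_L2[OF f Qc] loc_L2[OF f Pc], of 1 "-1"] by (simp add: h_def[abs_def])
      \<comment> \<open>Any point of \<open>W\<close> serves for the maximal function. The point
        \<open>x2\<close> below must also avoid the null sets on which linearity or the oscillation
        bound fails, which is where positive measure is needed.\<close>
      obtain x1 where x1: "x1 \<in> W" using Wp by (metis equals0I measure_empty less_irrefl)
      have "cube_maximal M S h x1 \<le> cube_maximal M S (loc f Q) x1 + cube_maximal M S (loc f P) x1"
        by (rule maximal_add)
           (use loc_L2[OF f Qc] loc_L2[OF f Pc] in \<open>auto simp: L2_space_iff h_def\<close>)
      also have "\<dots> \<le> ennreal (c * avg f Q) + ennreal (c * avg f P)" by (intro add_mono good x1)
      also have "\<dots> = ennreal H" unfolding H_def using c(1) avg_nonneg by (intro ennreal_plus[symmetric]) auto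
      finally have "cube_maximal M S h x1 \<le> ennreal H" .
      then have osc: "AE x in M. x \<in> P \<longrightarrow> \<bar>T h x - (LINT y|M. K (ctr P) y * h y)\<bar> \<le> Co * H"
        using x1 by (intro Co(2)[OF Pc hL hi h0 _ H0, of x1]) (auto simp: W_def)
      obtain x2 where x2: "x2 \<in> W" "T h x2 = T (loc f Q) x2 - T (loc f P) x2"
          "\<bar>T h x2 - (LINT y|M. K (ctr P) y * h y)\<bar> \<le> Co * H"
      proof (rule ccontr)
        assume nt: "\<not> thesis"
        have "AE x in M. x \<notin> W"
          using Th osc
        proof eventually_elim
          fix x assume a: "T h x = T (loc f Q) x - T (loc f P) x"
            and b: "x \<in> P \<longrightarrow> \<bar>T h x - (LINT y|M. K (ctr P) y * h y)\<bar> \<le> Co * H"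
          show "x \<notin> W"
          proof
            assume "x \<in> W"
            then have "x \<in> P" by (auto simp: W_def)
            then show False using nt that[OF \<open>x \<in> W\<close> a] b by blast
          qed
        qed
        then have "W \<in> null_sets M" using Ws by (simp add: AE_iff_null_sets)
        then show False using Wp by (simp add: null_setsD1 measure_def)
      qed
      \<comment> \<open>At \<open>x2\<close> both localizations are controlled, so
        \<open>\<bar>T h x2\<bar> \<le> H\<close>; this bounds the reference value, and through it
        \<open>T h\<close> almost everywhere on \<open>P\<close>.\<close>
      have k: "\<bar>LINT y|M. K (ctr P) y * h y\<bar> \<le> (Co + 1) * H"
        using x2(2,3) good(1,3)[OF x2(1)] by (simp add: H_def algebra_simps)
      show ?thesis using Th osc
      proof (eventually_elim, intro impI)
        fix x assume a: "T h x = T (loc f Q) x - T (loc f P) x"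
          and b: "x \<in> P \<longrightarrow> \<bar>T h x - (LINT y|M. K (ctr P) y * h y)\<bar> \<le> Co * H" and xP: "x \<in> P"
        have "\<bar>T (loc f Q) x\<bar> \<le> \<bar>T (loc f P) x\<bar> + Co * H + (Co + 1) * H"
          using a b xP k by linarith
        also have "\<dots> = \<bar>T (loc f P) x\<bar> + c' * (avg f Q + avg f P)"
          by (simp add: H_def c'_def algebra_simps)
        finally show "\<bar>T (loc f Q) x\<bar> \<le> \<bar>T (loc f P) x\<bar> + c' * (avg f Q + avg f P)" .
      qed
    qed
    show "\<exists>\<P>. stop_family Q \<P> \<and> local_control c' f Q \<P>"
      unfolding stop_family_def local_control_def
      using \<P>(1,2,3) half top step by (intro exI[of _ \<P>]) auto
  qed
qed

definition "sparse_at c f \<S> u x \<longleftrightarrow>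
  (\<exists>H. finite H \<and> H \<subseteq> \<S> \<and> (\<forall>P\<in>H. x \<in> P) \<and> \<bar>u x\<bar> \<le> c * (\<Sum>P\<in>H. avg f P))" for u :: "'a \<Rightarrow> real"

definition "dominates c \<longleftrightarrow> 0 \<le> c \<and> (\<forall>\<D>\<in>S. \<forall>f\<in>L2_space M. \<forall>Q\<in>dyadic_space.\<Q> \<D>.
  \<exists>\<S> E. \<S> \<subseteq> dyadic_space.\<Q> \<D> \<and> sparse_family E \<S> \<and>
    (AE x in M. x \<in> Q \<longrightarrow> sparse_at c f \<S> (T (loc f Q)) x))"

text \<open>Outside one null set the bound holds for all numbers of rounds at once, and the point
  has left the stopping cubes after some round. The remainders of the iterated cubes witness
  sparseness.\<close>

lemma ex_dominates: "\<exists>c. dominates c"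
proof -
  obtain c where c: "0 \<le> c" "\<And>\<D> f Q. \<D> \<in> S \<Longrightarrow> f \<in> L2_space M \<Longrightarrow> Q \<in> dyadic_space.\<Q> \<D> \<Longrightarrow>
    \<exists>\<P>. dyadic_space.stop_family M \<D> Q \<P> \<and> local_control c f Q \<P>"
    by (rule local_step) blast
  have "dominates (2 * c)"
    unfolding dominates_def
  proof (intro conjI ballI)
    fix \<D> f Q assume \<D>: "\<D> \<in> S" and f: "f \<in> L2_space M" and Q: "Q \<in> dyadic_space.\<Q> \<D>"
    interpret dyadic_space M \<rho> \<kappa> D \<D> \<delta> C0 \<epsilon> by (rule dyadic_S[OF \<D>])
    have "\<forall>R\<in>\<Q>. \<exists>\<P>. stop_family R \<P> \<and> local_control c f R \<P>" using c(2)[OF \<D> f] by simp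
    then obtain st where st: "\<forall>R\<in>\<Q>. stop_family R (st R) \<and> local_control c f R (st R)"
      by (rule bchoice[THEN exE])
    have stop: "stopping st" using st by (simp add: stopping_def)
    define \<S> where "\<S> = (\<Union>i. iterate_family st i Q)"
    let ?G = "\<lambda>R x. \<bar>T (loc f R) x\<bar>"
    have "AE x in M. x \<in> Q \<longrightarrow> x \<notin> \<Union>(iterate_family st n Q) \<longrightarrow>
        iterate_bound st ?G (avg f) c Q x" for n
      by (rule iterate_domination[OF stop]) (use st Q in \<open>auto simp: local_control_def\<close>)
    then have "AE x in M. \<forall>n. x \<in> Q \<longrightarrow> x \<notin> \<Union>(iterate_family st n Q) \<longrightarrow>
        iterate_bound st ?G (avg f) c Q x"
      by (subst AE_all_countable) blast
    then have "AE x in M. x \<in> Q \<longrightarrow> sparse_at (2 * c) f \<S> (T (loc f Q)) x"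
      using AE_not_in[OF iterate_Inter_null[OF stop Q]]
    proof (eventually_elim, intro impI)
      fix x assume a: "\<forall>n. x \<in> Q \<longrightarrow> x \<notin> \<Union>(iterate_family st n Q) \<longrightarrow>
          iterate_bound st ?G (avg f) c Q x"
        and b: "x \<notin> (\<Inter>n. \<Union>(iterate_family st n Q))" and x: "x \<in> Q"
      obtain n where xn: "x \<notin> \<Union>(iterate_family st n Q)" using b by blast
      obtain H where H: "finite H" "H \<subseteq> \<S>" "Q \<in> H" "\<forall>P\<in>H. x \<in> P"
          "\<bar>T (loc f Q) x\<bar> \<le> c * avg f Q + 2 * c * (\<Sum>P\<in>H - {Q}. avg f P)"
        using a[rule_format, OF x xn, unfolded iterate_bound_def[OF stop], folded \<S>_def]
        by (elim exE conjE) (rule that)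
      have "(\<Sum>P\<in>H. avg f P) = avg f Q + (\<Sum>P\<in>H - {Q}. avg f P)" by (rule sum.remove[OF H(1,3)])
      moreover have "c * avg f Q \<le> 2 * c * avg f Q" using c(1) avg_nonneg by (intro mult_right_mono) auto
      ultimately have "\<bar>T (loc f Q) x\<bar> \<le> 2 * c * (\<Sum>P\<in>H. avg f P)" using H(5) by (simp add: distrib_left)
      then show "sparse_at (2 * c) f \<S> (T (loc f Q)) x"
        unfolding sparse_at_def by (intro exI[of _ H] conjI H(1,2,4))
    qed
    moreover have "\<S> \<subseteq> \<Q>" unfolding \<S>_def using iterate_sub[OF stop Q] by auto
    moreover have "sparse_family (remainder st) \<S>"
      unfolding sparse_family_def
    proof
      show "disjoint_family_on (remainder st) \<S>"
        unfolding disjoint_family_on_def \<S>_def using iterate_disjoint[OF stop Q] by blast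
    qed (use remainder_props[OF stop] \<open>\<S> \<subseteq> \<Q>\<close> in auto)
    ultimately show "\<exists>\<S> E. \<S> \<subseteq> \<Q> \<and> sparse_family E \<S> \<and>
        (AE x in M. x \<in> Q \<longrightarrow> sparse_at (2 * c) f \<S> (T (loc f Q)) x)"
      by (intro exI[of _ \<S>] exI[of _ "remainder st"] conjI)
  qed (use c in simp)
  then show ?thesis by blast
qed

end

subsection \<open>A two-weight bilinear estimate\<close>

text \<open>The principal set \<open>pr R\<close> is the largest ancestor of \<open>R\<close> on which the running maximum of \<open>a\<close> over
  ancestors lies in the same dyadic interval as on \<open>R\<close>.\<close>

locale principal_sets =
  fixes \<R> :: "'a set set" and a :: "'a set \<Rightarrow> real"
  assumes finite_R: "finite \<R>" and nonempty: "R \<in> \<R> \<Longrightarrow> R \<noteq> {}"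
    and nested: "R \<in> \<R> \<Longrightarrow> R' \<in> \<R> \<Longrightarrow> R \<inter> R' \<noteq> {} \<Longrightarrow> R \<subseteq> R' \<or> R' \<subseteq> R"
    and a_pos: "R \<in> \<R> \<Longrightarrow> 0 < a R"
begin

definition "running_max R = Max (a ` {R' \<in> \<R>. R \<subseteq> R'})"
definition "level R = \<lfloor>log 2 (running_max R)\<rfloor>"
definition "pr R = \<Union>{R' \<in> \<R>. R \<subseteq> R' \<and> level R' = level R}"

lemma running_max_ge: "R' \<in> \<R> \<Longrightarrow> R \<subseteq> R' \<Longrightarrow> a R' \<le> running_max R"
  unfolding running_max_def using finite_R by (intro Max_ge) auto

lemma running_max_attained: "R \<in> \<R> \<Longrightarrow> \<exists>R'\<in>\<R>. R \<subseteq> R' \<and> running_max R = a R'"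
proof -
  assume "R \<in> \<R>"
  then have "running_max R \<in> a ` {R' \<in> \<R>. R \<subseteq> R'}"
    unfolding running_max_def using finite_R by (intro Max_in) auto
  then show ?thesis by auto
qed

lemma running_max_pos: "R \<in> \<R> \<Longrightarrow> 0 < running_max R"
  using running_max_attained a_pos by fastforce

lemma running_max_mono: "R' \<in> \<R> \<Longrightarrow> R \<subseteq> R' \<Longrightarrow> running_max R' \<le> running_max R"
  using running_max_attained[of R'] running_max_ge[of _ R] by (metis subset_trans)

lemma level_mono: "R' \<in> \<R> \<Longrightarrow> R \<subseteq> R' \<Longrightarrow> level R' \<le> level R"
  unfolding level_def using running_max_mono[of R' R] running_max_pos[of R']
  by (intro floor_mono log_mono) auto

lemma level_bounds:
  assumes "R \<in> \<R>"
  shows "2 powr level R \<le> running_max R" "running_max R < 2 * 2 powr level R"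
proof -
  have p: "0 < running_max R" by (rule running_max_pos[OF assms])
  have "2 powr level R \<le> 2 powr (log 2 (running_max R))"
    unfolding level_def by (intro powr_mono) auto
  then show "2 powr level R \<le> running_max R" using p by simp
  have "2 powr (log 2 (running_max R)) < 2 powr (level R + 1)"
    unfolding level_def by (intro powr_less_mono) linarith+
  then show "running_max R < 2 * 2 powr level R" using p by (simp add: powr_add)
qed

lemma pr_props:
  assumes R: "R \<in> \<R>"
  shows "pr R \<in> \<R>" "R \<subseteq> pr R" "level (pr R) = level R"
proof -
  let ?C = "{R' \<in> \<R>. R \<subseteq> R' \<and> level R' = level R}"
  have RC: "R \<in> ?C" using R by auto
  have fin: "finite ?C" using finite_R by auto
  obtain m where m: "m \<in> ?C" "\<forall>R'\<in>?C. m \<subseteq> R' \<longrightarrow> m = R'"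
    using finite_has_maximal[OF fin] RC by auto
  have "R' \<subseteq> m" if "R' \<in> ?C" for R'
  proof -
    have "R' \<inter> m \<noteq> {}" using that m(1) nonempty[OF R] by auto
    then show ?thesis using nested[of R' m] that m by blast
  qed
  then have "pr R = m" unfolding pr_def using m(1) by blast
  then show "pr R \<in> \<R>" "R \<subseteq> pr R" "level (pr R) = level R" using m(1) by auto
qed

lemma pr_greatest: "R' \<in> \<R> \<Longrightarrow> R \<subseteq> R' \<Longrightarrow> level R' = level R \<Longrightarrow> R' \<subseteq> pr R"
  unfolding pr_def by auto

text \<open>An ancestor of \<open>pr R\<close> attaining the maximum has the same running maximum,
  hence the same level, and so is contained in \<open>pr R\<close>.\<close>

lemma pr_attains: "R \<in> \<R> \<Longrightarrow> running_max (pr R) = a (pr R)"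
proof -
  assume R: "R \<in> \<R>"
  note p = pr_props[OF R]
  obtain R' where R': "R' \<in> \<R>" "pr R \<subseteq> R'" "running_max (pr R) = a R'"
    using running_max_attained[OF p(1)] by auto
  have "running_max R' = running_max (pr R)"
    using running_max_ge[OF R'(1) subset_refl] running_max_mono[OF R'(1,2)] R'(3) by simp
  then have "level R' = level R" using p(3) by (simp add: level_def)
  then have "R' \<subseteq> pr R" using pr_greatest R' p by blast
  then show ?thesis using R' by auto
qed

text \<open>On one level the running maximum varies by less than a factor 2, and at
  \<open>pr R\<close> it equals \<open>a (pr R)\<close>.\<close>

lemma le_pr: "R \<in> \<R> \<Longrightarrow> a R \<le> 2 * a (pr R)"
proof -
  assume R: "R \<in> \<R>"
  note p = pr_props[OF R]
  have "a R \<le> running_max R" by (rule running_max_ge[OF R subset_refl])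
  also have "\<dots> < 2 * 2 powr level (pr R)" using level_bounds[OF R] p(3) by simp
  also have "\<dots> \<le> 2 * a (pr R)" using level_bounds(1)[OF p(1)] pr_attains[OF R] by simp
  finally show ?thesis by simp
qed

text \<open>If \<open>R'\<close> lies inside \<open>pr R\<close>, levels are squeezed and
  \<open>R'\<close> has the level of \<open>R\<close>; otherwise \<open>pr R\<close> lies inside
  \<open>R'\<close>.\<close>

lemma pr_mono:
  assumes R: "R \<in> \<R>" "R' \<in> \<R>" "R \<subseteq> R'" shows "pr R \<subseteq> pr R'"
proof -
  have "pr R \<inter> R' \<noteq> {}" using pr_props[OF R(1)] nonempty[OF R(1)] R(3) by auto
  then consider "R' \<subseteq> pr R" | "pr R \<subseteq> R'" using nested[OF pr_props(1)[OF R(1)] R(2)] by auto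
  then show ?thesis
  proof cases
    case 1
    then have "level R = level R'"
      using level_mono[OF pr_props(1)[OF R(1)] 1] level_mono[OF R(2,3)] pr_props(3)[OF R(1)] by simp
    then show ?thesis using pr_greatest[OF pr_props(1)[OF R(1)] 1] pr_props(3)[OF R(1)] by simp
  next
    case 2
    then show ?thesis using pr_props(2)[OF R(2)] by auto
  qed
qed

lemma pr_idem: "R \<in> \<R> \<Longrightarrow> pr (pr R) = pr R"
proof -
  assume R: "R \<in> \<R>"
  note p = pr_props[OF R]
  have "pr (pr R) \<subseteq> pr R"
    using pr_greatest[OF pr_props(1)[OF p(1)]] pr_props(2,3)[OF p(1)] p by auto
  then show ?thesis using pr_props(2)[OF p(1)] by auto
qed

text \<open>At most one principal set of each level contains \<open>x\<close>, and
  \<open>a F\<close> is comparable to \<open>2 powr level F\<close>. The sum is thus geometric, at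
  most 4 times its term of highest level, and squaring gives 16.\<close>

lemma principal_sum_le:
  "(\<Sum>F\<in>pr ` \<R>. a F * indicator F x)^2 \<le> 16 * (\<Sum>F\<in>pr ` \<R>. (a F)^2 * indicator F x)"
proof -
  define H where "H = {F \<in> pr ` \<R>. x \<in> F}"
  have fin: "finite (pr ` \<R>)" "finite H" using finite_R by (auto simp: H_def)
  have HR: "F \<in> \<R>" "pr F = F" "running_max F = a F" "x \<in> F" if "F \<in> H" for F
    using that pr_props pr_idem pr_attains by (auto simp: H_def)
  have s1: "(\<Sum>F\<in>pr ` \<R>. a F * indicator F x) = (\<Sum>F\<in>H. a F)"
    unfolding H_def using fin(1)
    by (intro sum.mono_neutral_cong_right) (auto simp: indicator_def)
  have s2: "(\<Sum>F\<in>pr ` \<R>. (a F)^2 * indicator F x) = (\<Sum>F\<in>H. (a F)^2)"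
    unfolding H_def using fin(1)
    by (intro sum.mono_neutral_cong_right) (auto simp: indicator_def)
  have inj: "inj_on level H"
  proof (rule inj_onI)
    fix F F' assume F: "F \<in> H" "F' \<in> H" "level F = level F'"
    have "F \<inter> F' \<noteq> {}" using HR(4)[OF F(1)] HR(4)[OF F(2)] by auto
    then show "F = F'"
      using nested[OF HR(1)[OF F(1)] HR(1)[OF F(2)]] F
        pr_greatest[OF HR(1)[OF F(1)], of F'] pr_greatest[OF HR(1)[OF F(2)], of F] HR(2)[OF F(1)] HR(2)[OF F(2)]
      by auto
  qed
  show ?thesis
  proof (cases "H = {}")
    case False
    define n where "n = Max (level ` H)"
    have "n \<in> level ` H" unfolding n_def using fin False by (intro Max_in) auto
    then obtain F0 where F0: "F0 \<in> H" "level F0 = n" by auto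
    have le: "level F \<le> n" if "F \<in> H" for F unfolding n_def using fin that by (intro Max_ge) auto
    have "(\<Sum>F\<in>H. a F) \<le> (\<Sum>F\<in>H. 2 * 2 powr n * (1/2) ^ nat (n - level F))"
    proof (rule sum_mono)
      fix F assume F: "F \<in> H"
      have "a F \<le> 2 * 2 powr level F" using level_bounds(2)[OF HR(1)[OF F]] HR(3)[OF F] by simp
      also have "(2::real) powr level F = 2 powr n * (1/2) ^ nat (n - level F)"
      proof -
        have "(1/2::real) ^ nat (n - level F) = 2 powr (- real (nat (n - level F)))"
          by (simp add: powr_minus powr_realpow power_one_over inverse_eq_divide)
        also have "real (nat (n - level F)) = real_of_int (n - level F)" using le[OF F] by simp
        finally show ?thesis by (simp flip: powr_add)
      qed
      finally show "a F \<le> 2 * 2 powr n * (1/2) ^ nat (n - level F)" by simp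
    qed
    also have "\<dots> = 2 * 2 powr n * (\<Sum>F\<in>H. (1/2) ^ nat (n - level F))" by (simp add: sum_distrib_left)
    also have "(\<Sum>F\<in>H. (1/2::real) ^ nat (n - level F)) = (\<Sum>j\<in>(\<lambda>F. nat (n - level F)) ` H. (1/2) ^ j)"
    proof (subst sum.reindex)
      show "inj_on (\<lambda>F. nat (n - level F)) H"
      proof (rule inj_onI)
        fix F F' assume F: "F \<in> H" "F' \<in> H" "nat (n - level F) = nat (n - level F')"
        then have "level F = level F'" using le[OF F(1)] le[OF F(2)] by simp
        then show "F = F'" using inj F by (auto dest: inj_onD)
      qed
    qed simp
    also have "\<dots> \<le> (\<Sum>j. (1/2::real) ^ j)"
      using fin by (intro sum_le_suminf) auto
    also have "\<dots> = 2" by (simp add: suminf_geometric)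
    finally have "(\<Sum>F\<in>H. a F) \<le> 4 * 2 powr n" by simp
    also have "\<dots> \<le> 4 * a F0" using level_bounds(1)[OF HR(1)[OF F0(1)]] HR(3)[OF F0(1)] F0(2) by simp
    finally have "(\<Sum>F\<in>H. a F)^2 \<le> (4 * a F0)^2"
      using a_pos HR by (intro power_mono sum_nonneg) (auto intro: less_imp_le)
    also have "\<dots> = 16 * (a F0)^2" by (simp add: power2_eq_square)
    also have "\<dots> \<le> 16 * (\<Sum>F\<in>H. (a F)^2)"
      using F0(1) fin by (intro mult_left_mono member_le_sum) auto
    finally show ?thesis unfolding s1 s2 .
  qed (simp add: s1 s2)
qed

text \<open>The quantity \<open>s\<close> to be estimated also bounds the \<open>L\<^sup>2\<close> norm of
  \<open>\<Sum>F. a F * indicator F\<close>, so the estimate absorbs itself and no maximal theorem is needed.\<close>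

lemma principal_embedding:
  fixes \<phi> :: "'a \<Rightarrow> real"
  assumes meas: "\<And>R. R \<in> \<R> \<Longrightarrow> R \<in> fmeasurable N" and \<phi>: "integrable N (\<lambda>x. (\<phi> x)^2)"
    and \<phi>i: "\<And>R. R \<in> \<R> \<Longrightarrow> integrable N (\<lambda>x. \<phi> x * indicator R x)"
    and a: "\<And>R. R \<in> \<R> \<Longrightarrow> a R * measure N R = (LINT x|N. \<phi> x * indicator R x)"
  shows "(\<Sum>F\<in>pr ` \<R>. (a F)^2 * measure N F) \<le> 16 * (LINT x|N. (\<phi> x)^2)"
proof -
  define s where "s = (\<Sum>F\<in>pr ` \<R>. (a F)^2 * measure N F)"
  have PR: "F \<in> \<R>" if "F \<in> pr ` \<R>" for F using that pr_props by auto
  define h where "h x = (\<Sum>F\<in>pr ` \<R>. a F * indicator F x)" for x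
  have h\<phi>: "h x * \<phi> x = (\<Sum>F\<in>pr ` \<R>. a F * (\<phi> x * indicator F x))" for x
    unfolding h_def sum_distrib_right by (rule sum.cong) auto
  have i1: "integrable N (\<lambda>x. h x * \<phi> x)" unfolding h\<phi> using \<phi>i PR by auto
  have ii: "integrable N (\<lambda>x. (a F)^2 * indicator F x :: real)" if "F \<in> pr ` \<R>" for F
    using meas[OF PR[OF that]] by (auto simp: fmeasurable_def)
  have i2: "integrable N (\<lambda>x. (1/2) * (\<Sum>F\<in>pr ` \<R>. (a F)^2 * indicator F x) + 8 * (\<phi> x)^2)"
    using ii \<phi> by auto
  have "s = (\<Sum>F\<in>pr ` \<R>. a F * (LINT x|N. \<phi> x * indicator F x))"
    unfolding s_def by (rule sum.cong) (use a PR in \<open>auto simp: power2_eq_square mult.assoc\<close>)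
  also have "\<dots> = (LINT x|N. h x * \<phi> x)"
    unfolding h\<phi> using \<phi>i PR by (subst Bochner_Integration.integral_sum) auto
  also have "\<dots> \<le> (LINT x|N. (1/2) * (\<Sum>F\<in>pr ` \<R>. (a F)^2 * indicator F x) + 8 * (\<phi> x)^2)"
  proof (rule integral_mono[OF i1 i2])
    fix x
    \<comment> \<open>The weight 16 is chosen so that the term with \<open>h\<close> becomes at most
      half of the sum to be estimated and can be absorbed.\<close>
    have "0 \<le> (h x - 16 * \<phi> x)^2" by simp
    then have "h x * \<phi> x \<le> (h x)^2 / 32 + 8 * (\<phi> x)^2" by (simp add: power2_eq_square algebra_simps)
    then show "h x * \<phi> x \<le> (1/2) * (\<Sum>F\<in>pr ` \<R>. (a F)^2 * indicator F x) + 8 * (\<phi> x)^2"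
      using principal_sum_le[of x] by (simp add: h_def)
  qed
  also have "\<dots> = (1/2) * (\<Sum>F\<in>pr ` \<R>. (LINT x|N. (a F)^2 * indicator F x)) + 8 * (LINT x|N. (\<phi> x)^2)"
    using ii \<phi> by (simp add: Bochner_Integration.integral_sum)
  also have "(\<Sum>F\<in>pr ` \<R>. (LINT x|N. (a F)^2 * indicator F x)) = s"
    unfolding s_def by (rule sum.cong) (use meas PR in auto)
  finally show ?thesis unfolding s_def[symmetric] by simp
qed

end

text \<open>Sums run over indices instead of sets because different cubes may have the same enlarged
  cube. The assumptions are symmetric in the two measures, which allows the roles to be
  exchanged.\<close>

locale two_weight =
  fixes N1 N2 :: "'a measure" and I :: "'i set" and R :: "'i \<Rightarrow> 'a set" and m :: "'i \<Rightarrow> real"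
    and \<phi> \<psi> :: "'a \<Rightarrow> real" and Aw c B :: real
  assumes finite_I: "finite I"
    and R1: "i \<in> I \<Longrightarrow> R i \<in> fmeasurable N1" and R2: "i \<in> I \<Longrightarrow> R i \<in> fmeasurable N2"
    and R1_pos: "i \<in> I \<Longrightarrow> 0 < measure N1 (R i)" and R2_pos: "i \<in> I \<Longrightarrow> 0 < measure N2 (R i)"
    and R_nested: "i \<in> I \<Longrightarrow> j \<in> I \<Longrightarrow> R i \<inter> R j \<noteq> {} \<Longrightarrow> R i \<subseteq> R j \<or> R j \<subseteq> R i"
    and m_pos: "i \<in> I \<Longrightarrow> 0 < m i" and Aw_pos: "0 < Aw" and c_pos: "0 < c" and B_pos: "0 < B"
    and A2: "i \<in> I \<Longrightarrow> measure N1 (R i) * measure N2 (R i) \<le> Aw * (m i)^2"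
    and carleson: "i \<in> I \<Longrightarrow> (\<Sum>j | j \<in> I \<and> R j \<subseteq> R i. m j) \<le> c * m i"
    and carleson1: "i \<in> I \<Longrightarrow> (\<Sum>j | j \<in> I \<and> R j \<subseteq> R i. measure N1 (R j)) \<le> B * measure N1 (R i)"
    and carleson2: "i \<in> I \<Longrightarrow> (\<Sum>j | j \<in> I \<and> R j \<subseteq> R i. measure N2 (R j)) \<le> B * measure N2 (R i)"
    and phi2: "integrable N1 (\<lambda>x. (\<phi> x)^2)" and psi2: "integrable N2 (\<lambda>x. (\<psi> x)^2)"
    and phi: "i \<in> I \<Longrightarrow> integrable N1 (\<lambda>x. \<phi> x * indicator (R i) x)"
    and psi: "i \<in> I \<Longrightarrow> integrable N2 (\<lambda>x. \<psi> x * indicator (R i) x)"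
    and phi_pos: "i \<in> I \<Longrightarrow> 0 < (LINT x|N1. \<phi> x * indicator (R i) x)"
    and psi_pos: "i \<in> I \<Longrightarrow> 0 < (LINT x|N2. \<psi> x * indicator (R i) x)"
begin

definition "av1 Q = (LINT x|N1. \<phi> x * indicator Q x) / measure N1 Q"
definition "av2 Q = (LINT x|N2. \<psi> x * indicator Q x) / measure N2 Q"

lemma R_ne: "i \<in> I \<Longrightarrow> R i \<noteq> {}"
  using R1_pos by fastforce

sublocale p1: principal_sets "R ` I" av1
proof
  show "0 < av1 Q" if "Q \<in> R ` I" for Q
    using that phi_pos R1_pos unfolding av1_def by (auto intro!: divide_pos_pos)
qed (use finite_I R_ne R_nested in auto)

sublocale p2: principal_sets "R ` I" av2
proof
  show "0 < av2 Q" if "Q \<in> R ` I" for Q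
    using that psi_pos R2_pos unfolding av2_def by (auto intro!: divide_pos_pos)
qed (use finite_I R_ne R_nested in auto)

lemma embedding1: "(\<Sum>F\<in>p1.pr ` R ` I. (av1 F)^2 * measure N1 F) \<le> 16 * (LINT x|N1. (\<phi> x)^2)"
proof (rule p1.principal_embedding)
  show "av1 Q * measure N1 Q = (LINT x|N1. \<phi> x * indicator Q x)" if Q: "Q \<in> R ` I" for Q
  proof -
    obtain i where "i \<in> I" "Q = R i" using Q by auto
    then show ?thesis using R1_pos[of i] by (simp add: av1_def)
  qed
qed (use R1 phi phi2 in auto)

lemma embedding2: "(\<Sum>F\<in>p2.pr ` R ` I. (av2 F)^2 * measure N2 F) \<le> 16 * (LINT x|N2. (\<psi> x)^2)"
proof (rule p2.principal_embedding)
  show "av2 Q * measure N2 Q = (LINT x|N2. \<psi> x * indicator Q x)" if Q: "Q \<in> R ` I" for Q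
  proof -
    obtain i where "i \<in> I" "Q = R i" using Q by auto
    then show ?thesis using R2_pos[of i] by (simp add: av2_def)
  qed
qed (use R2 psi psi2 in auto)

text \<open>In each nested pair the two-weight condition is applied to the smaller set and turns its
  term into \<open>Aw * m j\<close>. The packing of \<open>m\<close> inside the larger set then
  cancels the denominator of \<open>k i\<close>, leaving \<open>measure N1 (R i)\<close>, which
  \<open>carleson1\<close> sums.\<close>

lemma testing:
  assumes i0: "i0 \<in> I" and J: "J \<subseteq> {i \<in> I. R i \<subseteq> R i0}"
  shows "(\<Sum>i\<in>J. \<Sum>j\<in>J. measure N1 (R i) / m i * (measure N1 (R j) / m j) * measure N2 (R i \<inter> R j))
    \<le> 2 * Aw * c * B * measure N1 (R i0)"
proof -
  define k where "k i = measure N1 (R i) / m i" for i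
  have fin: "finite J" using J finite_I by (auto intro: finite_subset)
  have JI: "i \<in> I" if "i \<in> J" for i using J that by auto
  have k0: "0 \<le> k i" if "i \<in> J" for i using R1_pos m_pos JI[OF that] by (auto simp: k_def intro: less_imp_le)
  \<comment> \<open>Pairs of indices with the same set are counted in both orders, which only
    enlarges the bound and accounts for part of the factor 2.\<close>
  define g where "g i j = (if R j \<subseteq> R i then k i * k j * measure N2 (R j) else 0)" for i j
  have g0: "0 \<le> g i j" if "i \<in> J" "j \<in> J" for i j using k0 that by (auto simp: g_def)
  have "(\<Sum>i\<in>J. \<Sum>j\<in>J. k i * k j * measure N2 (R i \<inter> R j)) \<le> (\<Sum>i\<in>J. \<Sum>j\<in>J. g i j + g j i)"
  proof (intro sum_mono)
    fix i j assume ij: "i \<in> J" "j \<in> J"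
    show "k i * k j * measure N2 (R i \<inter> R j) \<le> g i j + g j i"
    proof (cases "R i \<inter> R j = {}")
      case True
      then show ?thesis using g0[OF ij] g0[OF ij(2,1)] by simp
    next
      case False
      then consider "R i \<subseteq> R j" | "R j \<subseteq> R i" using R_nested JI ij by blast
      then show ?thesis
      proof cases
        case 1
        then have "k i * k j * measure N2 (R i \<inter> R j) = g j i" by (simp add: g_def Int_absorb2)
        then show ?thesis using g0[OF ij] by simp
      next
        case 2
        then have "k i * k j * measure N2 (R i \<inter> R j) = g i j" by (simp add: g_def Int_absorb1)
        then show ?thesis using g0[OF ij(2,1)] by simp
      qed
    qed
  qed
  also have "\<dots> = (\<Sum>i\<in>J. \<Sum>j\<in>J. g i j) + (\<Sum>i\<in>J. \<Sum>j\<in>J. g j i)" by (simp add: sum.distrib)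
  also have "(\<Sum>i\<in>J. \<Sum>j\<in>J. g j i) = (\<Sum>i\<in>J. \<Sum>j\<in>J. g i j)" by (rule sum.swap)
  also have "(\<Sum>i\<in>J. \<Sum>j\<in>J. g i j) \<le> (\<Sum>i\<in>J. Aw * c * measure N1 (R i))"
  proof (rule sum_mono)
    fix i assume i: "i \<in> J"
    have "(\<Sum>j\<in>J. g i j) \<le> (\<Sum>j\<in>J. if R j \<subseteq> R i then k i * (Aw * m j) else 0)"
    proof (rule sum_mono)
      fix j assume j: "j \<in> J"
      have "k j * measure N2 (R j) = measure N1 (R j) * measure N2 (R j) / m j" by (simp add: k_def)
      also have "\<dots> \<le> Aw * (m j)^2 / m j"
        using A2[OF JI[OF j]] m_pos[OF JI[OF j]] by (intro divide_right_mono) auto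
      also have "\<dots> = Aw * m j" by (simp add: power2_eq_square)
      finally have "k j * measure N2 (R j) \<le> Aw * m j" .
      then have "k i * (k j * measure N2 (R j)) \<le> k i * (Aw * m j)" using k0[OF i] by (rule mult_left_mono)
      then show "g i j \<le> (if R j \<subseteq> R i then k i * (Aw * m j) else 0)" by (simp add: g_def mult.assoc)
    qed
    also have "\<dots> = (\<Sum>j\<in>{j\<in>J. R j \<subseteq> R i}. k i * (Aw * m j))"
      using fin by (simp add: sum.inter_filter)
    also have "\<dots> = k i * Aw * (\<Sum>j\<in>{j\<in>J. R j \<subseteq> R i}. m j)" by (simp add: sum_distrib_left mult.assoc)
    also have "\<dots> \<le> k i * Aw * (\<Sum>j | j \<in> I \<and> R j \<subseteq> R i. m j)"
    proof (intro mult_left_mono sum_mono2)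
      show "finite {j. j \<in> I \<and> R j \<subseteq> R i}" using finite_I by simp
      show "0 \<le> m b" if "b \<in> {j. j \<in> I \<and> R j \<subseteq> R i} - {j \<in> J. R j \<subseteq> R i}" for b
        using m_pos[of b] that by auto
      show "0 \<le> k i * Aw" using k0[OF i] Aw_pos by simp
    qed (use JI in auto)
    also have "\<dots> \<le> k i * Aw * (c * m i)"
      using carleson[OF JI[OF i]] k0[OF i] Aw_pos by (intro mult_left_mono) auto
    also have "\<dots> = Aw * c * measure N1 (R i)" using m_pos[OF JI[OF i]] by (simp add: k_def)
    finally show "(\<Sum>j\<in>J. g i j) \<le> Aw * c * measure N1 (R i)" .
  qed
  also have "(\<Sum>i\<in>J. Aw * c * measure N1 (R i)) = Aw * c * (\<Sum>i\<in>J. measure N1 (R i))"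
    by (simp add: sum_distrib_left)
  also have "\<dots> \<le> Aw * c * (B * measure N1 (R i0))"
  proof (rule mult_left_mono)
    have "(\<Sum>i\<in>J. measure N1 (R i)) \<le> (\<Sum>j | j \<in> I \<and> R j \<subseteq> R i0. measure N1 (R j))"
      using J finite_I by (intro sum_mono2) auto
    then show "(\<Sum>i\<in>J. measure N1 (R i)) \<le> B * measure N1 (R i0)" using carleson1[OF i0] by linarith
  qed (use Aw_pos c_pos in simp)
  finally show ?thesis unfolding k_def by (simp add: mult_ac)
qed

text \<open>A corona argument for the terms whose principal set for \<open>\<psi>\<close> is the
  smaller one. In the block of \<open>F = p1.pr (R i)\<close>, \<open>av1 (R i)\<close> is replaced
  by \<open>2 * av1 F\<close>, and the weighted arithmetic-geometric inequality separates the
  testing function from the averages of \<open>\<psi>\<close>. Each principal set of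
  \<open>\<psi>\<close> belongs to one block only, so the two embeddings finish the sum.\<close>

lemma one_sided:
  assumes t: "0 < t"
  shows "(\<Sum>i | i \<in> I \<and> p2.pr (R i) \<subseteq> p1.pr (R i).
      (LINT x|N1. \<phi> x * indicator (R i) x) * (LINT x|N2. \<psi> x * indicator (R i) x) / m i)
    \<le> 32 * Aw * c * B * t * (LINT x|N1. (\<phi> x)^2) + 64 / t * (LINT x|N2. (\<psi> x)^2)"
proof -
  define I' where "I' = {i. i \<in> I \<and> p2.pr (R i) \<subseteq> p1.pr (R i)}"
  have I': "finite I'" "I' \<subseteq> I" using finite_I by (auto simp: I'_def)
  define \<F> where "\<F> = p1.pr ` R ` I"
  define \<G> where "\<G> = p2.pr ` R ` I"
  have fin: "finite \<F>" "finite \<G>" using finite_I by (auto simp: \<F>_def \<G>_def)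
  define k where "k i = measure N1 (R i) / m i" for i
  have k0: "0 \<le> k i" if "i \<in> I" for i using R1_pos[OF that] m_pos[OF that] by (auto simp: k_def)
  define J where "J F = {i \<in> I'. p1.pr (R i) = F}" for F
  define G where "G F = {G \<in> \<G>. p1.pr G = F}" for F
  have finJ: "finite (J F)" "finite (G F)" for F using I' fin by (auto simp: J_def G_def)
  define tm where "tm i = (LINT x|N1. \<phi> x * indicator (R i) x) * (LINT x|N2. \<psi> x * indicator (R i) x) / m i" for i
  have Gm: "Q \<in> fmeasurable N2" "Q \<in> R ` I" if "Q \<in> \<G>" for Q
  proof -
    show "Q \<in> R ` I" using that p2.pr_props(1) by (auto simp: \<G>_def)
    then show "Q \<in> fmeasurable N2" using R2 by auto
  qed
  have blk: "(\<Sum>i\<in>J F. tm i) \<le> t * (av1 F)^2 * (2 * Aw * c * B * measure N1 F) +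
      4 / t * (\<Sum>Q\<in>G F. (av2 Q)^2 * measure N2 Q)" if F: "F \<in> \<F>" for F
  proof -
    obtain i0 where i0: "i0 \<in> I" "F = R i0" using F p1.pr_props(1) by (force simp: \<F>_def)
    have av1F: "0 \<le> av1 F" using p1.a_pos[of F] i0 by auto
    have JI: "i \<in> I" "R i \<subseteq> F" "i \<in> I'" if "i \<in> J F" for i
      using that I' p1.pr_props(2)[of "R i"] by (auto simp: J_def)
    define Tf where "Tf x = (\<Sum>i\<in>J F. k i * indicator (R i) x)" for x
    \<comment> \<open>Adding all squares in the block dominates, at each point of
      \<open>R i\<close>, the square belonging to \<open>p2.pr (R i)\<close> and hence
      \<open>(av2 (R i))^2\<close>.\<close>
    define v where "v x = (\<Sum>Q\<in>G F. (2 * av2 Q)^2 * indicator Q x)" for x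
    have Tf0: "0 \<le> Tf x" for x unfolding Tf_def using k0 JI by (intro sum_nonneg mult_nonneg_nonneg) auto
    have Tf2: "(Tf x)^2 = (\<Sum>i\<in>J F. \<Sum>j\<in>J F. k i * k j * indicator (R i \<inter> R j) x)" for x
      unfolding Tf_def power2_eq_square sum_product
      by (intro sum.cong) (auto simp: indicator_def)
    have mIJ: "R i \<inter> R j \<in> fmeasurable N2" if "i \<in> J F" "j \<in> J F" for i j
      using R2 JI that by (intro fmeasurable.Int) auto
    have iT: "integrable N2 (\<lambda>x. k i * k j * indicator (R i \<inter> R j) x)" if "i \<in> J F" "j \<in> J F" for i j
      using mIJ[OF that] by (auto simp: fmeasurable_def)
    have iT2: "integrable N2 (\<lambda>x. (Tf x)^2)"
      unfolding Tf2 using iT by (intro Bochner_Integration.integrable_sum)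
    have intT: "(LINT x|N2. (Tf x)^2) \<le> 2 * Aw * c * B * measure N1 F"
    proof -
      have "(LINT x|N2. (Tf x)^2) = (\<Sum>i\<in>J F. \<Sum>j\<in>J F. LINT x|N2. k i * k j * indicator (R i \<inter> R j) x)"
        unfolding Tf2 using iT
        by (subst Bochner_Integration.integral_sum, (intro Bochner_Integration.integrable_sum; simp),
            intro sum.cong refl Bochner_Integration.integral_sum) auto
      also have "\<dots> = (\<Sum>i\<in>J F. \<Sum>j\<in>J F. k i * k j * measure N2 (R i \<inter> R j))"
        by (intro sum.cong refl) (use mIJ in simp)
      also have "\<dots> \<le> 2 * Aw * c * B * measure N1 F"
        unfolding k_def i0(2) by (rule testing[OF i0(1)]) (use JI i0 in auto)
      finally show ?thesis .
    qed
    have iG: "integrable N2 (\<lambda>x. (2 * av2 Q)^2 * indicator Q x :: real)" if "Q \<in> G F" for Q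
      using Gm(1)[of Q] that by (auto simp: fmeasurable_def G_def)
    have iv: "integrable N2 v" unfolding v_def using iG by auto
    have intv: "(LINT x|N2. v x) = 4 * (\<Sum>Q\<in>G F. (av2 Q)^2 * measure N2 Q)"
    proof -
      have "(LINT x|N2. v x) = (\<Sum>Q\<in>G F. LINT x|N2. (2 * av2 Q)^2 * indicator Q x)"
        unfolding v_def by (rule Bochner_Integration.integral_sum) (rule iG)
      also have "\<dots> = (\<Sum>Q\<in>G F. 4 * ((av2 Q)^2 * measure N2 Q))"
        by (intro sum.cong refl) (use Gm in \<open>auto simp: G_def power2_eq_square\<close>)
      finally show ?thesis by (simp add: sum_distrib_left)
    qed
    have iS: "integrable N2 (\<lambda>x. 2 * av1 F * k i * (av2 (R i) * indicator (R i) x))" if "i \<in> J F" for i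
      using R2 JI[OF that] by (auto simp: fmeasurable_def)
    have "(\<Sum>i\<in>J F. tm i) \<le> (\<Sum>i\<in>J F. LINT x|N2. 2 * av1 F * k i * (av2 (R i) * indicator (R i) x))"
    proof (rule sum_mono)
      fix i assume i: "i \<in> J F"
      have "av1 (R i) \<le> 2 * av1 F" using p1.le_pr[of "R i"] JI[OF i] i by (auto simp: J_def)
      moreover have "0 \<le> k i * (av2 (R i) * measure N2 (R i))"
        using k0 p2.a_pos[of "R i"] JI[OF i] by (intro mult_nonneg_nonneg) auto
      ultimately have "av1 (R i) * (k i * (av2 (R i) * measure N2 (R i))) \<le>
          2 * av1 F * (k i * (av2 (R i) * measure N2 (R i)))"
        by (rule mult_right_mono)
      moreover have "tm i = av1 (R i) * (k i * (av2 (R i) * measure N2 (R i)))"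
        using R1_pos[OF JI(1)[OF i]] R2_pos[OF JI(1)[OF i]] by (simp add: tm_def av1_def av2_def k_def)
      ultimately show "tm i \<le> (LINT x|N2. 2 * av1 F * k i * (av2 (R i) * indicator (R i) x))"
        using R2[OF JI(1)[OF i]] by (simp add: mult.assoc)
    qed
    also have "\<dots> = (LINT x|N2. (\<Sum>i\<in>J F. 2 * av1 F * k i * (av2 (R i) * indicator (R i) x)))"
      by (rule Bochner_Integration.integral_sum[symmetric]) (rule iS)
    also have "\<dots> \<le> (LINT x|N2. t * (av1 F)^2 * (Tf x)^2 + 1 / t * v x)"
    proof (rule integral_mono)
      show "integrable N2 (\<lambda>x. \<Sum>i\<in>J F. 2 * av1 F * k i * (av2 (R i) * indicator (R i) x))"
        using iS by auto
      show "integrable N2 (\<lambda>x. t * (av1 F)^2 * (Tf x)^2 + 1 / t * v x)" using iT2 iv by auto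
      fix x
      have v0: "0 \<le> v x" unfolding v_def by (intro sum_nonneg) auto
      have le: "av2 (R i) * indicator (R i) x \<le> sqrt (v x)" if i: "i \<in> J F" for i
      proof (cases "x \<in> R i")
        case True
        note iI = JI[OF i]
        have RI: "R i \<in> R ` I" using iI by auto
        note p = p2.pr_props[OF RI]
        have pF: "p1.pr (R i) = F" using i by (auto simp: J_def)
        have sub: "p2.pr (R i) \<subseteq> F" using iI(3) pF by (auto simp: I'_def)
        \<comment> \<open>\<open>p2.pr (R i)\<close> is squeezed between \<open>R i\<close> and
          \<open>F\<close>, and \<open>p1.pr\<close> sends both ends to \<open>F\<close>; so it
          belongs to the block.\<close>
        have "p1.pr (p2.pr (R i)) = F"
        proof
          have "p1.pr (p2.pr (R i)) \<subseteq> p1.pr F"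
            using sub p(1) i0 by (intro p1.pr_mono) auto
          also have "p1.pr F = F" using p1.pr_idem[OF RI] pF by simp
          finally show "p1.pr (p2.pr (R i)) \<subseteq> F" .
          show "F \<subseteq> p1.pr (p2.pr (R i))" using p1.pr_mono[OF RI p(1) p(2)] pF by simp
        qed
        then have GF: "p2.pr (R i) \<in> G F" using iI by (auto simp: G_def \<G>_def)
        have "(av2 (R i))^2 \<le> (2 * av2 (p2.pr (R i)))^2"
          using p2.le_pr[OF RI] p2.a_pos[OF RI] by (intro power_mono) auto
        also have "\<dots> = (2 * av2 (p2.pr (R i)))^2 * indicator (p2.pr (R i)) x" using True p(2) by auto
        also have "\<dots> \<le> v x" unfolding v_def by (rule member_le_sum[OF GF]) (use finJ in auto)
        finally have "av2 (R i) \<le> sqrt (v x)" by (rule real_le_rsqrt)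
        then show ?thesis using True by simp
      qed (use v0 in simp)
      have "(\<Sum>i\<in>J F. 2 * av1 F * k i * (av2 (R i) * indicator (R i) x)) \<le>
          (\<Sum>i\<in>J F. 2 * av1 F * (k i * indicator (R i) x) * sqrt (v x))"
      proof (rule sum_mono)
        fix i assume i: "i \<in> J F"
        show "2 * av1 F * k i * (av2 (R i) * indicator (R i) x) \<le> 2 * av1 F * (k i * indicator (R i) x) * sqrt (v x)"
        proof (cases "x \<in> R i")
          case True
          then have "2 * av1 F * k i * av2 (R i) \<le> 2 * av1 F * k i * sqrt (v x)"
            using le[OF i] av1F k0[OF JI(1)[OF i]] by (intro mult_left_mono) auto
          then show ?thesis using True by simp
        qed simp
      qed
      also have "\<dots> = 2 * (av1 F * Tf x) * sqrt (v x)"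
        by (simp add: Tf_def sum_distrib_left sum_distrib_right mult.assoc)
      also have "\<dots> \<le> t * (av1 F * Tf x)^2 + 1 / t * (sqrt (v x))^2"
      proof -
        have "0 \<le> (sqrt t * (av1 F * Tf x) - sqrt (v x) / sqrt t)^2" by simp
        also have "\<dots> = t * (av1 F * Tf x)^2 - 2 * (av1 F * Tf x) * sqrt (v x) + 1 / t * (sqrt (v x))^2"
          using t by (simp add: power2_diff power_mult_distrib power_divide)
        finally show ?thesis by simp
      qed
      also have "\<dots> = t * (av1 F)^2 * (Tf x)^2 + 1 / t * v x"
        using v0 by (simp add: power_mult_distrib)
      finally show "(\<Sum>i\<in>J F. 2 * av1 F * k i * (av2 (R i) * indicator (R i) x)) \<le>
          t * (av1 F)^2 * (Tf x)^2 + 1 / t * v x" .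
    qed
    also have "\<dots> = t * (av1 F)^2 * (LINT x|N2. (Tf x)^2) + 1 / t * (LINT x|N2. v x)"
      using iT2 iv by simp
    also have "\<dots> \<le> t * (av1 F)^2 * (2 * Aw * c * B * measure N1 F) + 1 / t * (LINT x|N2. v x)"
      using intT t by (intro add_right_mono mult_left_mono) auto
    finally show ?thesis by (simp add: intv)
  qed
  have "(\<Sum>i\<in>I'. tm i) = (\<Sum>F\<in>\<F>. \<Sum>i\<in>J F. tm i)"
    unfolding J_def using I' fin by (intro sum.group[symmetric]) (auto simp: \<F>_def)
  also have "\<dots> \<le> (\<Sum>F\<in>\<F>. t * (av1 F)^2 * (2 * Aw * c * B * measure N1 F) +
      4 / t * (\<Sum>Q\<in>G F. (av2 Q)^2 * measure N2 Q))"
    by (intro sum_mono blk)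
  also have "\<dots> = 2 * Aw * c * B * t * (\<Sum>F\<in>\<F>. (av1 F)^2 * measure N1 F) +
      4 / t * (\<Sum>F\<in>\<F>. \<Sum>Q\<in>G F. (av2 Q)^2 * measure N2 Q)"
    by (simp add: sum.distrib sum_distrib_left mult_ac)
  also have "(\<Sum>F\<in>\<F>. \<Sum>Q\<in>G F. (av2 Q)^2 * measure N2 Q) = (\<Sum>Q\<in>\<G>. (av2 Q)^2 * measure N2 Q)"
    unfolding G_def using fin Gm by (intro sum.group) (auto simp: \<F>_def)
  also have "2 * Aw * c * B * t * (\<Sum>F\<in>\<F>. (av1 F)^2 * measure N1 F) \<le>
      2 * Aw * c * B * t * (16 * (LINT x|N1. (\<phi> x)^2))"
    using embedding1 Aw_pos c_pos B_pos t unfolding \<F>_def by (intro mult_left_mono) auto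
  also have "4 / t * (\<Sum>Q\<in>\<G>. (av2 Q)^2 * measure N2 Q) \<le> 4 / t * (16 * (LINT x|N2. (\<psi> x)^2))"
    using embedding2 t unfolding \<G>_def by (intro mult_left_mono) auto
  finally show ?thesis unfolding tm_def I'_def by simp
qed

end

lemma (in two_weight) bilinear_bound:
  assumes t: "0 < t"
  shows "(\<Sum>i\<in>I. (LINT x|N1. \<phi> x * indicator (R i) x) * (LINT x|N2. \<psi> x * indicator (R i) x) / m i)
    \<le> 64 * Aw * c * B * t * (LINT x|N1. (\<phi> x)^2) + 128 / t * (LINT x|N2. (\<psi> x)^2)"
proof -
  interpret sw: two_weight N2 N1 I R m \<psi> \<phi> Aw c B
    by unfold_locales
      (use finite_I R1 R2 R1_pos R2_pos R_nested m_pos Aw_pos c_pos B_pos A2 carleson carleson1 carleson2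
        phi2 psi2 phi psi phi_pos psi_pos in \<open>auto simp: mult.commute\<close>)
  have av: "sw.av1 = av2" "sw.av2 = av1"
    unfolding sw.av1_def[abs_def] sw.av2_def[abs_def] av1_def[abs_def] av2_def[abs_def] by auto
  \<comment> \<open>With this parameter the exchanged estimate has the same two coefficients as the
    original one. Terms with equal principal sets are counted twice, which is harmless as all terms
    are nonnegative.\<close>
  define s where "s = 2 / (t * Aw * c * B)"
  have s: "0 < s" using t Aw_pos c_pos B_pos by (simp add: s_def)
  define g where "g i = (LINT x|N1. \<phi> x * indicator (R i) x) * (LINT x|N2. \<psi> x * indicator (R i) x) / m i" for i
  have g0: "0 \<le> g i" if "i \<in> I" for i
    using phi_pos[OF that] psi_pos[OF that] m_pos[OF that] by (simp add: g_def)
  have nest: "p2.pr (R i) \<subseteq> p1.pr (R i) \<or> p1.pr (R i) \<subseteq> p2.pr (R i)" if i: "i \<in> I" for i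
  proof -
    have "R i \<in> R ` I" using i by auto
    then show ?thesis
      using p1.pr_props[of "R i"] p2.pr_props[of "R i"] R_ne[OF i]
        p1.nested[of "p2.pr (R i)" "p1.pr (R i)"] by blast
  qed
  have "(\<Sum>i\<in>I. g i) \<le> (\<Sum>i | i \<in> I \<and> p2.pr (R i) \<subseteq> p1.pr (R i). g i) + (\<Sum>i | i \<in> I \<and> p1.pr (R i) \<subseteq> p2.pr (R i). g i)"
  proof -
    have "(\<Sum>i\<in>I. g i) \<le> (\<Sum>i\<in>I. (if p2.pr (R i) \<subseteq> p1.pr (R i) then g i else 0) +
        (if p1.pr (R i) \<subseteq> p2.pr (R i) then g i else 0))"
    proof (rule sum_mono)
      fix i assume "i \<in> I"
      then show "g i \<le> (if p2.pr (R i) \<subseteq> p1.pr (R i) then g i else 0) +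
          (if p1.pr (R i) \<subseteq> p2.pr (R i) then g i else 0)"
        using nest[of i] g0[of i] by auto
    qed
    also have "\<dots> = (\<Sum>i | i \<in> I \<and> p2.pr (R i) \<subseteq> p1.pr (R i). g i) + (\<Sum>i | i \<in> I \<and> p1.pr (R i) \<subseteq> p2.pr (R i). g i)"
      using finite_I by (simp add: sum.distrib sum.inter_filter)
    finally show ?thesis .
  qed
  also have "(\<Sum>i | i \<in> I \<and> p2.pr (R i) \<subseteq> p1.pr (R i). g i) \<le>
      32 * Aw * c * B * t * (LINT x|N1. (\<phi> x)^2) + 64 / t * (LINT x|N2. (\<psi> x)^2)"
    unfolding g_def by (rule one_sided[OF t])
  also have "(\<Sum>i | i \<in> I \<and> p1.pr (R i) \<subseteq> p2.pr (R i). g i) \<le>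
      32 * Aw * c * B * s * (LINT x|N2. (\<psi> x)^2) + 64 / s * (LINT x|N1. (\<phi> x)^2)"
    using sw.one_sided[OF s] unfolding g_def av by (simp add: mult.commute)
  also have "32 * Aw * c * B * s = 64 / t"
    using t Aw_pos c_pos B_pos by (simp add: s_def field_simps)
  also have "64 / s = 32 * Aw * c * B * t"
    using t Aw_pos c_pos B_pos by (simp add: s_def field_simps)
  finally show ?thesis unfolding g_def by (simp add: algebra_simps)
qed

subsection \<open>Weighted estimates for sparse operators\<close>

context cz_space
begin

lemma weight_cube_integrable:
  assumes w: "weight M \<rho> w" and Q: "Q \<in> cubes S"
  shows "integrable M (\<lambda>x. w x * indicator Q x)"
proof -
  have "0 < C0 * rad Q" using C0_pos rad_pos[OF Q] by simp
  then have "set_integrable M (bl (ctr Q) (C0 * rad Q)) w"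
    using w ctr_space[OF Q] by (simp add: weight_def)
  then have "set_integrable M Q w"
    by (rule set_integrable_subset[OF _ adj_sets[OF Q] cube_subset_ball[OF Q]])
  then show ?thesis by (simp add: set_integrable_def mult.commute)
qed

lemma emeasure_weighted:
  "v \<in> borel_measurable M \<Longrightarrow> Q \<in> sets M \<Longrightarrow> emeasure (weighted M v) Q = (\<integral>\<^sup>+x\<in>Q. ennreal (v x) \<partial>M)"
  unfolding weighted_def by (rule emeasure_density) auto

lemma emeasure_weighted_pos:
  assumes v: "v \<in> borel_measurable M" "AE x in M. 0 < v x" and Q: "Q \<in> cubes S"
  shows "0 < emeasure (weighted M v) Q"
proof (rule ccontr)
  have [measurable]: "v \<in> borel_measurable M" "Q \<in> sets M" using v adj_sets[OF Q] by auto
  assume "\<not> ?thesis"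
  then have "(\<integral>\<^sup>+x. ennreal (v x) * indicator Q x \<partial>M) = 0"
    using emeasure_weighted[OF v(1) adj_sets[OF Q]] by simp
  then have "AE x in M. ennreal (v x) * indicator Q x = 0" by (subst (asm) nn_integral_0_iff_AE) auto
  with v(2) have "AE x in M. x \<notin> Q" by eventually_elim (auto simp: indicator_def)
  then have "Q \<in> null_sets M" by (simp add: AE_iff_null_sets)
  then show False using adj_measure_pos[OF Q] by (simp add: null_setsD1 measure_def)
qed

lemma Ainf_bound:
  assumes v: "v \<in> borel_measurable M" "AE x in M. 0 < v x" and Q: "Q \<in> cubes S"
    and fin: "emeasure (weighted M v) Q < \<infinity>"
  shows "(\<integral>\<^sup>+x\<in>Q. cube_maximal M S (\<lambda>y. v y * indicator Q y) x \<partial>M) \<le>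
    Ainf_const M S v * emeasure (weighted M v) Q"
proof -
  let ?a = "\<integral>\<^sup>+x\<in>Q. cube_maximal M S (\<lambda>y. v y * indicator Q y) x \<partial>M"
  let ?b = "emeasure (weighted M v) Q"
  have eq: "?b = (\<integral>\<^sup>+x\<in>Q. ennreal (v x) \<partial>M)" by (rule emeasure_weighted[OF v(1) adj_sets[OF Q]])
  have "?a / ?b \<le> Ainf_const M S v"
    unfolding Ainf_const_def eq using Q by (intro SUP_upper) auto
  then have "?a / ?b * ?b \<le> Ainf_const M S v * ?b" by (rule mult_right_mono) auto
  moreover have "?a / ?b * ?b = ?a"
    using emeasure_weighted_pos[OF v Q] fin
    by (simp add: ennreal_divide_times ennreal_mult_divide_eq less_top[symmetric])
  ultimately show ?thesis by simp
qed

text \<open>On \<open>E P\<close> the maximal function dominates the average of \<open>v\<close>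
  over \<open>star P\<close>, since \<open>E P\<close> lies in \<open>star P\<close>. The disjoint
  sets belong to \<open>P\<close> while the masses belong to \<open>star P\<close>; the factor
  \<open>2 * cd\<close> pays for both the sparseness and the enlargement.\<close>

lemma carleson_weight:
  assumes v: "v \<in> borel_measurable M" "AE x in M. 0 < v x" and Q: "Q \<in> cubes S"
    and fin: "emeasure (weighted M v) Q < \<infinity>" and J: "finite J" "J \<subseteq> cubes S" "\<And>P. P \<in> J \<Longrightarrow> star P \<subseteq> Q"
    and sparse: "sparse_family E J"
  shows "(\<Sum>P\<in>J. emeasure (weighted M v) (star P)) \<le>
    ennreal (2 * cd) * (Ainf_const M S v * emeasure (weighted M v) Q)"
proof -
  note E = sparse_familyD[OF sparse]
  let ?Mv = "cube_maximal M S (\<lambda>y. v y * indicator Q y)"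
  have [measurable]: "v \<in> borel_measurable M" "Q \<in> sets M" using v adj_sets[OF Q] by auto
  have Em: "E P \<in> sets M" "E P \<in> fmeasurable M" if "P \<in> J" for P
    using E(2)[OF that] adj_fmeasurable[of P] J(2) that by (auto intro: fmeasurableI2)
  have one: "emeasure (weighted M v) (star P) \<le> ennreal (2 * cd) * (\<integral>\<^sup>+x\<in>E P. ?Mv x \<partial>M)" if P: "P \<in> J" for P
  proof -
    have Pc: "P \<in> cubes S" using P J by auto
    note sc = star_cube[OF Pc]
    have [measurable]: "star P \<in> sets M" by (rule adj_sets[OF sc])
    define b where "b = emeasure (weighted M v) (star P)"
    have "b = (\<integral>\<^sup>+x\<in>star P. ennreal (v x) \<partial>M)" unfolding b_def by (rule emeasure_weighted) auto
    also have "\<dots> \<le> (\<integral>\<^sup>+y\<in>star P. ennreal \<bar>v y * indicator Q y\<bar> \<partial>M)"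
      using J(3)[OF P] by (intro nn_integral_mono) (auto split: split_indicator intro!: ennreal_leI)
    finally have b: "b \<le> (\<integral>\<^sup>+y\<in>star P. ennreal \<bar>v y * indicator Q y\<bar> \<partial>M)" .
    have pt: "b * emeasure M (E P) \<le> emeasure M (star P) * (\<integral>\<^sup>+x\<in>E P. ?Mv x \<partial>M)"
    proof -
      have "b * emeasure M (E P) = (\<integral>\<^sup>+x\<in>E P. b \<partial>M)"
        by (rule nn_integral_cmult_indicator[symmetric]) (rule Em(1)[OF P])
      also have "\<dots> \<le> (\<integral>\<^sup>+x\<in>E P. emeasure M (star P) * ?Mv x \<partial>M)"
      proof (rule nn_integral_mono)
        fix x
        have "b \<le> ?Mv x * emeasure M (star P)" if "x \<in> E P"
        proof -
          have "x \<in> star P" using that E(2)[OF P] cube_subset_star[OF Pc] by auto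
          then show ?thesis by (rule order_trans[OF b maximal_ge[OF sc]])
        qed
        then show "b * indicator (E P) x \<le> emeasure M (star P) * ?Mv x * indicator (E P) x"
          by (auto split: split_indicator simp: mult.commute)
      qed
      also have "\<dots> = emeasure M (star P) * (\<integral>\<^sup>+x\<in>E P. ?Mv x \<partial>M)"
        using Em(1)[OF P] by (simp add: mult.assoc nn_integral_cmult)
      finally show ?thesis .
    qed
    have le: "emeasure M (star P) \<le> ennreal (2 * cd) * emeasure M (E P)"
    proof -
      have "mu (star P) \<le> cd * mu P" by (rule star_measure[OF Pc])
      also have "\<dots> \<le> cd * (2 * mu (E P))" using E(2)[OF P] cd_pos by (intro mult_left_mono) auto
      finally have "ennreal (mu (star P)) \<le> ennreal (2 * cd * mu (E P))" by (intro ennreal_leI) simp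
      then show ?thesis using cd_pos
        by (simp add: adj_emeasure[OF sc] emeasure_eq_measure2[OF Em(2)[OF P]] ennreal_mult')
    qed
    \<comment> \<open>Both sides are multiplied by the measure of \<open>star P\<close>, which is
      cancelled at the end; positivity and finiteness permit this in \<open>ennreal\<close>.\<close>
    have pos: "0 < emeasure M (star P)" "emeasure M (star P) < top"
      using adj_measure_pos[OF sc] by (auto simp: adj_emeasure[OF sc])
    have "emeasure M (star P) * b \<le> ennreal (2 * cd) * emeasure M (E P) * b"
      by (rule mult_right_mono[OF le]) simp
    also have "\<dots> = ennreal (2 * cd) * (b * emeasure M (E P))" by (simp add: mult_ac)
    also have "\<dots> \<le> ennreal (2 * cd) * (emeasure M (star P) * (\<integral>\<^sup>+x\<in>E P. ?Mv x \<partial>M))"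
      by (rule mult_left_mono[OF pt]) simp
    also have "\<dots> = emeasure M (star P) * (ennreal (2 * cd) * (\<integral>\<^sup>+x\<in>E P. ?Mv x \<partial>M))" by (simp add: mult_ac)
    finally show ?thesis unfolding b_def[symmetric] using pos
      by (subst (asm) ennreal_mult_le_mult_iff) auto
  qed
  have "(\<Sum>P\<in>J. emeasure (weighted M v) (star P)) \<le> (\<Sum>P\<in>J. ennreal (2 * cd) * (\<integral>\<^sup>+x\<in>E P. ?Mv x \<partial>M))"
    by (rule sum_mono) (rule one)
  also have "\<dots> = ennreal (2 * cd) * (\<Sum>P\<in>J. \<integral>\<^sup>+x\<in>E P. ?Mv x \<partial>M)" by (simp add: sum_distrib_left)
  also have "(\<Sum>P\<in>J. \<integral>\<^sup>+x\<in>E P. ?Mv x \<partial>M) = (\<integral>\<^sup>+x. (\<Sum>P\<in>J. ?Mv x * indicator (E P) x) \<partial>M)"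
    by (rule nn_integral_sum[symmetric]) (use Em in auto)
  also have "\<dots> \<le> (\<integral>\<^sup>+x\<in>Q. ?Mv x \<partial>M)"
  proof (rule nn_integral_mono)
    fix x
    show "(\<Sum>P\<in>J. ?Mv x * indicator (E P) x) \<le> ?Mv x * indicator Q x"
    proof -
      have "(\<Sum>P\<in>J. ?Mv x * indicator (E P) x) = ?Mv x * indicator (\<Union>P\<in>J. E P) x"
        using indicator_UN_disjoint[OF J(1) E(1), of x, where ?'c = ennreal] by (simp add: sum_distrib_left)
      moreover have "(\<Union>P\<in>J. E P) \<subseteq> Q"
      proof (rule UN_least)
        fix P assume P: "P \<in> J"
        then have "P \<subseteq> star P" using J(2) by (intro cube_subset_star) auto
        then show "E P \<subseteq> Q" using E(2)[OF P] J(3)[OF P] by blast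
      qed
      ultimately show ?thesis by (auto split: split_indicator)
    qed
  qed
  also have "\<dots> \<le> Ainf_const M S v * emeasure (weighted M v) Q" by (rule Ainf_bound[OF v Q fin])
  finally show ?thesis by (simp add: mult_left_mono)
qed

end

section \<open>The measures of an A2 weight and its dual, and finite sparse sums\<close>

locale cz_weight = cz_space M \<rho> \<kappa> D S \<delta> C0 \<epsilon> A T K \<eta> CK Bn
  for M :: "'a measure" and \<rho> \<kappa> D S \<delta> C0 \<epsilon> A T K \<eta> CK Bn +
  fixes w :: "'a \<Rightarrow> real"
  assumes A2w: "A2_weight M \<rho> S w"
    and Ainf_w: "Ainf_const M S w < \<infinity>" and Ainf_s: "Ainf_const M S (\<lambda>x. inverse (w x)) < \<infinity>"
begin

definition "\<sigma> = (\<lambda>x. inverse (w x))"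
definition "N1 = weighted M \<sigma>"
definition "N2 = weighted M w"
definition "a2 = enn2real (A2_const M S w)"
definition "ainf = enn2real (Ainf_const M S w + Ainf_const M S \<sigma>)"

lemma w_weight: "weight M \<rho> w"
  using A2w by (simp add: A2_weight_def)

lemma w_meas [measurable]: "w \<in> borel_measurable M" and w_pos: "AE x in M. 0 < w x"
  using w_weight by (auto simp: weight_def)

lemma s_meas [measurable]: "\<sigma> \<in> borel_measurable M"
  unfolding \<sigma>_def by measurable

lemma s_pos: "AE x in M. 0 < \<sigma> x"
  using w_pos by eventually_elim (simp add: \<sigma>_def)

lemma sets_N [measurable_cong, simp]: "sets N1 = sets M" "sets N2 = sets M"
  by (auto simp: N1_def N2_def weighted_def)

lemma space_N [simp]: "space N1 = space M" "space N2 = space M"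
  by (auto simp: N1_def N2_def weighted_def)

lemma a2_nonneg: "0 \<le> a2" and ainf_nonneg: "0 \<le> ainf"
  by (auto simp: a2_def ainf_def)

lemma A2_eq: "A2_const M S w = ennreal a2"
  using A2w by (simp add: a2_def A2_weight_def less_top)

lemma Ainf_le: "Ainf_const M S w \<le> ennreal ainf" "Ainf_const M S \<sigma> \<le> ennreal ainf"
proof -
  have "ennreal ainf = Ainf_const M S w + Ainf_const M S \<sigma>"
    using Ainf_w Ainf_s by (simp add: ainf_def \<sigma>_def less_top)
  then show "Ainf_const M S w \<le> ennreal ainf" "Ainf_const M S \<sigma> \<le> ennreal ainf" by auto
qed

lemma N2_finite: "Q \<in> cubes S \<Longrightarrow> emeasure N2 Q < \<infinity>"
proof -
  assume Q: "Q \<in> cubes S"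
  have "emeasure N2 Q = (\<integral>\<^sup>+x\<in>Q. ennreal (w x) \<partial>M)"
    unfolding N2_def by (rule emeasure_weighted[OF w_meas adj_sets[OF Q]])
  also have "\<dots> \<le> (\<integral>\<^sup>+x. ennreal (norm (w x * indicator Q x)) \<partial>M)"
    by (intro nn_integral_mono) (auto split: split_indicator intro!: ennreal_leI)
  also have "\<dots> < \<infinity>" using weight_cube_integrable[OF w_weight Q] by (simp add: integrable_iff_bounded)
  finally show ?thesis .
qed

lemma N_pos: "Q \<in> cubes S \<Longrightarrow> 0 < emeasure N1 Q" "Q \<in> cubes S \<Longrightarrow> 0 < emeasure N2 Q"
  unfolding N1_def N2_def
  by (rule emeasure_weighted_pos[OF s_meas s_pos], assumption, rule emeasure_weighted_pos[OF w_meas w_pos], assumption)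

lemma N1N2: "Q \<in> cubes S \<Longrightarrow> emeasure N2 Q * emeasure N1 Q \<le> ennreal a2 * (emeasure M Q * emeasure M Q)"
proof -
  assume Q: "Q \<in> cubes S"
  have m: "emeasure M Q \<noteq> 0" "emeasure M Q \<noteq> top"
    using adj_measure_pos[OF Q] by (auto simp: adj_emeasure[OF Q])
  have "(\<integral>\<^sup>+x\<in>Q. ennreal (w x) \<partial>M) / emeasure M Q * ((\<integral>\<^sup>+x\<in>Q. ennreal (inverse (w x)) \<partial>M) / emeasure M Q) \<le> A2_const M S w"
    unfolding A2_const_def by (rule SUP_upper[OF Q])
  then have "emeasure N2 Q / emeasure M Q * (emeasure N1 Q / emeasure M Q) \<le> ennreal a2"
    unfolding A2_eq N1_def N2_def emeasure_weighted[OF w_meas adj_sets[OF Q]]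
      emeasure_weighted[OF s_meas adj_sets[OF Q]] unfolding \<sigma>_def .
  then have "emeasure N2 Q / emeasure M Q * (emeasure N1 Q / emeasure M Q) * (emeasure M Q * emeasure M Q)
      \<le> ennreal a2 * (emeasure M Q * emeasure M Q)" by (rule mult_right_mono) auto
  moreover have "emeasure N2 Q / emeasure M Q * (emeasure N1 Q / emeasure M Q) * (emeasure M Q * emeasure M Q)
      = (emeasure N2 Q / emeasure M Q * emeasure M Q) * (emeasure N1 Q / emeasure M Q * emeasure M Q)"
    by (simp only: mult_ac)
  moreover have "y / emeasure M Q * emeasure M Q = y" for y
    using m by (simp add: ennreal_divide_times ennreal_divide_self less_top[symmetric])
  ultimately show ?thesis by (simp only:)
qed

text \<open>Local integrability of \<open>\<sigma>\<close> is a consequence of the A2 condition: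
  \<open>w\<close> has positive mass on \<open>Q\<close>, so infinite mass of
  \<open>\<sigma>\<close> would make the product infinite.\<close>

lemma N1_finite: "Q \<in> cubes S \<Longrightarrow> emeasure N1 Q < \<infinity>"
proof (rule ccontr)
  assume Q: "Q \<in> cubes S" and "\<not> emeasure N1 Q < \<infinity>"
  then have "emeasure N2 Q * emeasure N1 Q = \<infinity>" using N_pos(2)[OF Q] by (auto simp: less_top ennreal_mult_eq_top_iff)
  then have "ennreal a2 * (emeasure M Q * emeasure M Q) = \<infinity>" using N1N2[OF Q] by (auto simp: top_unique)
  moreover have "ennreal a2 * (emeasure M Q * emeasure M Q) = ennreal (a2 * (mu Q * mu Q))"
    using a2_nonneg by (simp add: adj_emeasure[OF Q] flip: ennreal_mult)
  ultimately show False by simp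
qed

lemma N_fmeasurable: "Q \<in> cubes S \<Longrightarrow> Q \<in> fmeasurable N1" "Q \<in> cubes S \<Longrightarrow> Q \<in> fmeasurable N2"
  using N1_finite N2_finite adj_sets by (auto intro!: fmeasurableI)

lemma N_emeasure:
  "Q \<in> cubes S \<Longrightarrow> emeasure N1 Q = ennreal (measure N1 Q)" "Q \<in> cubes S \<Longrightarrow> emeasure N2 Q = ennreal (measure N2 Q)"
  using N_fmeasurable by (auto intro: emeasure_eq_measure2)

lemma N_measure_pos: "Q \<in> cubes S \<Longrightarrow> 0 < measure N1 Q" "Q \<in> cubes S \<Longrightarrow> 0 < measure N2 Q"
  using N_pos[of Q] by (auto simp: N_emeasure)

lemma N_measure_A2: "Q \<in> cubes S \<Longrightarrow> measure N1 Q * measure N2 Q \<le> a2 * (mu Q)^2"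
proof -
  assume Q: "Q \<in> cubes S"
  have "ennreal (measure N2 Q * measure N1 Q) \<le> ennreal (a2 * (mu Q * mu Q))"
    using N1N2[OF Q] a2_nonneg by (simp add: N_emeasure[OF Q] adj_emeasure[OF Q] flip: ennreal_mult)
  then have "measure N2 Q * measure N1 Q \<le> a2 * (mu Q * mu Q)"
    using a2_nonneg by (subst (asm) ennreal_le_iff) auto
  then show ?thesis by (simp add: power2_eq_square mult.commute)
qed

lemma carleson_measures:
  assumes Q: "Q \<in> cubes S"
    and J: "finite J" "J \<subseteq> cubes S" "\<And>P. P \<in> J \<Longrightarrow> star P \<subseteq> Q"
    and sparse: "sparse_family E J"
  shows "(\<Sum>P\<in>J. mu (star P)) \<le> 2 * cd * mu Q"
    "(\<Sum>P\<in>J. measure N1 (star P)) \<le> 2 * cd * ainf * measure N1 Q"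
    "(\<Sum>P\<in>J. measure N2 (star P)) \<le> 2 * cd * ainf * measure N2 Q"
proof -
  note E = sparse_familyD[OF sparse]
  have sc: "star P \<in> cubes S" if "P \<in> J" for P using star_cube J(2) that by auto
  have Ef: "E P \<in> fmeasurable M" if "P \<in> J" for P
    using E(2)[OF that] adj_fmeasurable[of P] J(2) that by (auto intro: fmeasurableI2)
  have "(\<Sum>P\<in>J. mu (star P)) \<le> (\<Sum>P\<in>J. 2 * cd * mu (E P))"
  proof (rule sum_mono)
    fix P assume P: "P \<in> J"
    have "mu (star P) \<le> cd * mu P" using star_measure[of P] J(2) P by auto
    also have "\<dots> \<le> cd * (2 * mu (E P))" using E(2)[OF P] cd_pos by (intro mult_left_mono) auto
    finally show "mu (star P) \<le> 2 * cd * mu (E P)" by simp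
  qed
  also have "\<dots> = 2 * cd * (\<Sum>P\<in>J. mu (E P))" by (simp add: sum_distrib_left)
  also have "(\<Sum>P\<in>J. mu (E P)) = mu (\<Union>P\<in>J. E P)"
  proof (rule measure_UNION'[symmetric, OF J(1) Ef])
    show "pairwise (\<lambda>P P'. disjnt (E P) (E P')) J"
      using E(1) by (auto simp: pairwise_def disjnt_def disjoint_family_on_def)
  qed
  also have "2 * cd * mu (\<Union>P\<in>J. E P) \<le> 2 * cd * mu Q"
  proof (rule mult_left_mono[OF measure_mono_fmeasurable])
    show "(\<Union>P\<in>J. E P) \<subseteq> Q" using E(2) J(2,3) cube_subset_star by blast
    show "(\<Union>P\<in>J. E P) \<in> sets M" using Ef J(1) by auto
  qed (use adj_fmeasurable[OF Q] cd_pos in auto)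
  finally show "(\<Sum>P\<in>J. mu (star P)) \<le> 2 * cd * mu Q" .
  have gen: "(\<Sum>P\<in>J. measure N (star P)) \<le> 2 * cd * ainf * measure N Q"
    if N: "N = weighted M v" and v: "v \<in> borel_measurable M" "AE x in M. 0 < v x"
      and em: "\<And>Q. Q \<in> cubes S \<Longrightarrow> emeasure N Q = ennreal (measure N Q)" and Ai: "Ainf_const M S v \<le> ennreal ainf"
    for N v
  proof -
    have "ennreal (\<Sum>P\<in>J. measure N (star P)) = (\<Sum>P\<in>J. emeasure N (star P))"
      by (simp add: em[OF sc])
    also have "\<dots> \<le> ennreal (2 * cd) * (Ainf_const M S v * emeasure (weighted M v) Q)"
      unfolding N by (rule carleson_weight[OF v Q _ J sparse]) (use em[OF Q] N in auto)
    also have "\<dots> \<le> ennreal (2 * cd) * (ennreal ainf * emeasure (weighted M v) Q)"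
      using Ai by (intro mult_left_mono mult_right_mono) auto
    also have "\<dots> = ennreal (2 * cd * ainf * measure N Q)"
      using em[OF Q] cd_pos ainf_nonneg by (simp add: N mult.assoc flip: ennreal_mult)
    finally show ?thesis using cd_pos ainf_nonneg by (subst (asm) ennreal_le_iff) auto
  qed
  show "(\<Sum>P\<in>J. measure N1 (star P)) \<le> 2 * cd * ainf * measure N1 Q"
    by (rule gen[OF N1_def s_meas s_pos N_emeasure(1) Ainf_le(2)])
  show "(\<Sum>P\<in>J. measure N2 (star P)) \<le> 2 * cd * ainf * measure N2 Q"
    by (rule gen[OF N2_def w_meas w_pos N_emeasure(2) Ainf_le(1)])
qed

text \<open>The substitution \<open>\<bar>f\<bar> * w\<close> turns integrals of
  \<open>\<bar>f\<bar>\<close> against \<open>M\<close> into integrals against \<open>N1\<close> and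
  preserves the norm, because the product of \<open>w\<close> and \<open>\<sigma>\<close> is 1
  almost everywhere.\<close>

lemma N1_transfer:
  assumes f[measurable]: "f \<in> borel_measurable M" and f2: "integrable N2 (\<lambda>x. (f x)^2)"
  shows "integrable N1 (\<lambda>x. (\<bar>f x\<bar> * w x)^2)"
    "(LINT x|N1. (\<bar>f x\<bar> * w x)^2) = (LINT x|N2. (f x)^2)"
    "Q \<in> sets M \<Longrightarrow> integrable M (\<lambda>x. \<bar>f x\<bar> * indicator Q x) \<Longrightarrow>
      integrable N1 (\<lambda>x. \<bar>f x\<bar> * w x * indicator Q x)"
    "Q \<in> sets M \<Longrightarrow> (LINT x|N1. \<bar>f x\<bar> * w x * indicator Q x) = (LINT x|M. \<bar>f x\<bar> * indicator Q x)"
proof -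
  have snn: "AE x in M. 0 \<le> \<sigma> x" and wnn: "AE x in M. 0 \<le> w x"
    using s_pos w_pos by (auto elim: eventually_mono)
  have e1: "AE x in M. \<sigma> x *\<^sub>R (\<bar>f x\<bar> * w x)^2 = w x *\<^sub>R (f x)^2"
    using w_pos by eventually_elim (simp add: \<sigma>_def power_mult_distrib power2_eq_square field_simps)
  have e2: "AE x in M. \<sigma> x *\<^sub>R (\<bar>f x\<bar> * w x * indicator Q x) = \<bar>f x\<bar> * indicator Q x" for Q
    using w_pos by eventually_elim (simp add: \<sigma>_def field_simps)
  have "integrable M (\<lambda>x. w x *\<^sub>R (f x)^2)"
    using f2 unfolding N2_def weighted_def by (subst (asm) integrable_density) (use wnn in auto)
  then have "integrable M (\<lambda>x. \<sigma> x *\<^sub>R (\<bar>f x\<bar> * w x)^2)"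
    by (subst integrable_cong_AE[OF _ _ e1]) auto
  then show "integrable N1 (\<lambda>x. (\<bar>f x\<bar> * w x)^2)"
    unfolding N1_def weighted_def by (subst integrable_density) (use snn in auto)
  have "(LINT x|N1. (\<bar>f x\<bar> * w x)^2) = (LINT x|M. \<sigma> x *\<^sub>R (\<bar>f x\<bar> * w x)^2)"
    unfolding N1_def weighted_def by (rule integral_density) (use snn in auto)
  also have "\<dots> = (LINT x|M. w x *\<^sub>R (f x)^2)" by (rule integral_cong_AE[OF _ _ e1]) auto
  also have "\<dots> = (LINT x|N2. (f x)^2)"
    unfolding N2_def weighted_def by (rule integral_density[symmetric]) (use wnn in auto)
  finally show "(LINT x|N1. (\<bar>f x\<bar> * w x)^2) = (LINT x|N2. (f x)^2)" .
  assume Q[measurable]: "Q \<in> sets M"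
  show "(LINT x|N1. \<bar>f x\<bar> * w x * indicator Q x) = (LINT x|M. \<bar>f x\<bar> * indicator Q x)"
  proof -
    have "(LINT x|N1. \<bar>f x\<bar> * w x * indicator Q x) = (LINT x|M. \<sigma> x *\<^sub>R (\<bar>f x\<bar> * w x * indicator Q x))"
      unfolding N1_def weighted_def by (rule integral_density) (use snn in auto)
    also have "\<dots> = (LINT x|M. \<bar>f x\<bar> * indicator Q x)" by (rule integral_cong_AE[OF _ _ e2]) auto
    finally show ?thesis .
  qed
  assume i: "integrable M (\<lambda>x. \<bar>f x\<bar> * indicator Q x)"
  then have "integrable M (\<lambda>x. \<sigma> x *\<^sub>R (\<bar>f x\<bar> * w x * indicator Q x))"
    by (subst integrable_cong_AE[OF _ _ e2]) auto
  then show "integrable N1 (\<lambda>x. \<bar>f x\<bar> * w x * indicator Q x)"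
    unfolding N1_def weighted_def by (subst integrable_density) (use snn in auto)
qed

text \<open>The factors are 2 from absorption, the number of systems, the constants 64,
  \<open>2 * cd\<close> and \<open>2 * cd\<close> of the bilinear bound, and the parameter
  \<open>t\<close> used there.\<close>

definition "sparse_const = 2 * card S * 64 * (2 * cd) * (2 * cd) * (256 * real (card S))"

text \<open>The sum is paired with itself, so the square integral to be bounded reappears on the
  right with a small factor. Integrability is proved beforehand, from finiteness of the family, to
  make the absorption meaningful.\<close>

lemma finite_sparse_bound:
  assumes f: "f \<in> L2_space M" "integrable N2 (\<lambda>x. (f x)^2)"
    and I: "finite I" "I \<subseteq> cubes S"
    and sparse: "sparse_family E I"
  shows "integrable N2 (\<lambda>x. (\<Sum>P\<in>I. avg f P * indicator P x)^2) \<and>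
    (LINT x|N2. (\<Sum>P\<in>I. avg f P * indicator P x)^2) \<le> sparse_const * a2 * ainf * (LINT x|N2. (f x)^2)"
proof -
  define g where "g x = (\<Sum>P\<in>I. avg f P * indicator P x)" for x
  have fm[measurable]: "f \<in> borel_measurable M" using f by (simp add: L2_space_iff)
  have Is: "P \<in> sets M" "P \<in> cubes S" "P \<in> fmeasurable N2" "star P \<in> cubes S" "star P \<in> sets M" if "P \<in> I" for P
    using that I(2) adj_sets N_fmeasurable star_cube by auto
  have gm[measurable]: "g \<in> borel_measurable M" unfolding g_def using Is by auto
  have g0: "0 \<le> g x" for x unfolding g_def using avg_nonneg by (intro sum_nonneg mult_nonneg_nonneg) auto
  have g2: "(g x)^2 = (\<Sum>P\<in>I. \<Sum>Q\<in>I. avg f P * avg f Q * indicator (P \<inter> Q) x)" for x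
    unfolding g_def power2_eq_square sum_product by (intro sum.cong) (auto simp: indicator_def)
  have ig2: "integrable N2 (\<lambda>x. (g x)^2)" unfolding g2
  proof (intro Bochner_Integration.integrable_sum)
    fix P Q assume "P \<in> I" "Q \<in> I"
    then have "P \<inter> Q \<in> fmeasurable N2" using Is by (intro fmeasurable.Int) auto
    then show "integrable N2 (\<lambda>x. avg f P * avg f Q * indicator (P \<inter> Q) x)" by (auto simp: fmeasurable_def)
  qed
  have ig: "integrable N2 (\<lambda>x. g x * indicator Q x)" if Q: "Q \<in> sets M" for Q
  proof (rule integrable_real_mult_indicator)
    show "integrable N2 g" unfolding g_def
      using Is by (intro Bochner_Integration.integrable_sum) (auto simp: fmeasurable_def)
  qed (use Q in simp)
  define \<phi> where "\<phi> x = \<bar>f x\<bar> * w x" for x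
  define V where "V = (LINT x|N2. (f x)^2)"
  define G where "G = (LINT x|N2. (g x)^2)"
  have V0: "0 \<le> V" and G0: "0 \<le> G" by (auto simp: V_def G_def)
  have fi: "integrable M (\<lambda>x. \<bar>f x\<bar> * indicator (star P) x)" if "P \<in> I" for P
    using integrable_abs[OF loc_integrable[OF f(1) Is(2)[OF that]]] by (simp add: loc_def abs_mult)
  define u where "u P = (LINT x|N1. \<phi> x * indicator (star P) x) * (LINT x|N2. g x * indicator (star P) x) / mu (star P)" for P
  have phiI: "(LINT x|N1. \<phi> x * indicator (star P) x) = (LINT x|M. \<bar>f x\<bar> * indicator (star P) x)" if "P \<in> I" for P
    unfolding \<phi>_def by (rule N1_transfer(4)[OF fm f(2) Is(5)[OF that]])
  have u0: "0 \<le> u P" if "P \<in> I" for P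
    unfolding u_def phiI[OF that] using g0 by (intro divide_nonneg_nonneg mult_nonneg_nonneg integral_nonneg) auto
  have "G = (\<Sum>P\<in>I. avg f P * (LINT x|N2. g x * indicator P x))"
  proof -
    have "(g x)^2 = (\<Sum>P\<in>I. avg f P * (g x * indicator P x))" for x
      unfolding power2_eq_square by (subst (2) g_def) (simp add: sum_distrib_left mult_ac)
    then have "G = (LINT x|N2. (\<Sum>P\<in>I. avg f P * (g x * indicator P x)))" by (simp add: G_def)
    also have "\<dots> = (\<Sum>P\<in>I. LINT x|N2. avg f P * (g x * indicator P x))"
      by (rule Bochner_Integration.integral_sum) (use ig Is in auto)
    finally show ?thesis by simp
  qed
  also have "\<dots> \<le> (\<Sum>P\<in>I. u P)"
  proof (rule sum_mono)
    fix P assume P: "P \<in> I"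
    \<comment> \<open>Since \<open>g\<close> is nonnegative, enlarging the domain puts both
      integrals on the same cube.\<close>
    have "(LINT x|N2. g x * indicator P x) \<le> (LINT x|N2. g x * indicator (star P) x)"
      using ig Is[OF P] g0 cube_subset_star[OF Is(2)[OF P]]
      by (intro integral_mono) (auto simp: indicator_def)
    then have "avg f P * (LINT x|N2. g x * indicator P x) \<le> avg f P * (LINT x|N2. g x * indicator (star P) x)"
      using avg_nonneg by (rule mult_left_mono)
    then show "avg f P * (LINT x|N2. g x * indicator P x) \<le> u P"
      unfolding u_def phiI[OF P] by (simp add: avg_def)
  qed
  \<comment> \<open>The enlarged cubes are nested only within a single system; those in several
    systems are counted repeatedly, which is harmless.\<close>
  also have "\<dots> \<le> (\<Sum>P\<in>I. \<Sum>\<D>\<in>S. if star P \<in> dyadic_space.\<Q> \<D> then u P else 0)"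
  proof (rule sum_mono)
    fix P assume P: "P \<in> I"
    obtain \<D> where \<D>: "\<D> \<in> S" "star P \<in> dyadic_space.\<Q> \<D>" using Is(4)[OF P] cubes_eq by auto
    have "u P = (if star P \<in> dyadic_space.\<Q> \<D> then u P else 0)" using \<D> by simp
    also have "\<dots> \<le> (\<Sum>\<D>\<in>S. if star P \<in> dyadic_space.\<Q> \<D> then u P else 0)"
      by (rule member_le_sum[OF \<D>(1)]) (use u0[OF P] finite_S in auto)
    finally show "u P \<le> (\<Sum>\<D>\<in>S. if star P \<in> dyadic_space.\<Q> \<D> then u P else 0)" .
  qed
  also have "\<dots> = (\<Sum>\<D>\<in>S. \<Sum>P\<in>I. if star P \<in> dyadic_space.\<Q> \<D> then u P else 0)" by (rule sum.swap)
  finally have Gle: "G \<le> (\<Sum>\<D>\<in>S. \<Sum>P\<in>I. if star P \<in> dyadic_space.\<Q> \<D> then u P else 0)" .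
  define n where "n = real (card S)"
  \<comment> \<open>Chosen so that the \<open>n\<close> systems together contribute half of
    \<open>G\<close>.\<close>
  define t where "t = 256 * n"
  have each: "(\<Sum>P\<in>I. if star P \<in> dyadic_space.\<Q> \<D> then u P else 0) \<le>
      64 * a2 * (2 * cd) * (2 * cd * ainf) * t * V + 128 / t * G" if \<D>: "\<D> \<in> S" for \<D>
  proof -
    interpret dyadic_space M \<rho> \<kappa> D \<D> \<delta> C0 \<epsilon> by (rule dyadic_S[OF \<D>])
    have "0 < card S" using \<D> finite_S by (auto simp: card_gt_0_iff)
    then have n: "0 < n" by (simp add: n_def)
    then have t: "0 < t" by (simp add: t_def)
    \<comment> \<open>The principal sets need positive averages for their logarithms; the omitted
      terms vanish.\<close>
    define J where "J = {P \<in> I. star P \<in> \<Q> \<and> 0 < (LINT x|N1. \<phi> x * indicator (star P) x) \<and>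
      0 < (LINT x|N2. g x * indicator (star P) x)}"
    have J: "finite J" "J \<subseteq> I" using I by (auto simp: J_def)
    have "(\<Sum>P\<in>I. if star P \<in> \<Q> then u P else 0) = (\<Sum>P\<in>J. u P)"
    proof (rule sum.mono_neutral_cong_right[OF I(1) J(2)])
      show "\<forall>P\<in>I - J. (if star P \<in> \<Q> then u P else 0) = 0"
      proof
        fix P assume P: "P \<in> I - J"
        have "0 \<le> (LINT x|N1. \<phi> x * indicator (star P) x)" using P by (subst phiI) auto
        moreover have "0 \<le> (LINT x|N2. g x * indicator (star P) x)" by (intro Bochner_Integration.integral_nonneg mult_nonneg_nonneg g0) auto
        moreover have "star P \<in> \<Q> \<Longrightarrow> \<not> (0 < (LINT x|N1. \<phi> x * indicator (star P) x) \<and>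
            0 < (LINT x|N2. g x * indicator (star P) x))"
          using P by (simp add: J_def)
        ultimately have "star P \<in> \<Q> \<Longrightarrow> (LINT x|N1. \<phi> x * indicator (star P) x) = 0 \<or>
            (LINT x|N2. g x * indicator (star P) x) = 0"
          by linarith
        then show "(if star P \<in> \<Q> then u P else 0) = 0" unfolding u_def by auto
      qed
    qed (auto simp: J_def)
    also have "\<dots> \<le> 64 * a2 * (2 * cd) * (2 * cd * ainf) * t * V + 128 / t * G"
    proof (cases "J = {}")
      case True
      then show ?thesis using a2_nonneg cd_pos ainf_nonneg t V0 G0 by simp
    next
      case False
      then obtain P0 where P0: "P0 \<in> J" by auto
      have car: "(\<Sum>P | P \<in> J \<and> star P \<subseteq> star Q. mu (star P)) \<le> 2 * cd * mu (star Q)"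
        "(\<Sum>P | P \<in> J \<and> star P \<subseteq> star Q. measure N1 (star P)) \<le> 2 * cd * ainf * measure N1 (star Q)"
        "(\<Sum>P | P \<in> J \<and> star P \<subseteq> star Q. measure N2 (star P)) \<le> 2 * cd * ainf * measure N2 (star Q)" if Q: "Q \<in> J" for Q
      proof -
        have 1: "star Q \<in> cubes S" using Is J Q by auto
        have 2: "finite {P. P \<in> J \<and> star P \<subseteq> star Q}" "{P. P \<in> J \<and> star P \<subseteq> star Q} \<subseteq> cubes S"
            "\<And>P. P \<in> {P. P \<in> J \<and> star P \<subseteq> star Q} \<Longrightarrow> star P \<subseteq> star Q"
          using J I by auto
        have 3: "sparse_family E {P. P \<in> J \<and> star P \<subseteq> star Q}"
          by (rule sparse_family_subset[OF sparse]) (use J in auto)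
        show "(\<Sum>P | P \<in> J \<and> star P \<subseteq> star Q. mu (star P)) \<le> 2 * cd * mu (star Q)"
          by (rule carleson_measures(1)[OF 1 2 3])
        show "(\<Sum>P | P \<in> J \<and> star P \<subseteq> star Q. measure N1 (star P)) \<le> 2 * cd * ainf * measure N1 (star Q)"
          by (rule carleson_measures(2)[OF 1 2 3])
        show "(\<Sum>P | P \<in> J \<and> star P \<subseteq> star Q. measure N2 (star P)) \<le> 2 * cd * ainf * measure N2 (star Q)"
          by (rule carleson_measures(3)[OF 1 2 3])
      qed
      have sJ: "star P \<in> cubes S" "P \<in> I" if "P \<in> J" for P using that J Is by auto
      \<comment> \<open>The bilinear bound demands positive constants; a cube in \<open>J\<close>
        has positive mass for both measures and supplies them.\<close>
      have a2p: "0 < a2"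
      proof -
        have "0 < measure N1 (star P0) * measure N2 (star P0)"
          using N_measure_pos sJ[OF P0] by (intro mult_pos_pos) auto
        also have "\<dots> \<le> a2 * (mu (star P0))^2" by (rule N_measure_A2[OF sJ(1)[OF P0]])
        finally show ?thesis by (simp add: zero_less_mult_iff)
      qed
      have ap: "0 < 2 * cd * ainf"
      proof -
        have "measure N1 (star P0) \<le> (\<Sum>P | P \<in> J \<and> star P \<subseteq> star P0. measure N1 (star P))"
          by (rule member_le_sum) (use J P0 in auto)
        also have "\<dots> \<le> 2 * cd * ainf * measure N1 (star P0)" by (rule car(2)[OF P0])
        finally have "0 < 2 * cd * ainf * measure N1 (star P0)" using N_measure_pos(1)[OF sJ(1)[OF P0]] by linarith
        then show ?thesis using N_measure_pos(1)[OF sJ(1)[OF P0]] by (simp add: zero_less_mult_iff)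
      qed
      interpret tw: two_weight N1 N2 J star "\<lambda>P. mu (star P)" \<phi> g a2 "2 * cd" "2 * cd * ainf"
      proof
        show "star P \<subseteq> star Q \<or> star Q \<subseteq> star P" if "P \<in> J" "Q \<in> J" "star P \<inter> star Q \<noteq> {}" for P Q
          using cube_nested[of "star P" "star Q"] that by (auto simp: J_def)
        show "integrable N1 (\<lambda>x. (\<phi> x)^2)" unfolding \<phi>_def by (rule N1_transfer(1)[OF fm f(2)])
        show "integrable N1 (\<lambda>x. \<phi> x * indicator (star P) x)" if "P \<in> J" for P
          unfolding \<phi>_def by (rule N1_transfer(3)[OF fm f(2) Is(5)[OF sJ(2)[OF that]] fi[OF sJ(2)[OF that]]])
        show "integrable N2 (\<lambda>x. g x * indicator (star P) x)" if "P \<in> J" for P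
          by (rule ig[OF Is(5)[OF sJ(2)[OF that]]])
      qed (use J car a2p ap cd_pos N_fmeasurable N_measure_pos N_measure_A2 adj_measure_pos sJ(1) ig2 in \<open>auto simp: J_def\<close>)
      have "(\<Sum>P\<in>J. u P) \<le> 64 * a2 * (2 * cd) * (2 * cd * ainf) * t * (LINT x|N1. (\<phi> x)^2) + 128 / t * G"
        unfolding u_def G_def by (rule tw.bilinear_bound[OF t])
      also have "(LINT x|N1. (\<phi> x)^2) = V" unfolding \<phi>_def V_def by (rule N1_transfer(2)[OF fm f(2)])
      finally show ?thesis .
    qed
    finally show ?thesis .
  qed
  have "G \<le> sparse_const * a2 * ainf * V"
  proof (cases "S = {}")
    case True
    then have "G \<le> 0" using Gle by simp
    moreover have "card S = 0" using True by simp
    then have "sparse_const = 0" by (simp add: sparse_const_def)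
    ultimately show ?thesis by simp
  next
    case False
    then have n: "0 < n" using finite_S by (auto simp: n_def card_gt_0_iff)
    have "G \<le> (\<Sum>\<D>\<in>S. 64 * a2 * (2 * cd) * (2 * cd * ainf) * t * V + 128 / t * G)"
      using Gle sum_mono[OF each] by (rule order_trans)
    also have "\<dots> = n * (64 * a2 * (2 * cd) * (2 * cd * ainf) * t * V) + n * (128 / t * G)"
      by (simp add: n_def distrib_left)
    also have "n * (128 / t * G) = G / 2" using n by (simp add: t_def)
    finally have "G \<le> 2 * (n * (64 * a2 * (2 * cd) * (2 * cd * ainf) * t * V))" by simp
    also have "\<dots> = sparse_const * a2 * ainf * V" by (simp add: sparse_const_def t_def n_def)
    finally show ?thesis .
  qed
  then show ?thesis using ig2 by (simp add: G_def V_def g_def)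
qed

end

lemma ennreal_sqrt_le: "a \<le> ennreal r \<Longrightarrow> ennreal_sqrt a \<le> ennreal (sqrt r)"
proof -
  assume a: "a \<le> ennreal r"
  then have t: "a \<noteq> \<infinity>" by (auto simp: top_unique)
  have "enn2real a \<le> max 0 r" using a t by (cases a) (auto simp: ennreal_le_iff2)
  then have "sqrt (enn2real a) \<le> sqrt (max 0 r)" by simp
  also have "\<dots> \<le> max 0 (sqrt r)" by (simp add: max_def)
  finally have "ennreal (sqrt (enn2real a)) \<le> ennreal (max 0 (sqrt r))" by (rule ennreal_leI)
  then show ?thesis using t by (simp add: ennreal_sqrt_def ennreal_max_0)
qed

section \<open>From finite sparse sums to the operator on the weighted space\<close>

context cz_weight
begin

lemma AE_N2: "AE x in M. P x \<Longrightarrow> AE x in N2. P x"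
  unfolding N2_def weighted_def by (subst AE_density) (auto elim: eventually_mono)

text \<open>An enumeration exhausts the family by finite subfamilies. The cubes used at any point
  form a finite set, hence lie in one of them, and monotone convergence carries over the uniform
  bound.\<close>

lemma sparse_weighted_bound:
  assumes f: "f \<in> L2_space M" "integrable N2 (\<lambda>x. (f x)^2)"
    and \<S>: "countable \<S>" "\<S> \<subseteq> cubes S"
    and sparse: "sparse_family E \<S>"
    and c: "0 \<le> c"
    and dom: "AE x in M. x \<in> Q \<longrightarrow> sparse_at c f \<S> h x"
  shows "(\<integral>\<^sup>+x\<in>Q. ennreal ((h x)^2) \<partial>N2) \<le>
    ennreal (c^2 * sparse_const * a2 * ainf * (LINT x|N2. (f x)^2))"
proof -
  define \<T> where "\<T> n = {P \<in> \<S>. to_nat_on \<S> P \<le> n}" for n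
  have fin: "finite (\<T> n)" for n
  proof (rule finite_imageD)
    show "finite (to_nat_on \<S> ` \<T> n)" by (rule finite_subset[of _ "{..n}"]) (auto simp: \<T>_def)
    show "inj_on (to_nat_on \<S>) (\<T> n)"
      using inj_on_to_nat_on[OF \<S>(1)] by (rule inj_on_subset) (auto simp: \<T>_def)
  qed
  have sub: "\<T> n \<subseteq> \<S>" "\<T> n \<subseteq> cubes S" for n using \<S>(2) by (auto simp: \<T>_def)
  define g where "g n x = (\<Sum>P\<in>\<T> n. avg f P * indicator P x)" for n x
  have g0: "0 \<le> g n x" for n x unfolding g_def using avg_nonneg by (intro sum_nonneg mult_nonneg_nonneg) auto
  have gm: "g n \<in> borel_measurable M" for n
    unfolding g_def using adj_sets[OF subsetD[OF sub(2)]]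
    by (intro borel_measurable_sum borel_measurable_times borel_measurable_indicator) auto
  have inc: "g n x \<le> g k x" if "n \<le> k" for n k x
    unfolding g_def using that fin avg_nonneg by (intro sum_mono2) (auto simp: \<T>_def)
  have bound: "(\<integral>\<^sup>+x. ennreal (c^2 * (g n x)^2) \<partial>N2) \<le>
      ennreal (c^2 * sparse_const * a2 * ainf * (LINT x|N2. (f x)^2))" for n
  proof -
    have b: "integrable N2 (\<lambda>x. (g n x)^2) \<and>
        (LINT x|N2. (g n x)^2) \<le> sparse_const * a2 * ainf * (LINT x|N2. (f x)^2)"
      unfolding g_def
      by (rule finite_sparse_bound[OF f fin sub(2) sparse_family_subset[OF sparse sub(1)]])
    then have "(\<integral>\<^sup>+x. ennreal (c^2 * (g n x)^2) \<partial>N2) = ennreal (c^2 * (LINT x|N2. (g n x)^2))"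
      by (subst nn_integral_eq_integral) auto
    also have "\<dots> \<le> ennreal (c^2 * (sparse_const * a2 * ainf * (LINT x|N2. (f x)^2)))"
      using b by (intro ennreal_leI mult_left_mono) auto
    finally show ?thesis by (simp add: mult.assoc)
  qed
  have "AE x in N2. ennreal ((h x)^2) * indicator Q x \<le> (SUP n. ennreal (c^2 * (g n x)^2))"
  proof (rule AE_N2, use dom in eventually_elim)
    fix x assume d: "x \<in> Q \<longrightarrow> sparse_at c f \<S> h x"
    show "ennreal ((h x)^2) * indicator Q x \<le> (SUP n. ennreal (c^2 * (g n x)^2))"
    proof (cases "x \<in> Q")
      case True
      then obtain H where H: "finite H" "H \<subseteq> \<S>" "\<forall>P\<in>H. x \<in> P" "\<bar>h x\<bar> \<le> c * (\<Sum>P\<in>H. avg f P)"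
        using d by (auto simp: sparse_at_def)
      define n where "n = Max (insert 0 (to_nat_on \<S> ` H))"
      have HT: "H \<subseteq> \<T> n"
      proof
        fix P assume P: "P \<in> H"
        then have "to_nat_on \<S> P \<le> n" unfolding n_def using H(1) by (intro Max_ge) auto
        then show "P \<in> \<T> n" using P H(2) by (auto simp: \<T>_def)
      qed
      have "(\<Sum>P\<in>H. avg f P) = (\<Sum>P\<in>H. avg f P * indicator P x)" using H(3) by (intro sum.cong) auto
      also have "\<dots> \<le> g n x" unfolding g_def using HT fin avg_nonneg by (intro sum_mono2) auto
      finally have "\<bar>h x\<bar> \<le> c * g n x" using H(4) c mult_left_mono by fastforce
      then have "\<bar>h x\<bar>^2 \<le> (c * g n x)^2" by (rule power_mono) simp
      then have "ennreal ((h x)^2) \<le> ennreal (c^2 * (g n x)^2)" by (intro ennreal_leI) (simp add: power_mult_distrib)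
      also have "\<dots> \<le> (SUP n. ennreal (c^2 * (g n x)^2))" by (rule SUP_upper) simp
      finally show ?thesis using True by simp
    qed simp
  qed
  then have "(\<integral>\<^sup>+x\<in>Q. ennreal ((h x)^2) \<partial>N2) \<le> (\<integral>\<^sup>+x. (SUP n. ennreal (c^2 * (g n x)^2)) \<partial>N2)"
    by (rule nn_integral_mono_AE)
  also have "\<dots> = (SUP n. \<integral>\<^sup>+x. ennreal (c^2 * (g n x)^2) \<partial>N2)"
  proof (rule nn_integral_monotone_convergence_SUP)
    show "incseq (\<lambda>n x. ennreal (c^2 * (g n x)^2))"
      unfolding incseq_def le_fun_def
      using inc g0 by (auto intro!: ennreal_leI mult_left_mono power_mono)
    show "(\<lambda>x. ennreal (c^2 * (g n x)^2)) \<in> borel_measurable N2" for n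
      using gm[of n] by simp
  qed
  also have "\<dots> \<le> ennreal (c^2 * sparse_const * a2 * ainf * (LINT x|N2. (f x)^2))"
    by (rule SUP_least) (rule bound)
  finally show ?thesis .
qed

text \<open>Support in \<open>Q\<close> makes \<open>loc f Q\<close> equal to \<open>f\<close>, so
  the sparse domination on \<open>Q\<close> speaks of \<open>T f\<close> itself.\<close>

lemma local_weighted_bound:
  assumes c: "dominates c" and f: "f \<in> L2_space M" "integrable N2 (\<lambda>x. (f x)^2)"
    and Q: "Q \<in> cubes S" "\<And>y. y \<notin> Q \<Longrightarrow> f y = 0"
  shows "(\<integral>\<^sup>+x\<in>Q. ennreal ((T f x)^2) \<partial>N2) \<le>
    ennreal (c^2 * sparse_const * a2 * ainf * (LINT x|N2. (f x)^2))"
proof -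
  obtain \<D> where \<D>: "\<D> \<in> S" "Q \<in> dyadic_space.\<Q> \<D>" using Q cubes_eq by auto
  interpret dyadic_space M \<rho> \<kappa> D \<D> \<delta> C0 \<epsilon> by (rule dyadic_S[OF \<D>(1)])
  have lf: "loc f Q = f"
    unfolding loc_def using Q(2) cube_subset_star[OF Q(1)] by (auto simp: indicator_def fun_eq_iff)
  obtain \<S> E where \<S>: "\<S> \<subseteq> \<Q>" "sparse_family E \<S>"
      "AE x in M. x \<in> Q \<longrightarrow> sparse_at c f \<S> (T (loc f Q)) x"
    using c[unfolded dominates_def, THEN conjunct2, rule_format, OF \<D>(1) f(1) \<D>(2)]
    by (elim exE conjE) (rule that)
  have "\<S> \<subseteq> cubes S" using \<S>(1) \<D>(1) cubes_eq by auto
  moreover have "countable \<S>" by (rule countable_subset[OF \<S>(1) countable_cubes])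
  moreover have "0 \<le> c" using c by (simp add: dominates_def)
  ultimately show ?thesis
    using \<S>(3) unfolding lf by (intro sparse_weighted_bound[OF f _ _ \<S>(2)])
qed

text \<open>Truncations of \<open>f\<close> to balls have global bounds, since any two concentric
  balls lie in a common cube. They converge to \<open>f\<close> in the unweighted space, where
  \<open>T\<close> is known to be continuous; a subsequence of their images converges almost
  everywhere, and Fatou gives the weighted bound.\<close>

lemma weighted_bound:
  assumes c: "dominates c" and f: "f \<in> L2_space M" "integrable N2 (\<lambda>x. (f x)^2)" and ne: "X \<noteq> {}"
  shows "(\<integral>\<^sup>+x. ennreal ((T f x)^2) \<partial>N2) \<le>
    ennreal (c^2 * sparse_const * a2 * ainf * (LINT x|N2. (f x)^2))"
proof -
  define R where "R = c^2 * sparse_const * a2 * ainf * (LINT x|N2. (f x)^2)"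
  obtain x0 where x0: "x0 \<in> X" using ne by auto
  define B where "B n = bl x0 (real n + 1)" for n
  have Bs[measurable]: "B n \<in> sets M" for n unfolding B_def using x0 by (intro ball_sets) auto
  have XB: "X = (\<Union>n. B n)" unfolding B_def by (rule space_eq_UN_balls[OF x0])
  have Binc: "n \<le> k \<Longrightarrow> B n \<subseteq> B k" for n k unfolding B_def by (intro ball_mono) simp
  have fm[measurable]: "f \<in> borel_measurable M" and fi: "integrable M (\<lambda>x. (f x)^2)"
    using f by (auto simp: L2_space_iff)
  define fn where "fn n = (\<lambda>x. f x * indicator (B n) x)" for n
  have fn2: "(fn n x)^2 = (f x)^2 * indicator (B n) x" for n x by (auto simp: fn_def indicator_def)
  have fnL: "fn n \<in> L2_space M" for n unfolding fn_def by (rule L2_space_indicator[OF f(1) Bs])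
  have Tm[measurable]: "T (fn n) \<in> borel_measurable M" "T f \<in> borel_measurable M" for n
    using T_L2[OF fnL[of n]] T_L2[OF f(1)] by (auto simp: L2_space_iff)
  have fnN: "integrable N2 (\<lambda>x. (fn n x)^2)" for n
    unfolding fn2 by (rule integrable_real_mult_indicator[OF _ f(2)]) simp
  have fn_le: "(LINT x|N2. (fn n x)^2) \<le> (LINT x|N2. (f x)^2)" for n
    by (rule integral_mono[OF fnN f(2)]) (auto simp: fn2 indicator_def)
  have k0: "0 \<le> c^2 * sparse_const * a2 * ainf"
    using a2_nonneg ainf_nonneg cd_pos unfolding sparse_const_def
    by (intro mult_nonneg_nonneg) auto
  have fn_bound: "(\<integral>\<^sup>+x. ennreal ((T (fn n) x)^2) \<partial>N2) \<le> ennreal R" for n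
  proof -
    have ge: "(\<integral>\<^sup>+x. ennreal ((T (fn n) x)^2) * indicator (B (n + k)) x \<partial>N2) \<le> ennreal R" for k
    proof -
      \<comment> \<open>One cube contains both the support of the truncation and the larger ball on
        which its image is estimated.\<close>
      obtain Q where Q: "Q \<in> cubes S" "B (n + k) \<subseteq> Q"
        using adjacent[OF x0, of "real (n + k) + 1"] unfolding B_def by auto
      have z: "fn n y = 0" if "y \<notin> Q" for y
        using that Q(2) Binc[of n "n + k"] by (auto simp: fn_def indicator_def)
      have "(\<integral>\<^sup>+x. ennreal ((T (fn n) x)^2) * indicator (B (n + k)) x \<partial>N2) \<le>
          (\<integral>\<^sup>+x\<in>Q. ennreal ((T (fn n) x)^2) \<partial>N2)"
        using Q by (intro nn_integral_mono) (auto split: split_indicator)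
      also have "\<dots> \<le> ennreal (c^2 * sparse_const * a2 * ainf * (LINT x|N2. (fn n x)^2))"
        by (rule local_weighted_bound[OF c fnL fnN Q(1) z])
      also have "\<dots> \<le> ennreal R"
        unfolding R_def using fn_le k0 by (intro ennreal_leI mult_left_mono) auto
      finally show ?thesis .
    qed
    have "(\<integral>\<^sup>+x. ennreal ((T (fn n) x)^2) \<partial>N2) \<le>
        (\<integral>\<^sup>+x. (SUP k. ennreal ((T (fn n) x)^2) * indicator (B (n + k)) x) \<partial>N2)"
    proof (rule nn_integral_mono)
      fix x assume "x \<in> space N2"
      then obtain j where "x \<in> B j" using XB by auto
      then have "x \<in> B (n + j)" using Binc[of j "n + j"] by auto
      then have "ennreal ((T (fn n) x)^2) = ennreal ((T (fn n) x)^2) * indicator (B (n + j)) x" by simp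
      also have "\<dots> \<le> (SUP k. ennreal ((T (fn n) x)^2) * indicator (B (n + k)) x)"
        by (rule SUP_upper) simp
      finally show "ennreal ((T (fn n) x)^2) \<le> (SUP k. ennreal ((T (fn n) x)^2) * indicator (B (n + k)) x)" .
    qed
    also have "\<dots> = (SUP k. \<integral>\<^sup>+x. ennreal ((T (fn n) x)^2) * indicator (B (n + k)) x \<partial>N2)"
    proof (rule nn_integral_monotone_convergence_SUP)
      show "incseq (\<lambda>k x. ennreal ((T (fn n) x)^2) * indicator (B (n + k)) x)"
        unfolding incseq_def le_fun_def
      proof (intro allI impI)
        fix i j :: nat and x assume "i \<le> j"
        then have "B (n + i) \<subseteq> B (n + j)" by (intro Binc) simp
        then show "ennreal ((T (fn n) x)^2) * indicator (B (n + i)) x \<le>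
            ennreal ((T (fn n) x)^2) * indicator (B (n + j)) x"
          by (auto split: split_indicator)
      qed
    qed simp
    also have "\<dots> \<le> ennreal R" by (rule SUP_least) (rule ge)
    finally show ?thesis .
  qed
  define en where "en n = (\<lambda>y. 1 * f y + (-1) * fn n y)" for n
  have enL: "en n \<in> L2_space M" for n unfolding en_def by (rule L2_space_add[OF f(1) fnL])
  have Ten: "AE x in M. T (en n) x = T f x - T (fn n) x" for n
    using T_linear[OF f(1) fnL[of n], of 1 "-1"] by (simp add: en_def)
  have "(\<lambda>n. LINT x|M. (en n x)^2) \<longlonglongrightarrow> (LINT x|M. 0)"
  proof (rule integral_dominated_convergence[where w = "\<lambda>y. (f y)^2"])
    show "AE x in M. (\<lambda>n. (en n x)^2) \<longlonglongrightarrow> 0"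
    proof (rule AE_I2)
      fix x assume "x \<in> X"
      then obtain j where j: "x \<in> B j" using XB by auto
      have "eventually (\<lambda>n. (en n x)^2 = 0) sequentially"
        using j Binc by (intro eventually_sequentiallyI[of j]) (auto simp: en_def fn_def indicator_def)
      then show "(\<lambda>n. (en n x)^2) \<longlonglongrightarrow> 0" by (rule tendsto_eventually)
    qed
    show "(\<lambda>x. (en n x)^2) \<in> borel_measurable M" for n using enL[of n] by (auto simp: L2_space_iff)
    show "AE x in M. norm ((en n x)^2) \<le> (f x)^2" for n
      by (rule AE_I2) (auto simp: en_def fn_def indicator_def)
  qed (use fi in auto)
  then have lim0: "(\<lambda>n. Bn * (LINT x|M. (en n x)^2)) \<longlonglongrightarrow> 0"
    using tendsto_mult_right_zero by fastforce
  have "(\<lambda>n. LINT x|M. norm ((T (en n) x)^2)) \<longlonglongrightarrow> 0"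
  proof (rule tendsto_sandwich[OF _ _ tendsto_const lim0])
    show "\<forall>\<^sub>F n in sequentially. (LINT x|M. norm ((T (en n) x)^2)) \<le> Bn * (LINT x|M. (en n x)^2)"
      using T_bound[OF enL] by simp
  qed simp
  moreover have "integrable M (\<lambda>x. (T (en n) x)^2)" for n
    using T_L2[OF enL[of n]] by (simp add: L2_space_iff)
  ultimately obtain r where r: "strict_mono (r :: nat \<Rightarrow> nat)" "AE x in M. (\<lambda>n. (T (en (r n)) x)^2) \<longlonglongrightarrow> 0"
    using tendsto_L1_AE_subseq[of M "\<lambda>n x. (T (en n) x)^2"] by blast
  have "AE x in M. \<forall>n. T (en n) x = T f x - T (fn n) x"
    using Ten by (subst AE_all_countable) blast
  with r(2) have conv: "AE x in M. (\<lambda>n. ennreal ((T (fn (r n)) x)^2)) \<longlonglongrightarrow> ennreal ((T f x)^2)"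
  proof eventually_elim
    fix x assume a: "(\<lambda>n. (T (en (r n)) x)^2) \<longlonglongrightarrow> 0" and b: "\<forall>n. T (en n) x = T f x - T (fn n) x"
    have "(\<lambda>n. sqrt ((T (en (r n)) x)^2)) \<longlonglongrightarrow> sqrt 0" by (rule tendsto_real_sqrt[OF a])
    then have "(\<lambda>n. T (en (r n)) x) \<longlonglongrightarrow> 0" by (simp add: tendsto_rabs_zero_iff)
    then have "(\<lambda>n. T f x - T (en (r n)) x) \<longlonglongrightarrow> T f x - 0" by (intro tendsto_diff tendsto_const)
    then have "(\<lambda>n. T (fn (r n)) x) \<longlonglongrightarrow> T f x" using b by simp
    then show "(\<lambda>n. ennreal ((T (fn (r n)) x)^2)) \<longlonglongrightarrow> ennreal ((T f x)^2)"
      by (intro tendsto_ennrealI tendsto_power)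
  qed
  have "(\<integral>\<^sup>+x. ennreal ((T f x)^2) \<partial>N2) = (\<integral>\<^sup>+x. liminf (\<lambda>n. ennreal ((T (fn (r n)) x)^2)) \<partial>N2)"
  proof (rule nn_integral_cong_AE, rule AE_N2, use conv in eventually_elim)
    fix x assume "(\<lambda>n. ennreal ((T (fn (r n)) x)^2)) \<longlonglongrightarrow> ennreal ((T f x)^2)"
    then show "ennreal ((T f x)^2) = liminf (\<lambda>n. ennreal ((T (fn (r n)) x)^2))"
      by (intro lim_imp_Liminf[symmetric]) auto
  qed
  also have "\<dots> \<le> liminf (\<lambda>n. \<integral>\<^sup>+x. ennreal ((T (fn (r n)) x)^2) \<partial>N2)"
    by (rule nn_integral_liminf) simp
  also have "\<dots> \<le> ennreal R"
    by (intro Liminf_le always_eventually allI fn_bound) auto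
  finally show ?thesis by (simp add: R_def)
qed

end

section \<open>Passage from the definitions to the locales, and the theorem\<close>

lemma homogeneous_type_locale:
  assumes "homogeneous_type M \<rho>"
  obtains \<kappa> D where "homogeneous_space M \<rho> \<kappa> D"
proof -
  have q: "quasimetric_on (space M) \<rho>" and b: "borel_regular M \<rho>" and d: "doubling_measure M \<rho>"
    using assms by (auto simp: homogeneous_type_def)
  obtain \<kappa>0 where \<kappa>0: "\<forall>x\<in>space M. \<forall>y\<in>space M. \<forall>z\<in>space M. \<rho> x z \<le> \<kappa>0 * (\<rho> x y + \<rho> y z)"
    using q unfolding quasimetric_on_def by (elim conjE exE) (rule that)
  have q': "0 \<le> \<rho> x y" "\<rho> x y = 0 \<longleftrightarrow> x = y" "\<rho> x y = \<rho> y x" if "x \<in> space M" "y \<in> space M" for x y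
  proof -
    have "\<forall>x\<in>space M. \<forall>y\<in>space M. 0 \<le> \<rho> x y \<and> (\<rho> x y = 0 \<longleftrightarrow> x = y) \<and> \<rho> x y = \<rho> y x"
      using q unfolding quasimetric_on_def by (rule conjunct1)
    then have "0 \<le> \<rho> x y \<and> (\<rho> x y = 0 \<longleftrightarrow> x = y) \<and> \<rho> x y = \<rho> y x" using that by simp
    then show "0 \<le> \<rho> x y" "\<rho> x y = 0 \<longleftrightarrow> x = y" "\<rho> x y = \<rho> y x" by auto
  qed
  obtain D0 :: real where D0: "\<forall>x\<in>space M. \<forall>r>0.
        qball (space M) \<rho> x r \<in> sets M \<and>
        0 < emeasure M (qball (space M) \<rho> x (2 * r)) \<and>
        emeasure M (qball (space M) \<rho> x (2 * r)) \<le> ennreal D0 * emeasure M (qball (space M) \<rho> x r) \<and>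
        emeasure M (qball (space M) \<rho> x r) < \<infinity>"
    using d unfolding doubling_measure_def by (elim exE) (rule that)
  have fm: "qball (space M) \<rho> x r \<in> fmeasurable M" if "x \<in> space M" "0 < r" for x r
    using D0 that by (auto intro: fmeasurableI)
  have "homogeneous_space M \<rho> (max 1 \<kappa>0) (max 0 D0)"
  proof
    fix x y z assume xyz: "x \<in> space M" "y \<in> space M" "z \<in> space M"
    have "\<rho> x z \<le> \<kappa>0 * (\<rho> x y + \<rho> y z)" using \<kappa>0 xyz by blast
    also have "\<dots> \<le> max 1 \<kappa>0 * (\<rho> x y + \<rho> y z)"
      using q'(1) xyz by (intro mult_right_mono add_nonneg_nonneg) auto
    finally show "\<rho> x z \<le> max 1 \<kappa>0 * (\<rho> x y + \<rho> y z)" .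
  next
    fix x and r :: real assume x: "x \<in> space M" "0 < r"
    show "qball (space M) \<rho> x r \<in> sets M" "emeasure M (qball (space M) \<rho> x r) < \<infinity>" using D0 x by auto
    \<comment> \<open>Positivity is stated for doubled radii, hence the radius
      \<open>r / 2\<close>.\<close>
    have "0 < emeasure M (qball (space M) \<rho> x (2 * (r / 2)))"
      using D0[rule_format, OF x(1), of "r / 2"] x(2) by simp
    then show "0 < measure M (qball (space M) \<rho> x r)"
      using emeasure_eq_measure2[OF fm[OF x]] by simp
    have "emeasure M (qball (space M) \<rho> x (2 * r)) \<le> ennreal (max 0 D0) * emeasure M (qball (space M) \<rho> x r)"
      using D0 x by (simp add: ennreal_max_0)
    then have "ennreal (measure M (qball (space M) \<rho> x (2 * r))) \<le> ennreal (max 0 D0 * measure M (qball (space M) \<rho> x r))"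
      using x fm by (simp add: emeasure_eq_measure2 ennreal_mult'')
    then show "measure M (qball (space M) \<rho> x (2 * r)) \<le> max 0 D0 * measure M (qball (space M) \<rho> x r)"
      by (subst (asm) ennreal_le_iff) auto
  qed (use q' b in auto)
  then show thesis by (rule that)
qed

lemma adjacent_locale:
  assumes "homogeneous_space M \<rho> \<kappa> D" "adjacent_dyadic_systems M \<rho> S"
  obtains \<delta> C0 \<epsilon> A where "adjacent_space M \<rho> \<kappa> D S \<delta> C0 \<epsilon> A"
proof -
  interpret homogeneous_space M \<rho> \<kappa> D by (rule assms)
  obtain \<delta> C0 \<epsilon> where d: "1 < \<delta>" "0 < C0" "0 < \<epsilon>" "\<epsilon> < 1" "\<forall>\<D>\<in>S. dyadic_decomposition M \<rho> \<delta> C0 \<epsilon> \<D>"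
    using assms(2) unfolding adjacent_dyadic_systems_def by (elim conjE exE) (rule that)
  obtain A where A: "\<forall>x\<in>space M. \<forall>r>0. \<exists>Q\<in>cubes S. bl x r \<subseteq> Q \<and> emeasure M Q \<le> ennreal A * emeasure M (bl x r)"
    using assms(2) unfolding adjacent_dyadic_systems_def by (elim conjE exE) (rule that)
  have "adjacent_space M \<rho> \<kappa> D S \<delta> C0 \<epsilon> (max 1 A)"
  proof (rule adjacent_space.intro[OF assms(1)], rule adjacent_space_axioms.intro)
    show "dyadic_space M \<rho> \<kappa> D \<D> \<delta> C0 \<epsilon>" if "\<D> \<in> S" for \<D>
      by unfold_locales (use d that in auto)
    show "finite S" using assms(2) by (simp add: adjacent_dyadic_systems_def)
    fix x and r :: real assume x: "x \<in> space M" "0 < r"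
    then obtain Q where Q: "Q \<in> cubes S" "bl x r \<subseteq> Q" "emeasure M Q \<le> ennreal A * emeasure M (bl x r)" using A by blast
    have "emeasure M Q \<le> ennreal (max 1 A) * emeasure M (bl x r)"
      using Q(3) by (rule order_trans) (intro mult_right_mono ennreal_leI, auto)
    also have "\<dots> = ennreal (max 1 A * mu (bl x r))"
      by (simp add: emeasure_eq_measure2[OF ball_fmeasurable[OF x]] ennreal_mult'')
    finally have le: "emeasure M Q \<le> ennreal (max 1 A * mu (bl x r))" .
    then have "enn2real (emeasure M Q) \<le> max 1 A * mu (bl x r)"
      by (intro enn2real_leI) auto
    then show "\<exists>Q\<in>cubes S. bl x r \<subseteq> Q \<and> mu Q \<le> max 1 A * mu (bl x r)"
      using Q by (auto simp: measure_def)
  qed (use d in auto)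
  then show thesis by (rule that)
qed

lemma cz_locale:
  assumes "adjacent_space M \<rho> \<kappa> D S \<delta> C0 \<epsilon> A" "cz_operator M \<rho> T"
  obtains K \<eta> CK Bn where "cz_space M \<rho> \<kappa> D S \<delta> C0 \<epsilon> A T K \<eta> CK Bn"
proof -
  interpret adjacent_space M \<rho> \<kappa> D S \<delta> C0 \<epsilon> A by (rule assms)
  have bo: "bounded_operator_L2 M T" using assms(2) by (simp add: cz_operator_def)
  obtain K where K: "cz_kernel M \<rho> K" "\<forall>f\<in>L2_space M. AE x in M. x \<notin> ae_support M \<rho> f \<longrightarrow> T f x = (LINT y|M. K x y * f y)"
    using assms(2) unfolding cz_operator_def by (elim conjE exE) (rule that)
  obtain \<eta> CK :: real where e: "0 < \<eta>" and k: "\<forall>x0\<in>space M. \<forall>y\<in>space M. x0 \<noteq> y \<longrightarrow>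
      \<bar>K x0 y\<bar> \<le> CK / mu (bl x0 (\<rho> x0 y)) \<and>
      (\<forall>x\<in>space M. x \<noteq> y \<longrightarrow> \<rho> x0 x \<le> \<eta> * \<rho> x0 y \<longrightarrow>
         \<bar>K x y - K x0 y\<bar> \<le> (\<rho> x x0 / \<rho> x0 y) powr \<eta> * (1 / mu (bl x0 (\<rho> x0 y))) \<and>
         \<bar>K y x - K y x0\<bar> \<le> (\<rho> x x0 / \<rho> x0 y) powr \<eta> * (1 / mu (bl x0 (\<rho> x0 y))))"
    using K(1) unfolding cz_kernel_def by (elim conjE exE) (rule that)
  obtain B :: real where B: "\<forall>f\<in>L2_space M. L2_norm M (T f) \<le> ennreal B * L2_norm M f"
    using bo unfolding bounded_operator_L2_def by (elim conjE exE) (rule that)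
  have TL: "T f \<in> L2_space M" if "f \<in> L2_space M" for f using bo that by (simp add: bounded_operator_L2_def)
  \<comment> \<open>The norm constant may be negative as given; the locale wants its nonnegative
    part, squared.\<close>
  have "cz_space M \<rho> \<kappa> D S \<delta> C0 \<epsilon> A T K \<eta> CK ((max 0 B)^2)"
  proof
    show "T f \<in> L2_space M" if "f \<in> L2_space M" for f by (rule TL[OF that])
    show "AE x in M. T (\<lambda>y. a * f y + b * g y) x = a * T f x + b * T g x"
      if "f \<in> L2_space M" "g \<in> L2_space M" for f g a b
    proof -
      have "\<forall>f\<in>L2_space M. \<forall>g\<in>L2_space M. \<forall>a b.
          AE x in M. T (\<lambda>y. a * f y + b * g y) x = a * T f x + b * T g x"
        using bo unfolding bounded_operator_L2_def by (elim conjE)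
      then show ?thesis using that by blast
    qed
    show "(LINT x|M. (T f x)^2) \<le> (max 0 B)^2 * (LINT x|M. (f x)^2)" if f: "f \<in> L2_space M" for f
    proof -
      have "ennreal (sqrt (LINT x|M. (T f x)^2)) \<le> ennreal B * ennreal (sqrt (LINT x|M. (f x)^2))"
        using bspec[OF B f] L2_norm_eq[of M f] L2_norm_eq[of M "T f"] f TL[OF f] by (simp add: L2_space_iff)
      also have "ennreal B = ennreal (max 0 B)" by (simp add: ennreal_max_0)
      also have "ennreal (max 0 B) * ennreal (sqrt (LINT x|M. (f x)^2)) = ennreal (max 0 B * sqrt (LINT x|M. (f x)^2))"
        by (simp add: ennreal_mult'')
      finally have "sqrt (LINT x|M. (T f x)^2) \<le> max 0 B * sqrt (LINT x|M. (f x)^2)"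
        by (subst (asm) ennreal_le_iff) auto
      then have "(sqrt (LINT x|M. (T f x)^2))^2 \<le> (max 0 B * sqrt (LINT x|M. (f x)^2))^2"
        by (rule power_mono) simp
      then show ?thesis by (simp add: power_mult_distrib)
    qed
  qed (use e k K(2) in auto)
  then show thesis by (rule that)
qed

theorem theorem3p7:
  fixes M :: "'a measure"
    and \<rho> :: "'a \<Rightarrow> 'a \<Rightarrow> real"
    and S :: "(int \<Rightarrow> 'a set set) set"
    and T :: "('a \<Rightarrow> real) \<Rightarrow> 'a \<Rightarrow> real"
  assumes "homogeneous_type M \<rho>"
    and "adjacent_dyadic_systems M \<rho> S"
    and "cz_operator M \<rho> T"
  shows "\<exists>C::real. 0 < C \<and>
    (\<forall>w \<sigma>. A2_weight M \<rho> S w \<longrightarrow> \<sigma> = (\<lambda>x. inverse (w x)) \<longrightarrow>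
      (\<forall>f \<in> L2_space M \<inter> L2_space (weighted M w).
         L2_norm (weighted M w) (T f) \<le>
           ennreal C * ennreal_sqrt (A2_const M S w) *
             ennreal_sqrt (Ainf_const M S w + Ainf_const M S \<sigma>) *
             L2_norm (weighted M w) f))"
proof -
  obtain \<kappa> D where hs: "homogeneous_space M \<rho> \<kappa> D" using assms(1) by (rule homogeneous_type_locale)
  obtain \<delta> C0 \<epsilon> A where as: "adjacent_space M \<rho> \<kappa> D S \<delta> C0 \<epsilon> A" using hs assms(2) by (rule adjacent_locale)
  obtain K \<eta> CK Bn where cz: "cz_space M \<rho> \<kappa> D S \<delta> C0 \<epsilon> A T K \<eta> CK Bn" using as assms(3) by (rule cz_locale)
  interpret cz_space M \<rho> \<kappa> D S \<delta> C0 \<epsilon> A T K \<eta> CK Bn by (rule cz)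
  obtain c where c: "dominates c" using ex_dominates by auto
  \<comment> \<open>This is the value of \<open>sparse_const\<close>, written out because
    \<open>C\<close> has to be fixed before the weight and the locale that provides that
    name.\<close>
  define sc where "sc = 2 * card S * 64 * (2 * cd) * (2 * cd) * (256 * real (card S))"
  define C where "C = sqrt (c^2 * sc) + 1"
  have sc0: "0 \<le> sc" unfolding sc_def using cd_pos by simp
  have C0: "0 < C" "sqrt (c^2 * sc) \<le> C" unfolding C_def using sc0 by (auto intro: add_nonneg_pos)
  show ?thesis
  proof (intro exI[of _ C] conjI allI impI ballI C0(1))
    fix w \<sigma> f
    assume w: "A2_weight M \<rho> S w" and \<sigma>: "\<sigma> = (\<lambda>x. inverse (w x))"
      and f: "f \<in> L2_space M \<inter> L2_space (weighted M w)"
    let ?N = "weighted M w"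
    have fM: "f \<in> L2_space M" and fN: "f \<in> borel_measurable ?N" "integrable ?N (\<lambda>x. (f x)^2)"
      using f by (auto simp: L2_space_iff)
    have wm[measurable]: "w \<in> borel_measurable M" and wp: "AE x in M. 0 < w x"
      using w by (auto simp: A2_weight_def weight_def)
    have AE_N: "AE x in ?N. P x" if "AE x in M. P x" for P
      unfolding weighted_def using that by (subst AE_density) (auto elim: eventually_mono)
    have AE_M: "AE x in M. P x" if "AE x in ?N. P x" for P
    proof -
      have "AE x in M. 0 < ennreal (w x) \<longrightarrow> P x" using that unfolding weighted_def by (subst (asm) AE_density) auto
      with wp show ?thesis by eventually_elim simp
    qed
    show "L2_norm ?N (T f) \<le> ennreal C * ennreal_sqrt (A2_const M S w) *
        ennreal_sqrt (Ainf_const M S w + Ainf_const M S \<sigma>) * L2_norm ?N f"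
    \<comment> \<open>For norm 0 the right side is 0 even if the other factors are infinite, so the
      left side must be shown to vanish.\<close>
    proof (cases "L2_norm ?N f = 0")
      case True
      then have "sqrt (LINT x|?N. (f x)^2) = 0" using L2_norm_eq[OF fN(2)] by simp
      then have "AE x in ?N. (f x)^2 = 0" using fN(2) by (simp add: integral_nonneg_eq_0_iff_AE)
      then have "AE x in M. f x = 0" using AE_M by simp
      then have "AE x in ?N. T f x = 0" by (intro AE_N T_AE_zero[OF fM])
      then have "(\<integral>\<^sup>+x. ennreal ((T f x)^2) \<partial>?N) = (\<integral>\<^sup>+x. 0 \<partial>?N)"
        by (intro nn_integral_cong_AE) (auto elim: eventually_mono)
      then have "L2_norm ?N (T f) = 0" by (simp add: L2_norm_def ennreal_sqrt_def)
      then show ?thesis by simp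
    next
      case False
      have ne: "X \<noteq> {}"
      proof
        assume "X = {}"
        then have "space ?N = {}" by (simp add: weighted_def)
        then have "(\<integral>\<^sup>+x. ennreal ((f x)^2) \<partial>?N) = 0" by (rule nn_integral_empty)
        then show False using False by (simp add: L2_norm_def ennreal_sqrt_def)
      qed
      show ?thesis
      \<comment> \<open>If the sum is infinite, so is the right side: the A2 constant is positive
        and the norm of \<open>f\<close> is nonzero.\<close>
      proof (cases "Ainf_const M S w + Ainf_const M S \<sigma> = \<infinity>")
        case True
        obtain x0 where "x0 \<in> X" using ne by auto
        then obtain Q where Q: "Q \<in> cubes S" using adjacent[of x0 1] by auto
        have "0 < A2_const M S w"
        proof -
          have wi: "(\<lambda>x. inverse (w x)) \<in> borel_measurable M" by measurable
          have pos: "0 < (\<integral>\<^sup>+x\<in>Q. ennreal (w x) \<partial>M)" "0 < (\<integral>\<^sup>+x\<in>Q. ennreal (inverse (w x)) \<partial>M)"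
            using emeasure_weighted_pos[OF wm wp Q] emeasure_weighted[OF wm adj_sets[OF Q]]
              emeasure_weighted_pos[OF wi _ Q] emeasure_weighted[OF wi adj_sets[OF Q]] wp by auto
          have "0 < (\<integral>\<^sup>+x\<in>Q. ennreal (w x) \<partial>M) / emeasure M Q * ((\<integral>\<^sup>+x\<in>Q. ennreal (inverse (w x)) \<partial>M) / emeasure M Q)"
            using pos by (simp add: ennreal_zero_less_mult_iff ennreal_zero_less_divide adj_emeasure[OF Q])
          also have "\<dots> \<le> A2_const M S w" unfolding A2_const_def by (rule SUP_upper[OF Q])
          finally show ?thesis .
        qed
        moreover have "A2_const M S w < \<infinity>" using w by (simp add: A2_weight_def)
        ultimately have "0 < ennreal_sqrt (A2_const M S w)"
          by (cases "A2_const M S w") (auto simp: ennreal_sqrt_def)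
        then have "ennreal C * ennreal_sqrt (A2_const M S w) * ennreal_sqrt \<infinity> * L2_norm ?N f = \<infinity>"
          using C0(1) False by (simp add: ennreal_sqrt_def ennreal_mult_top ennreal_top_mult)
        then show ?thesis unfolding True by simp
      next
        case fin: False
        interpret cz_weight M \<rho> \<kappa> D S \<delta> C0 \<epsilon> A T K \<eta> CK Bn w
          by unfold_locales (use w fin \<sigma> in \<open>auto simp: less_top\<close>)
        have \<sigma>e: "\<sigma> = local.\<sigma>" unfolding \<sigma> \<sigma>_def ..
        let ?V = "LINT x|?N. (f x)^2"
        have "(\<integral>\<^sup>+x. ennreal ((T f x)^2) \<partial>?N) \<le> ennreal (c^2 * sparse_const * a2 * ainf * ?V)"
          using weighted_bound[OF c fM _ ne] fN(2) unfolding N2_def by simp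
        then have "L2_norm ?N (T f) \<le> ennreal (sqrt (c^2 * sparse_const * a2 * ainf * ?V))"
          unfolding L2_norm_def by (rule ennreal_sqrt_le)
        also have "sqrt (c^2 * sparse_const * a2 * ainf * ?V) = sqrt (c^2 * sc) * sqrt a2 * sqrt ainf * sqrt ?V"
          by (simp add: real_sqrt_mult sparse_const_def sc_def)
        also have "ennreal \<dots> \<le> ennreal (C * sqrt a2 * sqrt ainf * sqrt ?V)"
          using C0(2) a2_nonneg ainf_nonneg by (intro ennreal_leI mult_right_mono) auto
        also have "\<dots> = ennreal C * ennreal (sqrt a2) * ennreal (sqrt ainf) * ennreal (sqrt ?V)"
          using C0(1) a2_nonneg ainf_nonneg by (simp add: ennreal_mult)
        also have "ennreal (sqrt a2) = ennreal_sqrt (A2_const M S w)"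
          using w by (simp add: ennreal_sqrt_def a2_def A2_weight_def less_top)
        also have "ennreal (sqrt ainf) = ennreal_sqrt (Ainf_const M S w + Ainf_const M S \<sigma>)"
          using fin by (simp add: ennreal_sqrt_def ainf_def \<sigma>e)
        also have "ennreal (sqrt ?V) = L2_norm ?N f" by (rule L2_norm_eq[OF fN(2), symmetric])
        finally show ?thesis .
      qed
    qed
  qed
qed

end
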